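(* Let $\varphi_0=\mathrm{Id}$ and $\varphi_1\in H^n([0,1])$ with $n\ge3$ be two diffeomorphisms in $\mathrm{Diff}_0^2([0,1])$. Then, for every geodesic of $(\mathrm{Diff}_0^2([0,1]),G)$ joining $\varphi_0$ and $\varphi_1$, the initial tangent vector lies in $H^n([0,1])$.
   Context: $H_0^2([0,1])$ is the space of $H^2$ functions on $[0,1]$ vanishing together with their first derivative at $0$ and $1$. $\mathrm{Diff}_0^2([0,1])=\{\mathrm{Id}+f:\ f\in H_0^2([0,1]),\ 1+f'(x)>0\}$. It carries the right-invariant Riemannian metric $G_\varphi(X,Y)=\int_0^1\partial_{xx}(X\circ\varphi^{-1})\,\partial_{xx}(Y\circ\varphi^{-1})\,dx$ for $X,Y\in T_\varphi\mathrm{Diff}_0^2([0,1])\cong H_0^2([0,1])$. A geodesic joining $\varphi_0$ and $\varphi_1$ is a geodesic $t\in[0,1]\mapsto\varphi(t)$ with $\varphi(0)=\varphi_0$, $\varphi(1)=\varphi_1$; its initial tangent vector is $\dot\varphi(0)$. Here $n$ is an integer. *)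

theory Defs
  imports "HOL-Analysis.Analysis"
begin

text \<open>Elements of the function spaces over \<open>[0,1]\<close> are functions on \<open>\<real>\<close> of which only the
  values on \<open>[0,1]\<close> are ever used. The integral is the Lebesgue integral over \<open>[0,1]\<close>.\<close>

definition L2 :: "(real \<Rightarrow> real) \<Rightarrow> bool" where
  "L2 f \<longleftrightarrow> set_borel_measurable lebesgue {0..1} f \<and>
     set_integrable lebesgue {0..1} (\<lambda>x. (f x)\<^sup>2)"

text \<open>\<open>\<eta>\<close> is a \<open>C\<^sup>1\<close> function with compact support in the open interval \<open>(0,1)\<close>, and \<open>\<eta>'\<close>
  is its derivative.\<close>

definition test_function :: "(real \<Rightarrow> real) \<Rightarrow> (real \<Rightarrow> real) \<Rightarrow> bool" where
  "test_function \<eta> \<eta>' \<longleftrightarrow> (\<forall>x. (\<eta> has_real_derivative \<eta>' x) (at x)) \<and> continuous_on UNIV \<eta>' \<and>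
     (\<exists>a b. 0 < a \<and> b < 1 \<and> (\<forall>x. x \<notin> {a..b} \<longrightarrow> \<eta> x = 0))"

definition weak_deriv :: "(real \<Rightarrow> real) \<Rightarrow> (real \<Rightarrow> real) \<Rightarrow> bool" where
  "weak_deriv f g \<longleftrightarrow> L2 f \<and> L2 g \<and>
     (\<forall>\<eta> \<eta>'. test_function \<eta> \<eta>' \<longrightarrow>
        (LINT x:{0..1}|lebesgue. f x * \<eta>' x) = - (LINT x:{0..1}|lebesgue. g x * \<eta> x))"

text \<open>The weak derivative is determined almost everywhere only; \<open>wderiv\<close> picks a representative
  and is used only under integrals or under a further \<open>wderiv\<close>.\<close>

definition wderiv :: "(real \<Rightarrow> real) \<Rightarrow> real \<Rightarrow> real" where
  "wderiv f = (SOME g. weak_deriv f g)"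

text \<open>Membership in the Sobolev space \<open>H\<^sup>n([0,1])\<close>.\<close>

primrec sobolev :: "nat \<Rightarrow> (real \<Rightarrow> real) \<Rightarrow> bool" where
  "sobolev 0 f \<longleftrightarrow> L2 f"
| "sobolev (Suc n) f \<longleftrightarrow> (\<exists>g. weak_deriv f g \<and> sobolev n g)"

definition sobolev_norm :: "nat \<Rightarrow> (real \<Rightarrow> real) \<Rightarrow> real" where
  "sobolev_norm n f = sqrt (\<Sum>k\<le>n. LINT x:{0..1}|lebesgue. ((wderiv ^^ k) f x)\<^sup>2)"

text \<open>The space \<open>H\<^sub>0\<^sup>2([0,1])\<close>. Continuity selects the continuous representative; together
  with \<open>sobolev 2 f\<close> it makes \<open>f\<close> continuously differentiable on \<open>[0,1]\<close>, so that its classical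
  (at the endpoints one-sided) derivative can be used pointwise, here and in \<open>Diff2_0\<close>.\<close>

definition H2_0 :: "(real \<Rightarrow> real) set" where
  "H2_0 = {f. continuous_on {0..1} f \<and> sobolev 2 f \<and> f 0 = 0 \<and> f 1 = 0 \<and>
     (f has_real_derivative 0) (at 0 within {0..1}) \<and>
     (f has_real_derivative 0) (at 1 within {0..1})}"

definition Diff2_0 :: "(real \<Rightarrow> real) set" where
  "Diff2_0 = {\<phi>. \<exists>f\<in>H2_0. (\<forall>x\<in>{0..1}. \<phi> x = x + f x) \<and>
     (\<forall>x\<in>{0..1}. \<exists>d. (f has_real_derivative d) (at x within {0..1}) \<and> 1 + d > 0)}"

definition G :: "(real \<Rightarrow> real) \<Rightarrow> (real \<Rightarrow> real) \<Rightarrow> (real \<Rightarrow> real) \<Rightarrow> real" where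
  "G \<phi> X Y = (LINT x:{0..1}|lebesgue.
     wderiv (wderiv (X \<circ> inv_into {0..1} \<phi>)) x * wderiv (wderiv (Y \<circ> inv_into {0..1} \<phi>)) x)"

text \<open>\<open>Diff2_0\<close> is an open subset of the affine space \<open>Id + H2_0\<close>, hence a manifold with a single
  chart. \<open>G_deriv \<phi> Z X Y\<close> is the derivative of \<open>G\<close> with respect to its base point \<open>\<phi>\<close> in
  the direction \<open>Z\<close>, for constant \<open>X\<close> and \<open>Y\<close>.\<close>

definition G_deriv ::
  "(real \<Rightarrow> real) \<Rightarrow> (real \<Rightarrow> real) \<Rightarrow> (real \<Rightarrow> real) \<Rightarrow> (real \<Rightarrow> real) \<Rightarrow> real" where
  "G_deriv \<phi> Z X Y = deriv (\<lambda>s. G (\<lambda>x. \<phi> x + s * Z x) X Y) 0"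

text \<open>\<open>C\<close> is the value \<open>\<Gamma>\<^sub>\<phi>(X,Y)\<close> of the Christoffel symbol of the Levi-Civita connection of
  \<open>G\<close> in this chart, characterised by the Koszul formula for constant vector fields.\<close>

definition christoffel ::
  "(real \<Rightarrow> real) \<Rightarrow> (real \<Rightarrow> real) \<Rightarrow> (real \<Rightarrow> real) \<Rightarrow> (real \<Rightarrow> real) \<Rightarrow> bool" where
  "christoffel \<phi> X Y C \<longleftrightarrow> C \<in> H2_0 \<and>
     (\<forall>Z\<in>H2_0. 2 * G \<phi> C Z = G_deriv \<phi> X Y Z + G_deriv \<phi> Y X Z - G_deriv \<phi> Z X Y)"

text \<open>Curves are defined on the time interval \<open>[0,1]\<close>; limits are taken in the \<open>H\<^sup>2\<close> norm and are
  one-sided at the endpoints.\<close>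

definition curve_deriv :: "(real \<Rightarrow> real \<Rightarrow> real) \<Rightarrow> real \<Rightarrow> (real \<Rightarrow> real) \<Rightarrow> bool" where
  "curve_deriv c t v \<longleftrightarrow> v \<in> H2_0 \<and>
     ((\<lambda>s. sobolev_norm 2 (\<lambda>x. (c s x - c t x) / (s - t) - v x)) \<longlongrightarrow> 0) (at t within {0..1})"

definition curve_continuous :: "(real \<Rightarrow> real \<Rightarrow> real) \<Rightarrow> bool" where
  "curve_continuous c \<longleftrightarrow> (\<forall>t\<in>{0..1}.
     ((\<lambda>s. sobolev_norm 2 (\<lambda>x. c s x - c t x)) \<longlongrightarrow> 0) (at t within {0..1}))"

text \<open>A geodesic is a \<open>C\<^sup>2\<close> curve with vanishing covariant acceleration: in the chart,
  \<open>\<phi>\<^sub>t\<^sub>t + \<Gamma>\<^sub>\<phi>(\<phi>\<^sub>t,\<phi>\<^sub>t) = 0\<close>.\<close>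

definition geodesic :: "(real \<Rightarrow> real \<Rightarrow> real) \<Rightarrow> bool" where
  "geodesic c \<longleftrightarrow> (\<forall>t\<in>{0..1}. c t \<in> Diff2_0) \<and>
     (\<exists>V A. (\<forall>t\<in>{0..1}. curve_deriv c t (V t) \<and> curve_deriv V t (A t)) \<and>
        curve_continuous A \<and>
        (\<forall>t\<in>{0..1}. \<exists>C. christoffel (c t) (V t) (V t) C \<and> (\<forall>x\<in>{0..1}. A t x + C x = 0)))"

definition geodesic_joining ::
  "(real \<Rightarrow> real \<Rightarrow> real) \<Rightarrow> (real \<Rightarrow> real) \<Rightarrow> (real \<Rightarrow> real) \<Rightarrow> bool" where
  "geodesic_joining c \<phi>\<^sub>0 \<phi>\<^sub>1 \<longleftrightarrow> geodesic c \<and>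
     (\<forall>x\<in>{0..1}. c 0 x = \<phi>\<^sub>0 x) \<and> (\<forall>x\<in>{0..1}. c 1 x = \<phi>\<^sub>1 x)"

end

theory Submission
  imports Defs
begin

text \<open>Let \<open>p\<close> be the spatial derivative of \<open>\<phi>(t)\<close> and \<open>\<lambda> = ln p\<close>. The metric is
  \<open>G\<^sub>\<phi>(\<phi>\<^sub>t,\<phi>\<^sub>t) = \<integral> \<lambda>\<^sub>t\<^sub>x\<^sup>2 * exp (- \<lambda>)\<close>, and the geodesic equation, tested against all admissible
  directions, says that the momentum \<open>m = \<lambda>\<^sub>t\<^sub>x * exp (- \<lambda>)\<close> satisfies \<open>m\<^sub>t = W\<close>, where
  \<open>W(t,x) = \<integral>\<^sub>0\<^sup>x p * m\<^sup>2 / 2 + C(t) * \<phi>(t,x) + B(t)\<close> is one degree smoother in \<open>x\<close> than \<open>m\<^sup>2\<close>. Hence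
  \<open>m(t) = m(0) + N(t)\<close> with \<open>N\<close> the time integral of \<open>W\<close>. Integrating \<open>\<lambda>\<^sub>t\<^sub>x = p * m\<close> over \<open>[0,1]\<close> and
  using \<open>\<lambda>(0) = 0\<close> gives \<open>\<lambda>\<^sub>x(1) = m(0) * P + Q\<close> with \<open>P = \<integral> p dt > 0\<close> and \<open>Q = \<integral> p * N dt\<close>,
  so \<open>m(0) = (\<lambda>\<^sub>x(1) - Q) / P\<close>. Here \<open>\<lambda>\<^sub>x(1)\<close> is the quotient of the second and the first derivative
  of \<open>\<phi>\<^sub>1\<close>, while \<open>p\<close>, \<open>P\<close> and \<open>Q\<close> have one more derivative than \<open>m(0)\<close>. So \<open>m(0)\<close>, which is the second
  derivative of the initial velocity, inherits the regularity of the second derivative of \<open>\<phi>\<^sub>1\<close>.\<close>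

section \<open>Integrable functions and primitives on the unit interval\<close>

text \<open>A geodesic moves in H2 only, so the second space derivatives \<open>q\<close>,
  \<open>V2\<close>, \<open>A2\<close> of position, velocity and acceleration are L2 functions,
  fixed up to a null set at each time separately. They are differentiated in time as curves in L2,
  while \<open>p\<close>, \<open>V1\<close>, \<open>A1\<close> are jointly continuous in time and
  space; the computation therefore rests on product rules that mix L2, L1 and uniform convergence.

  The rough part \<open>m(0)\<close> does not depend on time. One function of x alone thus holds all
  the irregularity, and the single equation at time 1 determines it. The condition n >= 3 starts the
  bootstrap: the second derivative of \<open>\<phi>\<^sub>1\<close> then lies in H1 and is
  continuous up to a null set, so \<open>m(0)\<close> has a continuous representative. Intermediate
  steps count classical derivatives of the coefficients, jointly continuous in time because
  \<open>N\<close> and \<open>Q\<close> collect all times. Only the last step returns to Sobolev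
  spaces, since the embedding of H^(k+1) into C^k would otherwise cost one derivative.\<close>

abbreviation ae :: "(real \<Rightarrow> bool) \<Rightarrow> bool" where
  "ae P \<equiv> (AE x in lebesgue_on {0..1}. P x)"

abbreviation L1 :: "(real \<Rightarrow> real) \<Rightarrow> bool" where
  "L1 f \<equiv> f absolutely_integrable_on {0..1}"

lemmas HK_integral_cong = Henstock_Kurzweil_Integration.integral_cong

text \<open>Links the almost-everywhere filter, convenient for \<open>eventually_elim\<close>, with
  the negligible exceptional sets that the spike rules of the gauge integral expect.\<close>

lemma ae_iff_negligible: "ae P \<longleftrightarrow> negligible {x\<in>{0..1}. \<not> P x}"
proof -
  have "ae P \<longleftrightarrow> (\<exists>N. N \<in> null_sets lebesgue \<and> N \<subseteq> {0..1} \<and> {x\<in>{0..1}. \<not> P x} \<subseteq> N)"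
    unfolding eventually_ae_filter by (auto simp: null_sets_restrict_space)
  also have "\<dots> \<longleftrightarrow> negligible {x\<in>{0..1}. \<not> P x}"
    by (metis (no_types, lifting) negligible_iff_null_sets negligible_subset mem_Collect_eq
        subsetI)
  finally show ?thesis .
qed

lemma aeI: "(\<And>x. x \<in> {0..1} \<Longrightarrow> P x) \<Longrightarrow> ae P"
  by (rule AE_I2) simp

lemma ae_eq_sym: "ae (\<lambda>x. f x = g x) \<Longrightarrow> ae (\<lambda>x. g x = f x)"
  by (auto elim: eventually_mono)

lemma L1_cong_ae: "L1 f \<Longrightarrow> ae (\<lambda>x. g x = f x) \<Longrightarrow> L1 g"
  unfolding ae_iff_negligible by (erule absolutely_integrable_spike) auto

lemma integral_cong_ae:
  assumes "ae (\<lambda>x. f x = g x)" "{a..b} \<subseteq> {0..1}"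
  shows "integral {a..b} f = integral {a..b} g"
  using assms unfolding ae_iff_negligible by (intro integral_spike) auto

lemma L1_subinterval: "L1 f \<Longrightarrow> {a..b} \<subseteq> {0..1} \<Longrightarrow> f absolutely_integrable_on {a..b}"
  by (rule absolutely_integrable_on_subinterval)

lemma L1_integrable: "L1 f \<Longrightarrow> {a..b} \<subseteq> {0..1} \<Longrightarrow> f integrable_on {a..b}"
  using L1_subinterval set_lebesgue_integral_eq_integral(1) by blast

lemma L1_cont: "continuous_on {0..1} f \<Longrightarrow> L1 f"
  by (rule absolutely_integrable_continuous_real)

lemma L1_measurable: "L1 f \<Longrightarrow> f \<in> borel_measurable (lebesgue_on {0..1})"
  by (simp add: absolutely_integrable_measurable)

lemma L1_mult_cont:
  assumes "L1 f" "continuous_on {0..1} g" shows "L1 (\<lambda>x. f x * g x)"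
proof -
  have "L1 (\<lambda>x. g x * f x)"
    using assms(2)
    by (intro absolutely_integrable_bounded_measurable_product_real L1_measurable[OF L1_cont] assms(1))
      (auto intro!: compact_imp_bounded compact_continuous_image)
  then show ?thesis by (simp add: mult.commute)
qed

text \<open>On an interval of finite length square integrability implies integrability, because 2|u|
  <= 1 + u^2. Measurability is then contained in \<open>L1\<close>, so that \<open>L2\<close>
  amounts to two integrability facts.\<close>

lemma L2_iff: "L2 f \<longleftrightarrow> L1 f \<and> L1 (\<lambda>x. (f x)\<^sup>2)"
proof -
  have "L1 f" if "L2 f"
  proof -
    have m: "f \<in> borel_measurable (lebesgue_on {0..1})"
      using that unfolding L2_def set_borel_measurable_def
      by (subst borel_measurable_restrict_space_iff) auto
    have sq: "L1 (\<lambda>x. (f x)\<^sup>2)" using that by (simp add: L2_def)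
    have "L1 (\<lambda>x. 1 + (f x)\<^sup>2)"
      using sq by (intro set_integral_add(1)) (auto intro: L1_cont)
    then have i: "(\<lambda>x. 1 + (f x)\<^sup>2) integrable_on {0..1}"
      using L1_integrable by blast
    show ?thesis
    proof (rule measurable_bounded_by_integrable_imp_absolutely_integrable[OF m _ i])
      fix x :: real
      have "0 \<le> (\<bar>f x\<bar> - 1)\<^sup>2" by simp
      then have "2 * \<bar>f x\<bar> \<le> 1 + (f x)\<^sup>2" unfolding power2_diff by simp
      then show "norm (f x) \<le> 1 + (f x)\<^sup>2" by simp
    qed auto
  qed
  moreover have "set_borel_measurable lebesgue {0..1} f" if "L1 f"
    using that unfolding set_integrable_def set_borel_measurable_def by auto
  ultimately show ?thesis by (auto simp: L2_def)
qed

lemma L2_imp_L1: "L2 f \<Longrightarrow> L1 f" and L2_square: "L2 f \<Longrightarrow> L1 (\<lambda>x. (f x)\<^sup>2)"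
  by (simp_all add: L2_iff)

lemma L2_measurable: "L2 f \<Longrightarrow> f \<in> borel_measurable (lebesgue_on {0..1})"
  by (simp add: L1_measurable L2_imp_L1)

lemma L2_mult: assumes "L2 f" "L2 g" shows "L1 (\<lambda>x. f x * g x)"
proof (rule measurable_bounded_by_integrable_imp_absolutely_integrable)
  show "(\<lambda>x. f x * g x) \<in> borel_measurable (lebesgue_on {0..1})"
    using L2_measurable[OF assms(1)] L2_measurable[OF assms(2)] by measurable
  have "L1 (\<lambda>x. (f x)\<^sup>2 + (g x)\<^sup>2)"
    using assms by (intro set_integral_add(1) L2_square)
  then show "(\<lambda>x. (f x)\<^sup>2 + (g x)\<^sup>2) integrable_on {0..1}" using L1_integrable by blast
  fix x :: real
  have "0 \<le> (\<bar>f x\<bar> - \<bar>g x\<bar>)\<^sup>2" by simp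
  moreover have "0 \<le> \<bar>f x\<bar> * \<bar>g x\<bar>" by simp
  ultimately show "norm (f x * g x) \<le> (f x)\<^sup>2 + (g x)\<^sup>2"
    unfolding power2_diff by (simp add: abs_mult, linarith)
qed auto

lemma L2_add: assumes "L2 f" "L2 g" shows "L2 (\<lambda>x. f x + g x)"
proof -
  have "L1 (\<lambda>x. (f x)\<^sup>2 + 2 * (f x * g x) + (g x)\<^sup>2)"
    using assms by (intro set_integral_add(1) L2_square set_integrable_mult_right L2_mult)
  then show ?thesis
    using assms by (auto simp: L2_iff power2_sum algebra_simps intro: set_integral_add(1))
qed

lemma L2_mult_cont:
  assumes "L2 f" "continuous_on {0..1} g" shows "L2 (\<lambda>x. f x * g x)"
  using assms unfolding L2_iff power_mult_distrib by (intro conjI L1_mult_cont continuous_intros) auto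

lemma L2_cont: "continuous_on {0..1} f \<Longrightarrow> L2 f"
  unfolding L2_iff by (auto intro!: L1_cont continuous_intros)

lemma L2_cmult: "L2 f \<Longrightarrow> L2 (\<lambda>x. c * f x)"
  using L2_mult_cont[of f "\<lambda>_. c"] by (simp add: mult.commute)

lemma L2_diff: "L2 f \<Longrightarrow> L2 g \<Longrightarrow> L2 (\<lambda>x. f x - g x)"
  using L2_add[of f "\<lambda>x. (-1) * g x"] L2_cmult[of g "-1"] by simp

lemma L2_cong_ae: "L2 f \<Longrightarrow> ae (\<lambda>x. g x = f x) \<Longrightarrow> L2 g"
  unfolding L2_iff by (blast intro: L1_cong_ae eventually_mono[where Q="\<lambda>x. (g x)\<^sup>2 = (f x)\<^sup>2"] arg_cong[where f="\<lambda>u. u\<^sup>2"])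

lemma LINT_eq: "L1 f \<Longrightarrow> (LINT x:{0..1}|lebesgue. f x) = integral {0..1} f"
  by (rule set_lebesgue_integral_eq_integral)

lemma integral_add': "L1 f \<Longrightarrow> L1 g \<Longrightarrow> {a..b} \<subseteq> {0..1} \<Longrightarrow>
   integral {a..b} (\<lambda>x. f x + g x) = integral {a..b} f + integral {a..b} g"
  by (intro Henstock_Kurzweil_Integration.integral_add L1_integrable)

lemma integral_diff': "L1 f \<Longrightarrow> L1 g \<Longrightarrow> {a..b} \<subseteq> {0..1} \<Longrightarrow>
   integral {a..b} (\<lambda>x. f x - g x) = integral {a..b} f - integral {a..b} g"
  by (intro Henstock_Kurzweil_Integration.integral_diff L1_integrable)

lemma L2_zero_ae:
  assumes "L2 f" "integral {0..1} (\<lambda>x. (f x)\<^sup>2) = 0"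
  shows "ae (\<lambda>x. f x = 0)"
proof -
  have i: "integrable (lebesgue_on {0..1}) (\<lambda>x. (f x)\<^sup>2)"
    using L2_square[OF assms(1)] by (rule absolutely_integrable_imp_integrable) simp
  have "integral\<^sup>L (lebesgue_on {0..1}) (\<lambda>x. (f x)\<^sup>2) = 0"
    using assms i by (simp add: lebesgue_integral_eq_integral)
  then have "ae (\<lambda>x. (f x)\<^sup>2 = 0)"
    using i by (subst (asm) integral_nonneg_eq_0_iff_AE) auto
  then show ?thesis by simp
qed

text \<open>Lebesgue differentiation: outside a null set \<open>f x\<close> is the limit of the
  averages over \<open>{x..x + h}\<close>, and all of these vanish. The extension \<open>f0\<close>
  by zero supplies integrability on every interval; the point 1 joins the exceptional set because
  averages to its right leave the unit interval.\<close>

lemma integral_zero_ae: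
  assumes "L1 f" "\<And>x. x \<in> {0..1} \<Longrightarrow> integral {0..x} f = 0"
  shows "ae (\<lambda>x. f x = 0)"
proof -
  define f0 where "f0 = (\<lambda>x. if x \<in> {0..1} then f x else 0)"
  have z: "integral {a..b} f = 0" if "0 \<le> a" "a \<le> b" "b \<le> 1" for a b
    using Henstock_Kurzweil_Integration.integral_combine[of 0 a b f] L1_integrable[OF assms(1), of 0 b]
       assms(2)[of a] assms(2)[of b] that by auto
  have "f0 integrable_on UNIV"
    using L1_integrable[OF assms(1)] unfolding f0_def integrable_restrict_UNIV by auto
  then have int: "f0 integrable_on cbox a b" for a b
    by (rule integrable_on_subcbox) auto
  obtain N where N: "negligible N"
    and k: "\<And>x e. \<lbrakk>x \<notin> N; 0 < e\<rbrakk> \<Longrightarrow> \<exists>d>0. \<forall>h. 0 < h \<and> h < d \<longrightarrow>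
                  norm (integral (cbox x (x + h *\<^sub>R One)) f0 /\<^sub>R h ^ DIM(real) - f0 x) < e"
    using integrable_ccontinuous_explicit[of f0] int by blast
  have "f x = 0" if x: "x \<in> {0..<1}" "x \<notin> N" for x
  proof (rule ccontr)
    assume "f x \<noteq> 0"
    then obtain d where d: "d > 0" "\<And>h. 0 < h \<Longrightarrow> h < d \<Longrightarrow>
        norm (integral (cbox x (x + h *\<^sub>R One)) f0 /\<^sub>R h ^ DIM(real) - f0 x) < \<bar>f x\<bar>"
      using k[OF x(2), of "\<bar>f x\<bar>"] by auto
    define h where "h = min (d/2) (1 - x)"
    have h: "0 < h" "h < d" "x + h \<le> 1" using d x by (auto simp: h_def)
    have "integral {x..x+h} f0 = integral {x..x+h} f"
      using x h by (intro HK_integral_cong) (auto simp: f0_def)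
    also have "\<dots> = 0" using x h by (intro z) auto
    finally show False using d(2)[OF h(1,2)] x by (auto simp: f0_def)
  qed
  then have "{x\<in>{0..1}. f x \<noteq> 0} \<subseteq> N \<union> {1}" by (auto simp: less_le)
  then show ?thesis unfolding ae_iff_negligible
    by (rule negligible_subset[rotated]) (intro negligible_Un N negligible_sing)
qed

section \<open>Absolutely continuous functions\<close>

text \<open>This is absolute continuity of \<open>F\<close> on the unit interval with
  almost-everywhere derivative \<open>f\<close>. The integral form lets \<open>f\<close> be replaced
  by any function equal to it almost everywhere and asks for no pointwise derivative.\<close>

definition prim :: "(real \<Rightarrow> real) \<Rightarrow> (real \<Rightarrow> real) \<Rightarrow> bool" where
  "prim F f \<longleftrightarrow> L1 f \<and> (\<forall>x\<in>{0..1}. F x = F 0 + integral {0..x} f)"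

lemma primI: "L1 f \<Longrightarrow> (\<And>x. x \<in> {0..1} \<Longrightarrow> F x = F 0 + integral {0..x} f) \<Longrightarrow> prim F f"
  by (simp only: prim_def) blast

lemma prim_L1: "prim F f \<Longrightarrow> L1 f"
  and prim_eq: "prim F f \<Longrightarrow> x \<in> {0..1} \<Longrightarrow> F x = F 0 + integral {0..x} f"
  unfolding prim_def by blast+

lemma prim_diff:
  assumes "prim F f" "0 \<le> x" "x \<le> y" "y \<le> 1"
  shows "F y - F x = integral {x..y} f"
  using prim_eq[OF assms(1), of x] prim_eq[OF assms(1), of y] assms
    Henstock_Kurzweil_Integration.integral_combine[of 0 x y f] L1_integrable[OF prim_L1[OF assms(1)], of 0 y]
  by auto

lemma prim_cont: assumes "prim F f" shows "continuous_on {0..1} F"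
proof -
  have "continuous_on {0..1} (\<lambda>x. F 0 + integral {0..x} f)"
    by (intro continuous_intros indefinite_integral_continuous_1 L1_integrable prim_L1[OF assms]) simp
  then show ?thesis by (rule continuous_on_eq) (simp add: prim_eq[OF assms, symmetric])
qed

lemma prim_cong:
  assumes "prim F f" "\<And>x. x \<in> {0..1} \<Longrightarrow> K x = F x" "ae (\<lambda>x. g x = f x)" shows "prim K g"
proof (rule primI)
  show "L1 g" using L1_cong_ae prim_L1 assms by blast
  fix x :: real assume "x \<in> {0..1}"
  then show "K x = K 0 + integral {0..x} g"
    using assms(2)[of x] assms(2)[of 0] prim_eq[OF assms(1), of x] integral_cong_ae[OF assms(3), of 0 x] by auto
qed

lemma prim_integral: "L1 f \<Longrightarrow> prim (\<lambda>x. c + integral {0..x} f) f"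
  by (simp add: prim_def)

lemma prim_add:
  assumes "prim F f" "prim K g" shows "prim (\<lambda>x. F x + K x) (\<lambda>x. f x + g x)"
proof (rule primI)
  show L: "L1 (\<lambda>x. f x + g x)" using assms prim_L1 by (intro set_integral_add(1)) auto
  fix x :: real assume x: "x \<in> {0..1}"
  then show "F x + K x = F 0 + K 0 + integral {0..x} (\<lambda>x. f x + g x)"
    using prim_eq[OF assms(1) x] prim_eq[OF assms(2) x] assms[THEN prim_L1] by (simp add: integral_add')
qed

lemma prim_cmult: assumes "prim F f" shows "prim (\<lambda>x. c * F x) (\<lambda>x. c * f x)"
proof (rule primI)
  show "L1 (\<lambda>x. c * f x)" using assms prim_L1 by (intro set_integrable_mult_right) auto
  fix x :: real assume x: "x \<in> {0..1}"
  then show "c * F x = c * F 0 + integral {0..x} (\<lambda>x. c * f x)"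
    using prim_eq[OF assms(1) x] by (simp add: distrib_left)
qed

lemma prim_diff_fun: "prim F f \<Longrightarrow> prim K g \<Longrightarrow> prim (\<lambda>x. F x - K x) (\<lambda>x. f x - g x)"
  using prim_add[of F f "\<lambda>x. (-1) * K x" "\<lambda>x. (-1) * g x"] prim_cmult[of K g "-1"] by simp

lemma prim_unique:
  assumes "prim F f" "prim K g" "\<And>x. x \<in> {0..1} \<Longrightarrow> F x = K x"
  shows "ae (\<lambda>x. f x = g x)"
proof -
  have "ae (\<lambda>x. f x - g x = 0)"
  proof (rule integral_zero_ae)
    show "L1 (\<lambda>x. f x - g x)" using assms prim_L1 by (auto intro!: set_integral_diff(1))
    fix x :: real assume "x \<in> {0..1}"
    then show "integral {0..x} (\<lambda>x. f x - g x) = 0"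
      using prim_eq[OF prim_diff_fun[OF assms(1,2)], of x] assms(3)[of x] assms(3)[of 0] by simp
  qed
  then show ?thesis by simp
qed

text \<open>Cut \<open>{0..z}\<close> into equal pieces shorter than \<open>d\<close>: the bounds
  telescope to \<open>e * (\<Theta> z - \<Theta> 0)\<close> for every positive \<open>e\<close>.
  Measuring pieces by \<open>\<Theta>\<close> and not by length admits unbounded densities, as when
  \<open>\<Theta>\<close> is the integral of \<open>\<bar>f\<bar>\<close>.\<close>

lemma locally_small_imp_constant:
  fixes H \<Theta> :: "real \<Rightarrow> real"
  assumes small: "\<And>e. e > 0 \<Longrightarrow> \<exists>d>0. \<forall>x y. 0 \<le> x \<longrightarrow> x \<le> y \<longrightarrow> y \<le> 1 \<longrightarrow> y - x < d \<longrightarrow>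
    \<bar>H y - H x\<bar> \<le> e * (\<Theta> y - \<Theta> x)"
    and z: "z \<in> {0..1}"
  shows "H z = H 0"
proof -
  have bound: "\<bar>H z - H 0\<bar> \<le> e * (\<Theta> z - \<Theta> 0)" if "e > 0" for e
  proof -
    obtain d where d: "d > 0" "\<And>x y. 0 \<le> x \<Longrightarrow> x \<le> y \<Longrightarrow> y \<le> 1 \<Longrightarrow> y - x < d \<Longrightarrow>
       \<bar>H y - H x\<bar> \<le> e * (\<Theta> y - \<Theta> x)" using small[OF \<open>e > 0\<close>] by meson
    obtain n :: nat where n: "n > 0" "1 / d < n"
      using reals_Archimedean2[of "1/d"] d(1) by (metis divide_pos_pos less_trans of_nat_0_less_iff zero_less_one)
    have zn: "z / n < d" using n d z by (auto simp: field_simps intro: le_less_trans)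
    have "\<bar>H (k * z / n) - H 0\<bar> \<le> e * (\<Theta> (k * z / n) - \<Theta> 0)" if "k \<le> n" for k :: nat
      using that
    proof (induction k)
      case (Suc k)
      have "\<bar>H (Suc k * z / n) - H (k * z / n)\<bar> \<le> e * (\<Theta> (Suc k * z / n) - \<Theta> (k * z / n))"
      proof (rule d(2))
        show "real (Suc k) * z / n \<le> 1"
          using mult_mono[of "real (Suc k)" "real n" z 1] Suc.prems z n(1) by (simp add: divide_le_eq_1)
        show "real (Suc k) * z / n - real k * z / n < d"
          using zn by (simp add: distrib_right add_divide_distrib)
      qed (use z n in \<open>auto intro!: divide_right_mono mult_right_mono\<close>)
      with Suc show ?case by (auto simp: algebra_simps)
    qed simp
    from this[of n] show ?thesis using n by simp
  qed
  show ?thesis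
  proof (rule ccontr)
    assume "H z \<noteq> H 0"
    then have p: "\<bar>H z - H 0\<bar> > 0" by simp
    define g where "g = \<Theta> z - \<Theta> 0"
    define D where "D = \<bar>H z - H 0\<bar>"
    have b: "D \<le> e * g" if "e > 0" for e using bound[OF that] by (simp only: g_def D_def)
    have "D > 0" using p by (simp only: D_def)
    have "g > 0" using b[of 1] \<open>D > 0\<close> by simp
    \<comment> \<open>With \<open>e = D / (2 * g)\<close> the bound says that the positive number
      \<open>D\<close> is at most half of itself.\<close>
    have "D \<le> D / (2 * g) * g" using \<open>D > 0\<close> \<open>g > 0\<close> by (intro b) simp
    then show False using \<open>D > 0\<close> \<open>g > 0\<close> by simp
  qed
qed

text \<open>On a short interval the defect in the chain rule is a small multiple of the integral of
  \<open>\<bar>f\<bar>\<close>, and these errors add up.\<close>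

lemma prim_chain:
  assumes F: "prim F f"
    and d: "\<And>u. u \<in> F ` {0..1} \<Longrightarrow> (h has_real_derivative h' u) (at u within F ` {0..1})"
    and c: "continuous_on (F ` {0..1}) h'"
  shows "prim (\<lambda>x. h (F x)) (\<lambda>x. h' (F x) * f x)"
proof -
  have cF: "continuous_on {0..1} F" by (rule prim_cont[OF F])
  have f: "L1 f" by (rule prim_L1[OF F])
  have ch: "continuous_on {0..1} (\<lambda>x. h' (F x))"
    using continuous_on_compose[OF cF c] by (simp add: o_def)
  have g: "L1 (\<lambda>x. h' (F x) * f x)"
    using L1_mult_cont[OF f ch] by (simp add: mult.commute)
  have af: "L1 (\<lambda>x. \<bar>f x\<bar>)" using f by (rule set_integrable_abs)
  define H where "H = (\<lambda>y. h (F y) - integral {0..y} (\<lambda>x. h' (F x) * f x))"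
  define \<Theta> where "\<Theta> = (\<lambda>y. integral {0..y} (\<lambda>x. \<bar>f x\<bar>))"
  have const: "H z = H 0" if "z \<in> {0..1}" for z
  proof (rule locally_small_imp_constant[where \<Theta> = \<Theta>, OF _ that])
    fix e :: real assume "e > 0"
    have uc: "uniformly_continuous_on {0..1} (\<lambda>x. h' (F x))"
      using ch by (intro compact_uniformly_continuous) auto
    obtain \<delta> where \<delta>: "\<delta> > 0" "\<And>x y. x \<in> {0..1} \<Longrightarrow> y \<in> {0..1} \<Longrightarrow> \<bar>y - x\<bar> < \<delta> \<Longrightarrow>
        \<bar>h' (F y) - h' (F x)\<bar> < e"
      using uc[unfolded uniformly_continuous_on_def dist_real_def, rule_format, OF \<open>e > 0\<close>] by blast
    have "\<bar>H y - H x\<bar> \<le> e * (\<Theta> y - \<Theta> x)" if xy: "0 \<le> x" "x \<le> y" "y \<le> 1" "y - x < \<delta>" for x y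
    proof -
      have sub: "{x..y} \<subseteq> {0..1}" using xy by auto
      have cxy: "continuous_on {x..y} F" using cF sub continuous_on_subset by blast
      \<comment> \<open>\<open>F\<close> need not be differentiable, so the mean value theorem is
        applied to \<open>h\<close> between the values \<open>F x\<close> and \<open>F y\<close>; by
        connectedness of the image the intermediate value is \<open>F \<xi>\<close> for some
        \<open>\<xi>\<close> in \<open>{x..y}\<close>.\<close>
      have "\<exists>\<xi>\<in>{x..y}. h (F y) - h (F x) = h' (F \<xi>) * (F y - F x)"
      proof (cases "F x = F y")
        case False
        define a where "a = min (F x) (F y)"
        define b where "b = max (F x) (F y)"
        have ab: "a < b" "F x \<in> {a,b}" "F y \<in> {a,b}" using False by (auto simp: a_def b_def)
        have "connected (F ` {x..y})" by (intro connected_continuous_image cxy) auto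
        moreover have "a \<in> F ` {x..y}" "b \<in> F ` {x..y}" using xy by (auto simp: a_def b_def min_def max_def)
        ultimately have iv: "{a..b} \<subseteq> F ` {x..y}" by (rule connected_contains_Icc)
        then have iv': "{a..b} \<subseteq> F ` {0..1}" using sub by blast
        have "\<exists>u\<in>{a<..<b}. h b - h a = h' u * (b - a)"
        proof (rule mvt_simple[OF ab(1), where f = h and f' = "\<lambda>u v. h' u * v"])
          fix u assume "a \<le> u" "u \<le> b"
          then have uF: "u \<in> F ` {0..1}" using iv' by (meson atLeastAtMost_iff subsetD)
          show "(h has_derivative (\<lambda>v. h' u * v)) (at u within {a..b})"
            by (rule has_derivative_subset[OF d[OF uF, unfolded has_field_derivative_def] iv'])
        qed
        then obtain u where u: "u \<in> {a..b}" "h b - h a = h' u * (b - a)"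
          using greaterThanLessThan_subseteq_atLeastAtMost_iff[of a b a b] by blast
        then obtain \<xi> where "\<xi> \<in> {x..y}" "u = F \<xi>" using iv by auto
        moreover have "h (F y) - h (F x) = h' u * (F y - F x)"
        proof (cases "F x < F y")
          case True
          then show ?thesis using u(2) by (simp add: a_def b_def)
        next
          case False
          then have "a = F y" "b = F x" using ab(1) by (simp_all add: a_def b_def)
          with u(2) have "h (F x) - h (F y) = h' u * (F x - F y)" by simp
          then show ?thesis by (simp add: right_diff_distrib)
        qed
        ultimately show ?thesis by blast
      qed (use xy in auto)
      then obtain \<xi> where \<xi>: "\<xi> \<in> {x..y}" "h (F y) - h (F x) = h' (F \<xi>) * (F y - F x)" by auto
      have "integral {0..y} (\<lambda>x. h' (F x) * f x) - integral {0..x} (\<lambda>x. h' (F x) * f x)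
          = integral {x..y} (\<lambda>x. h' (F x) * f x)"
        using prim_diff[OF prim_integral[OF g, of 0] xy(1-3)] by simp
      moreover have "h' (F \<xi>) * (F y - F x) = integral {x..y} (\<lambda>s. h' (F \<xi>) * f s)"
        using prim_diff[OF F xy(1-3)] by simp
      ultimately have "H y - H x =
          integral {x..y} (\<lambda>s. h' (F \<xi>) * f s) - integral {x..y} (\<lambda>s. h' (F s) * f s)"
        unfolding H_def using \<xi>(2) by linarith
      also have "\<dots> = integral {x..y} (\<lambda>s. h' (F \<xi>) * f s - h' (F s) * f s)"
        by (intro integral_diff'[symmetric] set_integrable_mult_right g sub) (rule f)
      also have "norm \<dots> \<le> integral {x..y} (\<lambda>s. e * \<bar>f s\<bar>)"
      proof (rule Henstock_Kurzweil_Integration.integral_norm_bound_integral)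
        show "(\<lambda>s. h' (F \<xi>) * f s - h' (F s) * f s) integrable_on {x..y}"
          using f g sub by (intro L1_integrable set_integral_diff(1)) (auto)
        show "(\<lambda>s. e * \<bar>f s\<bar>) integrable_on {x..y}"
          using af sub by (intro L1_integrable) auto
        fix s assume s: "s \<in> {x..y}"
        then have "\<bar>\<xi> - s\<bar> < \<delta>" using \<xi>(1) xy(4) by (auto simp: abs_less_iff)
        then have "\<bar>h' (F \<xi>) - h' (F s)\<bar> \<le> e" using \<delta>(2)[of s \<xi>] \<xi>(1) s sub by (auto simp: less_imp_le)
        then show "norm (h' (F \<xi>) * f s - h' (F s) * f s) \<le> e * \<bar>f s\<bar>"
          unfolding left_diff_distrib[symmetric] by (simp add: abs_mult mult_right_mono)
      qed
      also have "\<dots> = e * (\<Theta> y - \<Theta> x)"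
        using prim_diff[OF prim_integral[OF af, of 0] xy(1-3)] by (simp add: \<Theta>_def)
      finally show ?thesis by simp
    qed
    then show "\<exists>d>0. \<forall>x y. 0 \<le> x \<longrightarrow> x \<le> y \<longrightarrow> y \<le> 1 \<longrightarrow> y - x < d \<longrightarrow> \<bar>H y - H x\<bar> \<le> e * (\<Theta> y - \<Theta> x)"
      using \<delta>(1) by blast
  qed
  show ?thesis
  proof (rule primI[OF g])
    fix x :: real assume "x \<in> {0..1}"
    from const[OF this] show "h (F x) = h (F 0) + integral {0..x} (\<lambda>x. h' (F x) * f x)"
      by (simp add: H_def)
  qed
qed

lemma prim_square: "prim F f \<Longrightarrow> prim (\<lambda>x. (F x)\<^sup>2) (\<lambda>x. 2 * F x * f x)"
  by (rule prim_chain[where h = "\<lambda>u. u\<^sup>2" and h' = "\<lambda>u. 2 * u"])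
    (auto intro!: derivative_eq_intros continuous_intros)

text \<open>Polarization, 4 u v = (u + v)^2 - (u - v)^2, reduces products to squares, so the chain
  rule in one variable suffices.\<close>

lemma prim_mult:
  assumes "prim F f" "prim K g"
  shows "prim (\<lambda>x. F x * K x) (\<lambda>x. f x * K x + F x * g x)"
proof -
  have "prim (\<lambda>x. (1/4) * ((F x + K x)\<^sup>2 - (F x - K x)\<^sup>2))
     (\<lambda>x. (1/4) * (2 * (F x + K x) * (f x + g x) - 2 * (F x - K x) * (f x - g x)))"
    using assms by (intro prim_cmult prim_diff_fun prim_square prim_add)
  then show ?thesis
    by (rule prim_cong) (auto intro!: aeI simp: field_simps power2_eq_square)
qed

lemma prim_inverse:
  assumes "prim F f" "\<And>x. x \<in> {0..1} \<Longrightarrow> F x > 0"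
  shows "prim (\<lambda>x. inverse (F x)) (\<lambda>x. - f x / (F x)\<^sup>2)"
proof -
  have pos: "F x > 0" "F x \<noteq> 0" if "0 \<le> x" "x \<le> 1" for x using that assms(2)[of x] by auto
  have "prim (\<lambda>x. inverse (F x)) (\<lambda>x. - (inverse (F x))\<^sup>2 * f x)"
    by (rule prim_chain[OF assms(1), where h = inverse and h' = "\<lambda>u. - (inverse u)\<^sup>2"])
      (auto intro!: derivative_eq_intros continuous_intros simp: power2_eq_square pos)
  then show ?thesis
    by (rule prim_cong) (auto intro!: aeI simp: field_simps power2_eq_square)
qed

lemma prim_ln:
  assumes "prim F f" "\<And>x. x \<in> {0..1} \<Longrightarrow> F x > 0"
  shows "prim (\<lambda>x. ln (F x)) (\<lambda>x. f x / F x)"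
proof -
  have pos: "F x > 0" "F x \<noteq> 0" if "0 \<le> x" "x \<le> 1" for x using that assms(2)[of x] by auto
  have "prim (\<lambda>x. ln (F x)) (\<lambda>x. inverse (F x) * f x)"
    by (rule prim_chain[OF assms(1), where h = ln and h' = inverse])
      (auto intro!: derivative_eq_intros continuous_intros simp: divide_inverse pos)
  then show ?thesis
    by (rule prim_cong) (auto intro!: aeI simp: field_simps)
qed

lemma prim_C1:
  assumes "\<And>x. x \<in> {0..1} \<Longrightarrow> (F has_real_derivative f x) (at x within {0..1})" "continuous_on {0..1} f"
  shows "prim F f"
proof (rule primI)
  show "L1 f" by (rule L1_cont[OF assms(2)])
  fix x :: real assume x: "x \<in> {0..1}"
  have "(f has_integral (F x - F 0)) {0..x}"
    using x by (intro fundamental_theorem_of_calculus)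
      (auto intro!: has_field_derivative_subset[OF assms(1)] simp flip: has_real_derivative_iff_has_vector_derivative)
  then show "F x = F 0 + integral {0..x} f" by (simp add: integral_unique)
qed

lemma prim_deriv:
  assumes "prim F f" "continuous_on {0..1} f" "x \<in> {0..1}"
  shows "(F has_real_derivative f x) (at x within {0..1})"
proof -
  have "((\<lambda>x. F 0 + integral {0..x} f) has_real_derivative 0 + f x) (at x within {0..1})"
    by (intro DERIV_add DERIV_const integral_has_real_derivative assms)
  then have "((\<lambda>x. F 0 + integral {0..x} f) has_real_derivative f x) (at x within {0..1})" by simp
  then show ?thesis
    by (rule has_field_derivative_transform_within[OF _ zero_less_one assms(3)])
      (simp_all add: prim_eq[OF assms(1), symmetric])
qed

section \<open>Weak derivatives\<close>

lemma test_functionD: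
  assumes "test_function \<eta> \<eta>'"
  shows "prim \<eta> \<eta>'" "continuous_on UNIV \<eta>" "continuous_on UNIV \<eta>'" "\<eta> 0 = 0" "\<eta> 1 = 0"
proof -
  have d: "(\<eta> has_real_derivative \<eta>' x) (at x)" for x using assms by (simp add: test_function_def)
  show c: "continuous_on UNIV \<eta>'" using assms by (simp add: test_function_def)
  show "continuous_on UNIV \<eta>" using d DERIV_continuous_on by blast
  show "prim \<eta> \<eta>'"
    by (rule prim_C1) (auto intro: d has_field_derivative_at_within continuous_on_subset[OF c])
  show "\<eta> 0 = 0" "\<eta> 1 = 0" using assms unfolding test_function_def by force+
qed

lemma weak_derivI:
  assumes "L2 f" "L2 g"
    "\<And>\<eta> \<eta>'. test_function \<eta> \<eta>' \<Longrightarrow>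
      integral {0..1} (\<lambda>x. f x * \<eta>' x) = - integral {0..1} (\<lambda>x. g x * \<eta> x)"
  shows "weak_deriv f g"
  unfolding weak_deriv_def
proof (intro conjI allI impI assms(1,2))
  fix \<eta> \<eta>' assume t: "test_function \<eta> \<eta>'"
  have c: "continuous_on {0..1} \<eta>" "continuous_on {0..1} \<eta>'"
    using test_functionD[OF t] continuous_on_subset by blast+
  show "(LINT x:{0..1}|lebesgue. f x * \<eta>' x) = - (LINT x:{0..1}|lebesgue. g x * \<eta> x)"
    using assms(3)[OF t] c assms(1,2) by (simp add: LINT_eq L1_mult_cont L2_imp_L1)
qed

lemma weak_derivD:
  assumes "weak_deriv f g"
  shows "L2 f" "L2 g"
    and "test_function \<eta> \<eta>' \<Longrightarrow> integral {0..1} (\<lambda>x. f x * \<eta>' x) = - integral {0..1} (\<lambda>x. g x * \<eta> x)"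
proof -
  show L: "L2 f" "L2 g" using assms by (auto simp: weak_deriv_def)
  assume t: "test_function \<eta> \<eta>'"
  have c: "continuous_on {0..1} \<eta>" "continuous_on {0..1} \<eta>'"
    using test_functionD[OF t] continuous_on_subset by blast+
  have "(LINT x:{0..1}|lebesgue. f x * \<eta>' x) = - (LINT x:{0..1}|lebesgue. g x * \<eta> x)"
    using assms t by (simp add: weak_deriv_def)
  then show "integral {0..1} (\<lambda>x. f x * \<eta>' x) = - integral {0..1} (\<lambda>x. g x * \<eta> x)"
    using c L by (simp add: LINT_eq L1_mult_cont L2_imp_L1)
qed

lemma weak_deriv_cong:
  assumes "weak_deriv f g" "ae (\<lambda>x. f' x = f x)" "ae (\<lambda>x. g' x = g x)"
  shows "weak_deriv f' g'"
proof (rule weak_derivI)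
  show "L2 f'" "L2 g'" using assms weak_derivD(1,2) L2_cong_ae by blast+
  fix \<eta> \<eta>' assume t: "test_function \<eta> \<eta>'"
  have 1: "ae (\<lambda>x. f' x * \<eta>' x = f x * \<eta>' x)" using assms(2) by eventually_elim simp
  have 2: "ae (\<lambda>x. g' x * \<eta> x = g x * \<eta> x)" using assms(3) by eventually_elim simp
  show "integral {0..1} (\<lambda>x. f' x * \<eta>' x) = - integral {0..1} (\<lambda>x. g' x * \<eta> x)"
    using weak_derivD(3)[OF assms(1) t] integral_cong_ae[OF 1, of 0 1] integral_cong_ae[OF 2, of 0 1] by simp
qed

lemma prim_imp_weak_deriv:
  assumes "prim F f" "L2 f" shows "weak_deriv F f"
proof (rule weak_derivI)
  show "L2 F" by (rule L2_cont[OF prim_cont[OF assms(1)]])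
  fix \<eta> \<eta>' assume t: "test_function \<eta> \<eta>'"
  have c: "continuous_on {0..1} \<eta>" "continuous_on {0..1} \<eta>'"
    using test_functionD[OF t] continuous_on_subset by blast+
  have "prim (\<lambda>x. F x * \<eta> x) (\<lambda>x. f x * \<eta> x + F x * \<eta>' x)"
    by (rule prim_mult[OF assms(1) test_functionD(1)[OF t]])
  from prim_eq[OF this, of 1] have "integral {0..1} (\<lambda>x. f x * \<eta> x + F x * \<eta>' x) = 0"
    using test_functionD(4,5)[OF t] by simp
  then show "integral {0..1} (\<lambda>x. F x * \<eta>' x) = - integral {0..1} (\<lambda>x. f x * \<eta> x)"
    using L1_mult_cont[OF prim_L1[OF assms(1)] c(1)] L1_mult_cont[OF L1_cont[OF prim_cont[OF assms(1)]] c(2)]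
    by (simp add: integral_add')
qed (rule assms)

text \<open>The vanishing mean makes the antiderivative that is zero to the left of the support zero
  to its right as well.\<close>

lemma test_function_antiderivative:
  assumes c: "continuous_on UNIV \<psi>" and ab: "0 < a" "b < 1"
    and z: "\<And>x. x \<notin> {a..b} \<Longrightarrow> \<psi> x = 0" and i: "integral {0..1} \<psi> = 0"
  shows "\<exists>\<eta>. test_function \<eta> \<psi>"
proof -
  have "\<exists>F. \<forall>x::real. -\<infinity> < ereal x \<longrightarrow> ereal x < \<infinity> \<longrightarrow> (F has_vector_derivative \<psi> x) (at x)"
    using c by (intro einterval_antiderivative) (auto simp: continuous_on_eq_continuous_at)
  then obtain F where F: "\<And>x. (F has_vector_derivative \<psi> x) (at x)" by auto
  have ftc: "F y - F x = integral {x..y} \<psi>" if "x \<le> y" for x y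
    using fundamental_theorem_of_calculus[OF that, of F \<psi>] F
    by (simp add: has_vector_derivative_at_within integral_unique)
  have zero: "integral {x..y} \<psi> = 0" if "y < a \<or> b < x" for x y
  proof -
    have "integral {x..y} \<psi> = integral {x..y} (\<lambda>_. 0)"
      using that z by (intro HK_integral_cong) auto
    then show ?thesis by simp
  qed
  have out: "F x - F 0 = 0" if "x \<notin> {a..b}" for x
  proof -
    have "x < a \<or> x > b" using that by auto
    then consider "x < a" "x \<le> 0" | "x < a" "0 \<le> x" | "x > b" "1 \<le> x" | "x > b" "x \<le> 1" by linarith
    then show ?thesis
    proof cases
      case 1
      then show ?thesis using ftc[OF 1(2)] zero[of 0 x] ab by simp
    next
      case 2
      then show ?thesis using ftc[OF 2(2)] zero[of x 0] ab by simp
    next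
      case 3
      have "F x - F 1 = 0" "F 1 - F 0 = 0" using ftc[OF 3(2)] zero[of x 1] ftc[of 0 1] i ab by simp_all
      then show ?thesis by linarith
    next
      case 4
      have "F 1 - F x = 0" "F 1 - F 0 = 0" using ftc[OF 4(2)] zero[of 1 x] ftc[of 0 1] i 4(1) by simp_all
      then show ?thesis by linarith
    qed
  qed
  have "((\<lambda>x. F x - F 0) has_real_derivative \<psi> x) (at x)" for x
    using DERIV_diff[OF F[of x, folded has_real_derivative_iff_has_vector_derivative] DERIV_const[of "F 0"]] by simp
  then have "test_function (\<lambda>x. F x - F 0) \<psi>"
    unfolding test_function_def using c ab out by blast
  then show ?thesis by blast
qed

text \<open>This is the du Bois-Reymond lemma. The constant has to be the mean of \<open>w\<close>
  against a fixed weight of nonzero integral; the cutoffs then show that \<open>w\<close> minus this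
  mean integrates to zero over every \<open>{0..q}\<close>.\<close>

lemma weak_deriv_zero_imp_constant:
  assumes w: "L2 w" "\<And>\<eta> \<eta>'. test_function \<eta> \<eta>' \<Longrightarrow> integral {0..1} (\<lambda>x. w x * \<eta>' x) = 0"
  obtains C where "ae (\<lambda>x. w x = C)"
proof -
  \<comment> \<open>\<open>\<tau> q n\<close> is a continuous cutoff with support in the open interval, tending to the indicator
    function of \<open>(0,q)\<close>. Subtracting a multiple of a fixed cutoff makes it the derivative of a test
    function.\<close>
  define cl :: "real \<Rightarrow> real" where "cl = (\<lambda>u. max 0 (min 1 u))"
  define \<tau> :: "real \<Rightarrow> nat \<Rightarrow> real \<Rightarrow> real" where
    "\<tau> = (\<lambda>q n x. cl (real n * x - 1) * cl (real n * (q - x) - 1))"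
  have cl: "0 \<le> cl u" "cl u \<le> 1" "u \<le> 0 \<Longrightarrow> cl u = 0" "u \<ge> 1 \<Longrightarrow> cl u = 1" for u
    by (auto simp: cl_def)
  have c\<tau>: "continuous_on S (\<tau> q n)" for S q n
    unfolding \<tau>_def cl_def by (intro continuous_intros)
  have \<tau>01: "0 \<le> \<tau> q n x" "\<tau> q n x \<le> 1" for q n x
    using cl by (auto simp: \<tau>_def intro: mult_le_one)
  have supp: "\<tau> q n x = 0" if "n > 0" "x \<notin> {1/n..q - 1/n}" for q n x
  proof -
    have "real n * x - 1 \<le> 0 \<or> real n * (q - x) - 1 \<le> 0"
      using that by (auto simp: field_simps)
    then show ?thesis using cl(3) unfolding \<tau>_def by (metis mult_eq_0_iff)
  qed
  have Lw: "L1 (\<lambda>x. w x * \<tau> q n x)" for q n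
    by (intro L1_mult_cont L2_imp_L1 w c\<tau>)
  \<comment> \<open>The fixed weight must not vanish identically; \<open>\<tau> 1 4\<close> equals 1
    at the midpoint.\<close>
  define m where "m = integral {0..1} (\<tau> 1 4)"
  have "m \<noteq> 0"
  proof
    assume "m = 0"
    then have "\<tau> 1 4 (1/2) = 0"
      unfolding m_def using integral_eq_0_iff[of 0 1 "\<tau> 1 4"] c\<tau> \<tau>01 by auto
    then show False by (simp add: \<tau>_def cl_def)
  qed
  define C where "C = integral {0..1} (\<lambda>x. w x * \<tau> 1 4 x) / m"
  have key: "integral {0..1} (\<lambda>x. (w x - C) * \<tau> q n x) = 0" if "n > 0" "q \<le> 1" for q n
  proof -
    define k where "k = integral {0..1} (\<tau> q n) / m"
    define \<psi> where "\<psi> = (\<lambda>x. \<tau> q n x - k * \<tau> 1 4 x)"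
    have "\<exists>\<eta>. test_function \<eta> \<psi>"
    proof (rule test_function_antiderivative[where a = "1 / real (max n 4)" and b = "1 - 1 / real (max n 4)"])
      show "continuous_on UNIV \<psi>" unfolding \<psi>_def by (intro continuous_intros c\<tau>)
      show "integral {0..1} \<psi> = 0" unfolding \<psi>_def
        by (subst integral_diff') (auto intro!: L1_cont c\<tau> continuous_intros simp: k_def m_def[symmetric] \<open>m \<noteq> 0\<close>)
      fix x assume x': "x \<notin> {1 / real (max n 4)..1 - 1 / real (max n 4)}"
      define M where "M = 1 / real (max n 4)"
      have x: "x \<notin> {M..1 - M}" using x' by (simp only: M_def not_False_eq_True)
      have "M \<le> 1 / n" "M \<le> 1 / real 4"
        using \<open>n > 0\<close> unfolding M_def by (intro divide_left_mono; simp)+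
      then have "x \<notin> {1/n..q - 1/n}" "x \<notin> {1/real 4..1 - 1/real 4}" using x \<open>q \<le> 1\<close> by auto
      then show "\<psi> x = 0" unfolding \<psi>_def using supp[of n x q] supp[of 4 x 1] \<open>n > 0\<close> by simp
    qed (use \<open>n > 0\<close> in auto)
    then obtain \<eta> where "test_function \<eta> \<psi>" ..
    from w(2)[OF this] have "integral {0..1} (\<lambda>x. w x * \<tau> q n x - k * (w x * \<tau> 1 4 x)) = 0"
      by (simp add: \<psi>_def algebra_simps)
    then have "integral {0..1} (\<lambda>x. w x * \<tau> q n x) = k * (C * m)"
      using \<open>m \<noteq> 0\<close> by (subst (asm) integral_diff') (auto intro!: Lw set_integrable_mult_right simp: C_def)
    also have "\<dots> = integral {0..1} (\<lambda>x. C * \<tau> q n x)"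
      using \<open>m \<noteq> 0\<close> by (simp add: k_def)
    finally have "integral {0..1} (\<lambda>x. w x * \<tau> q n x - C * \<tau> q n x) = 0"
      by (subst integral_diff') (auto intro!: Lw L1_cont continuous_intros c\<tau>)
    then show ?thesis by (simp add: algebra_simps)
  qed
  have LC: "L1 (\<lambda>x. w x - C)" by (intro set_integral_diff(1) L2_imp_L1[OF w(1)]) (auto intro: L1_cont)
  have "ae (\<lambda>x. w x - C = 0)"
  proof (rule integral_zero_ae[OF LC])
    fix q :: real assume q: "q \<in> {0..1}"
    define g where "g = (\<lambda>x. if 0 < x \<and> x < q then w x - C else 0)"
    \<comment> \<open>\<open>Suc n\<close> keeps the index positive, as \<open>key\<close> requires.
      The limit \<open>g\<close> is 0 at the points 0 and \<open>q\<close>, where every cutoff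
      vanishes.\<close>
    have "(\<lambda>n. integral {0..1} (\<lambda>x. (w x - C) * \<tau> q (Suc n) x)) \<longlonglongrightarrow> integral {0..1} g"
    proof (rule dominated_convergence(2)[where h = "\<lambda>x. \<bar>w x - C\<bar>"])
      show "(\<lambda>x. (w x - C) * \<tau> q (Suc n) x) integrable_on {0..1}" for n
        by (intro L1_integrable L1_mult_cont LC c\<tau>) auto
      show "(\<lambda>x. \<bar>w x - C\<bar>) integrable_on {0..1}"
        by (intro L1_integrable set_integrable_abs LC) auto
      show "norm ((w x - C) * \<tau> q (Suc n) x) \<le> \<bar>w x - C\<bar>" for n x
        using \<tau>01[of q "Suc n" x] by (simp add: abs_mult mult_left_le)
      fix x :: real assume x: "x \<in> {0..1}"
      have lim: "filterlim (\<lambda>n. real (Suc n) * d - 1) at_top sequentially" if "d > 0" for d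
        using that by real_asymp
      have "eventually (\<lambda>n. (w x - C) * \<tau> q (Suc n) x = g x) sequentially"
      proof (cases "0 < x \<and> x < q")
        case True
        then have "x > 0" "q - x > 0" by simp_all
        then have "eventually (\<lambda>n. real (Suc n) * x - 1 \<ge> 1) sequentially"
          "eventually (\<lambda>n. real (Suc n) * (q - x) - 1 \<ge> 1) sequentially"
          by (simp_all only: lim[unfolded filterlim_at_top])
        then show ?thesis
          by eventually_elim (use True in \<open>simp add: \<tau>_def g_def cl(4)\<close>)
      next
        case False
        then have "x \<le> 0 \<or> q - x \<le> 0" by auto
        then have "real (Suc n) * x \<le> 0 \<or> real (Suc n) * (q - x) \<le> 0" for n
          by (meson mult_nonneg_nonpos of_nat_0_le_iff)
        then have "real (Suc n) * x - 1 \<le> 0 \<or> real (Suc n) * (q - x) - 1 \<le> 0" for n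
          by (smt (verit))
        then have "\<tau> q (Suc n) x = 0" for n
          unfolding \<tau>_def using cl(3) by (metis mult_eq_0_iff)
        moreover have "g x = 0" unfolding g_def using False by (rule if_not_P)
        ultimately show ?thesis by simp
      qed
      then show "(\<lambda>n. (w x - C) * \<tau> q (Suc n) x) \<longlonglongrightarrow> g x" by (rule tendsto_eventually)
    qed
    then have "integral {0..1} g = 0" using key q by (simp add: LIMSEQ_const_iff)
    also have "integral {0..1} g = integral {0..1} (\<lambda>x. if x \<in> {0..q} then w x - C else 0)"
      by (rule integral_spike[of "{0,q}"]) (auto simp: g_def)
    also have "\<dots> = integral {0..q} (\<lambda>x. w x - C)"
      using q by (subst Henstock_Kurzweil_Integration.integral_restrict_Int) (simp add: Int_absorb2)
    finally show "integral {0..q} (\<lambda>x. w x - C) = 0" .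
  qed
  then show ?thesis by (intro that[of C]) simp
qed

text \<open>\<open>f\<close> minus the integral of \<open>g\<close> has weak derivative zero, hence
  is constant almost everywhere. This allows weak derivatives to be handled through absolutely
  continuous representatives.\<close>

lemma weak_deriv_imp_prim:
  assumes "weak_deriv f g"
  obtains F where "prim F g" "ae (\<lambda>x. f x = F x)"
proof -
  define W where "W = (\<lambda>x. integral {0..x} g)"
  have pW: "prim W g"
    using prim_integral[OF L2_imp_L1[OF weak_derivD(2)[OF assms]], of 0] by (simp add: W_def)
  have dW: "weak_deriv W g" by (rule prim_imp_weak_deriv[OF pW weak_derivD(2)[OF assms]])
  obtain C where C: "ae (\<lambda>x. f x - W x = C)"
  proof (rule weak_deriv_zero_imp_constant)
    show "L2 (\<lambda>x. f x - W x)" by (intro L2_diff weak_derivD(1)[OF assms] weak_derivD(1)[OF dW])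
    fix \<eta> \<eta>' assume t: "test_function \<eta> \<eta>'"
    have c: "continuous_on {0..1} \<eta>'"
      using test_functionD[OF t] continuous_on_subset by blast+
    have "integral {0..1} (\<lambda>x. f x * \<eta>' x - W x * \<eta>' x) = 0"
      using weak_derivD(3)[OF assms t] weak_derivD(3)[OF dW t]
      by (subst integral_diff')
        (auto intro!: L1_mult_cont[OF L2_imp_L1[OF weak_derivD(1)[OF assms]] c]
          L1_mult_cont[OF L2_imp_L1[OF weak_derivD(1)[OF dW]] c])
    then show "integral {0..1} (\<lambda>x. (f x - W x) * \<eta>' x) = 0" by (simp add: left_diff_distrib)
  qed
  have "prim (\<lambda>x. C + W x) g"
    using prim_integral[OF L2_imp_L1[OF weak_derivD(2)[OF assms]], of C] by (simp add: W_def)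
  moreover have "ae (\<lambda>x. f x = C + W x)" using C by eventually_elim simp
  ultimately show ?thesis by (rule that)
qed

lemma continuous_ae_eq:
  fixes F H :: "real \<Rightarrow> real"
  assumes "continuous_on {0..1} F" "continuous_on {0..1} H" "ae (\<lambda>x. F x = H x)" "x \<in> {0..1}"
  shows "F x = H x"
proof -
  have c: "continuous_on {0..1} (\<lambda>x. (F x - H x)\<^sup>2)" using assms by (intro continuous_intros)
  have z: "ae (\<lambda>x. (F x - H x)\<^sup>2 = 0)" using assms(3) by eventually_elim simp
  have "integral {0..1} (\<lambda>x. (F x - H x)\<^sup>2) = 0" using integral_cong_ae[OF z, of 0 1] by simp
  then have "\<forall>x\<in>{0..1}. (F x - H x)\<^sup>2 = 0"
    using integral_eq_0_iff[OF c zero_less_one] by (meson zero_le_power2)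
  then have "(F x - H x)\<^sup>2 = 0" using assms(4) by blast
  then show ?thesis by simp
qed

lemma weak_deriv_unique:
  assumes "weak_deriv f g" "weak_deriv f h"
  shows "ae (\<lambda>x. g x = h x)"
proof -
  obtain F where F: "prim F g" "ae (\<lambda>x. f x = F x)" by (rule weak_deriv_imp_prim[OF assms(1)])
  obtain H where H: "prim H h" "ae (\<lambda>x. f x = H x)" by (rule weak_deriv_imp_prim[OF assms(2)])
  have "ae (\<lambda>x. F x = H x)" using F(2) H(2) by eventually_elim simp
  from continuous_ae_eq[OF prim_cont[OF F(1)] prim_cont[OF H(1)] this]
  show ?thesis by (rule prim_unique[OF F(1) H(1)])
qed

text \<open>Uniqueness neutralises the choice in \<open>wderiv\<close>: whichever representative is
  picked, it agrees almost everywhere with every known weak derivative, which is all that integrals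
  can see.\<close>

lemma wderiv_ae: "weak_deriv f g \<Longrightarrow> ae (\<lambda>x. wderiv f x = g x)"
  unfolding wderiv_def by (rule weak_deriv_unique[OF someI[of "weak_deriv f" g]])

lemma wderiv2_ae:
  assumes "weak_deriv f g" "weak_deriv g h" shows "ae (\<lambda>x. wderiv (wderiv f) x = h x)"
proof (rule wderiv_ae)
  show "weak_deriv (wderiv f) h"
    using weak_deriv_cong[OF assms(2) wderiv_ae[OF assms(1)]] by simp
qed

lemma sobolev_cong_ae:
  assumes "sobolev n f" "ae (\<lambda>x. g x = f x)" shows "sobolev n g"
proof (cases n)
  case 0
  then show ?thesis using L2_cong_ae[OF _ assms(2)] assms(1) by simp
next
  case (Suc m)
  have "sobolev (Suc m) f" using assms(1) Suc by (simp only:)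
  then obtain h where h: "weak_deriv f h" "sobolev m h" by (simp only: sobolev.simps) blast
  have "weak_deriv g h" by (rule weak_deriv_cong[OF h(1) assms(2)]) simp
  then show ?thesis unfolding Suc sobolev.simps using h(2) by blast
qed

section \<open>The metric in Lagrangian coordinates\<close>

text \<open>Second-order Sobolev regularity with its derivatives named: \<open>f1\<close> is a
  continuous classical derivative, \<open>f2\<close> is square integrable and fixed only up to a
  null set. Naming them allows pointwise algebra in place of nested weak derivatives.\<close>

definition h2 :: "(real \<Rightarrow> real) \<Rightarrow> (real \<Rightarrow> real) \<Rightarrow> (real \<Rightarrow> real) \<Rightarrow> bool" where
  "h2 f f1 f2 \<longleftrightarrow> prim f f1 \<and> prim f1 f2 \<and> L2 f2"

lemma h2D:
  assumes "h2 f f1 f2"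
  shows "prim f f1" "prim f1 f2" "L2 f2" "continuous_on {0..1} f" "continuous_on {0..1} f1"
    "weak_deriv f f1" "weak_deriv f1 f2"
    "\<And>x. x \<in> {0..1} \<Longrightarrow> (f has_real_derivative f1 x) (at x within {0..1})"
proof -
  show p: "prim f f1" "prim f1 f2" "L2 f2" using assms unfolding h2_def by blast+
  show c: "continuous_on {0..1} f" "continuous_on {0..1} f1" using p prim_cont by blast+
  show "weak_deriv f f1" by (rule prim_imp_weak_deriv[OF p(1) L2_cont[OF c(2)]])
  show "weak_deriv f1 f2" by (rule prim_imp_weak_deriv[OF p(2,3)])
  show "(f has_real_derivative f1 x) (at x within {0..1})" if "x \<in> {0..1}" for x
    by (rule prim_deriv[OF p(1) c(2) that])
qed

lemma h2_wderiv: "h2 f f1 f2 \<Longrightarrow> ae (\<lambda>x. wderiv (wderiv f) x = f2 x)"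
  by (rule wderiv2_ae[OF h2D(6,7)])

lemma h2_cong: "h2 f f1 f2 \<Longrightarrow> (\<And>x. x \<in> {0..1} \<Longrightarrow> g x = f x) \<Longrightarrow> h2 g f1 f2"
  unfolding h2_def using prim_cong[of f f1 g f1] by simp

lemma h2_add: "h2 f f1 f2 \<Longrightarrow> h2 g g1 g2 \<Longrightarrow> h2 (\<lambda>x. f x + g x) (\<lambda>x. f1 x + g1 x) (\<lambda>x. f2 x + g2 x)"
  unfolding h2_def by (intro conjI prim_add L2_add) blast+

lemma h2_cmult: "h2 f f1 f2 \<Longrightarrow> h2 (\<lambda>x. c * f x) (\<lambda>x. c * f1 x) (\<lambda>x. c * f2 x)"
  unfolding h2_def by (intro conjI prim_cmult L2_cmult) blast+

lemma h2_diff: "h2 f f1 f2 \<Longrightarrow> h2 g g1 g2 \<Longrightarrow> h2 (\<lambda>x. f x - g x) (\<lambda>x. f1 x - g1 x) (\<lambda>x. f2 x - g2 x)"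
  unfolding h2_def by (intro conjI prim_diff_fun L2_diff) blast+

lemma h2_id: "h2 (\<lambda>x. x) (\<lambda>_. 1) (\<lambda>_. 0)"
  unfolding h2_def by (intro conjI prim_C1 L2_cont) (auto intro!: derivative_eq_intros)

lemma h2_unique:
  assumes "h2 f f1 f2" "h2 g g1 g2" "\<And>x. x \<in> {0..1} \<Longrightarrow> f x = g x"
  shows "\<And>x. x \<in> {0..1} \<Longrightarrow> f1 x = g1 x" "ae (\<lambda>x. f2 x = g2 x)"
proof -
  have "ae (\<lambda>x. f1 x = g1 x)" by (rule prim_unique[OF h2D(1)[OF assms(1)] h2D(1)[OF assms(2)] assms(3)])
  from continuous_ae_eq[OF h2D(5)[OF assms(1)] h2D(5)[OF assms(2)] this]
  show *: "\<And>x. x \<in> {0..1} \<Longrightarrow> f1 x = g1 x" .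
  show "ae (\<lambda>x. f2 x = g2 x)" by (rule prim_unique[OF h2D(2)[OF assms(1)] h2D(2)[OF assms(2)] *])
qed

lemma sobolev2_imp_h2:
  assumes "continuous_on {0..1} f" "sobolev 2 f"
  obtains f1 f2 where "h2 f f1 f2"
proof -
  obtain g h where g: "weak_deriv f g" and h: "weak_deriv g h"
    using assms(2) unfolding numeral_2_eq_2 sobolev.simps by blast
  obtain F1 where F1: "prim F1 h" "ae (\<lambda>x. g x = F1 x)" by (rule weak_deriv_imp_prim[OF h])
  obtain F where F: "prim F g" "ae (\<lambda>x. f x = F x)" by (rule weak_deriv_imp_prim[OF g])
  have "prim f F1"
    using prim_cong[OF F(1) _ ae_eq_sym[OF F1(2)]] continuous_ae_eq[OF assms(1) prim_cont[OF F(1)] F(2)] by blast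
  then have "h2 f F1 h" unfolding h2_def using F1(1) weak_derivD(2)[OF h] by blast
  then show ?thesis by (rule that)
qed

lemma real_derivative_within_unique:
  fixes f :: "real \<Rightarrow> real"
  assumes "(f has_real_derivative a) (at x within {0..1})" "(f has_real_derivative b) (at x within {0..1})" "x \<in> {0..1}"
  shows "a = b"
proof -
  have "at x within {0..1} \<noteq> bot" using assms(3) by (simp add: trivial_limit_within islimpt_Icc)
  then show ?thesis using assms(1,2) tendsto_unique unfolding has_field_derivative_iff by blast
qed

lemma H2_0E:
  assumes "f \<in> H2_0"
  obtains f1 f2 where "h2 f f1 f2" "f 0 = 0" "f 1 = 0" "f1 0 = 0" "f1 1 = 0"
proof -
  have f: "continuous_on {0..1} f" "sobolev 2 f" "f 0 = 0" "f 1 = 0"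
     "(f has_real_derivative 0) (at 0 within {0..1})"
     "(f has_real_derivative 0) (at 1 within {0..1})" using assms unfolding H2_0_def by blast+
  obtain f1 f2 where h: "h2 f f1 f2" by (rule sobolev2_imp_h2[OF f(1,2)])
  have "f1 0 = 0" by (rule real_derivative_within_unique[OF h2D(8)[OF h] f(5)]) simp_all
  moreover have "f1 1 = 0" by (rule real_derivative_within_unique[OF h2D(8)[OF h] f(6)]) simp_all
  ultimately show ?thesis using that h f(3,4) by blast
qed

lemma H2_0I:
  assumes h: "h2 f f1 f2" and z: "f 0 = 0" "f 1 = 0" "f1 0 = 0" "f1 1 = 0"
  shows "f \<in> H2_0"
proof -
  have "sobolev 2 f" unfolding numeral_2_eq_2 sobolev.simps using h2D(3,6,7)[OF h] by blast
  moreover have "(f has_real_derivative 0) (at 0 within {0..1})" "(f has_real_derivative 0) (at 1 within {0..1})"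
    using h2D(8)[OF h, of 0] h2D(8)[OF h, of 1] z(3,4) by simp_all
  ultimately show ?thesis unfolding H2_0_def using h2D(4)[OF h] z by blast
qed

section \<open>Diffeomorphisms and the change of variables\<close>

definition diffeo :: "(real \<Rightarrow> real) \<Rightarrow> (real \<Rightarrow> real) \<Rightarrow> (real \<Rightarrow> real) \<Rightarrow> bool" where
  "diffeo \<phi> p q \<longleftrightarrow> h2 \<phi> p q \<and> \<phi> 0 = 0 \<and> \<phi> 1 = 1 \<and> (\<forall>x\<in>{0..1}. 0 < p x)"

lemma Diff2_0E:
  assumes "\<phi> \<in> Diff2_0"
  obtains p q where "diffeo \<phi> p q" "p 0 = 1" "p 1 = 1"
proof -
  obtain f where f: "f \<in> H2_0" "\<And>x. x \<in> {0..1} \<Longrightarrow> \<phi> x = x + f x"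
     "\<And>x. x \<in> {0..1} \<Longrightarrow> \<exists>d. (f has_real_derivative d) (at x within {0..1}) \<and> 1 + d > 0"
    using assms unfolding Diff2_0_def by blast
  obtain f1 f2 where h: "h2 f f1 f2" "f 0 = 0" "f 1 = 0" "f1 0 = 0" "f1 1 = 0" by (rule H2_0E[OF f(1)])
  have "h2 \<phi> (\<lambda>x. 1 + f1 x) (\<lambda>x. 0 + f2 x)"
    by (rule h2_cong[OF h2_add[OF h2_id h(1)] f(2)])
  moreover have "0 < 1 + f1 x" if "x \<in> {0..1}" for x
    using f(3)[OF that] real_derivative_within_unique[OF h2D(8)[OF h(1) that] _ that] by blast
  moreover have "\<phi> 0 = 0" "\<phi> 1 = 1" using f(2)[of 0] f(2)[of 1] h by simp_all
  ultimately have "diffeo \<phi> (\<lambda>x. 1 + f1 x) (\<lambda>x. 0 + f2 x)" unfolding diffeo_def by blast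
  then show ?thesis using h(4,5) that[of "\<lambda>x. 1 + f1 x" "\<lambda>x. 0 + f2 x"] by simp
qed

lemma diffeoD:
  assumes "diffeo \<phi> p q"
  shows "h2 \<phi> p q" "\<phi> 0 = 0" "\<phi> 1 = 1" "x \<in> {0..1} \<Longrightarrow> 0 < p x"
  using assms unfolding diffeo_def by blast+

lemma diffeo_strict_mono:
  assumes d: "diffeo \<phi> p q" and xy: "0 \<le> x" "x < y" "y \<le> 1"
  shows "\<phi> x < \<phi> y"
proof -
  have "\<exists>u\<in>{x<..<y}. \<phi> y - \<phi> x = p u * (y - x)"
  proof (rule mvt_simple[OF xy(2), where f = \<phi> and f' = "\<lambda>u v. p u * v"])
    fix u assume u: "x \<le> u" "u \<le> y"
    then have "u \<in> {0..1}" using xy by simp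
    from h2D(8)[OF diffeoD(1)[OF d] this, unfolded has_field_derivative_def]
    show "(\<phi> has_derivative (\<lambda>v. p u * v)) (at u within {x..y})"
      by (rule has_derivative_subset) (use xy in auto)
  qed
  then obtain u where u: "u \<in> {x<..<y}" "\<phi> y - \<phi> x = p u * (y - x)" by blast
  have "0 < p u" using u xy by (intro diffeoD(4)[OF d]) simp
  then have "0 < p u * (y - x)" using xy by simp
  then show ?thesis using u(2) by linarith
qed

lemma diffeo_inj: assumes d: "diffeo \<phi> p q" shows "inj_on \<phi> {0..1}"
proof (rule inj_onI)
  fix x y :: real assume xy: "x \<in> {0..1}" "y \<in> {0..1}" "\<phi> x = \<phi> y"
  then show "x = y" using diffeo_strict_mono[OF d, of x y] diffeo_strict_mono[OF d, of y x]
    by (cases x y rule: linorder_cases) auto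
qed

lemma diffeo_image:
  assumes d: "diffeo \<phi> p q" and x: "x \<in> {0..1}" shows "\<phi> ` {0..x} = {0..\<phi> x}"
proof
  have le: "\<phi> u \<le> \<phi> v" if "0 \<le> u" "u \<le> v" "v \<le> 1" for u v
    using diffeo_strict_mono[OF d, of u v] that by (cases "u = v") (auto simp: less_imp_le)
  show "\<phi> ` {0..x} \<subseteq> {0..\<phi> x}"
    using le[of 0] le[of _ x] x diffeoD(2)[OF d] by auto
  have "continuous_on {0..x} \<phi>"
    using h2D(4)[OF diffeoD(1)[OF d]] by (rule continuous_on_subset) (use x in auto)
  then have "connected (\<phi> ` {0..x})" by (intro connected_continuous_image) auto
  moreover have "\<phi> 0 \<in> \<phi> ` {0..x}" "\<phi> x \<in> \<phi> ` {0..x}" using x by auto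
  ultimately show "{0..\<phi> x} \<subseteq> \<phi> ` {0..x}"
    using connected_contains_Icc diffeoD(2)[OF d] by metis
qed

text \<open>Substitution \<open>y = \<phi> x\<close>. The upper end is left variable so that the
  same identity yields primitives of composed functions and not only integrals over the whole
  interval.\<close>

lemma change_of_variables:
  assumes d: "diffeo \<phi> p q" and f: "L1 f" and x: "x \<in> {0..1}"
  shows "(\<lambda>y. f (inv_into {0..1} \<phi> y)) absolutely_integrable_on {0..\<phi> x}"
    "integral {0..\<phi> x} (\<lambda>y. f (inv_into {0..1} \<phi> y)) = integral {0..x} (\<lambda>x. p x * f x)"
proof -
  have sub: "{0..x} \<subseteq> {0..1}" using x by auto
  define g where "g = (\<lambda>y. f (inv_into {0..1} \<phi> y))"
  have eq: "\<bar>p s\<bar> * g (\<phi> s) = p s * f s" if "s \<in> {0..x}" for s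
    using that sub diffeoD(4)[OF d, of s] inv_into_f_f[OF diffeo_inj[OF d], of s] by (auto simp: g_def)
  have "L1 (\<lambda>s. f s * p s)" by (rule L1_mult_cont[OF f h2D(5)[OF diffeoD(1)[OF d]]])
  then have "L1 (\<lambda>s. p s * f s)" by (simp add: mult.commute)
  then have "(\<lambda>s. p s * f s) absolutely_integrable_on {0..x}" by (rule L1_subinterval[OF _ sub])
  then have i: "(\<lambda>s. \<bar>p s\<bar> * g (\<phi> s)) absolutely_integrable_on {0..x}"
    by (rule absolutely_integrable_spike[OF _ negligible_empty]) (simp add: eq)
  have "(\<lambda>s. \<bar>p s\<bar> * g (\<phi> s)) absolutely_integrable_on {0..x} \<and>
      integral {0..x} (\<lambda>s. \<bar>p s\<bar> * g (\<phi> s)) = integral {0..x} (\<lambda>s. \<bar>p s\<bar> * g (\<phi> s)) \<longleftrightarrow>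
      g absolutely_integrable_on \<phi> ` {0..x} \<and>
      integral (\<phi> ` {0..x}) g = integral {0..x} (\<lambda>s. \<bar>p s\<bar> * g (\<phi> s))"
  proof (rule has_absolute_integral_change_of_variables_1')
    show "(\<phi> has_field_derivative p s) (at s within {0..x})" if "s \<in> {0..x}" for s
      using h2D(8)[OF diffeoD(1)[OF d], of s] that sub by (blast intro: has_field_derivative_subset)
    show "inj_on \<phi> {0..x}" using diffeo_inj[OF d] sub by (rule inj_on_subset)
  qed simp
  then have "g absolutely_integrable_on {0..\<phi> x}"
     "integral {0..\<phi> x} g = integral {0..x} (\<lambda>s. \<bar>p s\<bar> * g (\<phi> s))"
    using i unfolding diffeo_image[OF d x] by blast+
  moreover have "integral {0..x} (\<lambda>s. \<bar>p s\<bar> * g (\<phi> s)) = integral {0..x} (\<lambda>s. p s * f s)"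
    by (rule HK_integral_cong) (rule eq)
  ultimately show "(\<lambda>y. f (inv_into {0..1} \<phi> y)) absolutely_integrable_on {0..\<phi> x}"
    "integral {0..\<phi> x} (\<lambda>y. f (inv_into {0..1} \<phi> y)) = integral {0..x} (\<lambda>x. p x * f x)"
    unfolding g_def by simp_all
qed

lemma change_of_variables_L2:
  assumes d: "diffeo \<phi> p q" and f: "L2 f"
  shows "L2 (\<lambda>y. f (inv_into {0..1} \<phi> y))"
  unfolding L2_iff
  using change_of_variables(1)[OF d L2_imp_L1[OF f], of 1] change_of_variables(1)[OF d L2_square[OF f], of 1]
    diffeoD(3)[OF d] by simp

lemma inv_diffeo:
  assumes d: "diffeo \<phi> p q" and y: "y \<in> {0..1}"
  shows "inv_into {0..1} \<phi> y \<in> {0..1}" "\<phi> (inv_into {0..1} \<phi> y) = y"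
proof -
  have "y \<in> \<phi> ` {0..1}" using diffeo_image[OF d, of 1] diffeoD(3)[OF d] y by simp
  then show "inv_into {0..1} \<phi> y \<in> {0..1}" "\<phi> (inv_into {0..1} \<phi> y) = y"
    by (rule inv_into_into, rule f_inv_into_f)
qed

text \<open>The Jacobian \<open>p\<close> of the substitution is exactly the factor split off in
  \<open>f = p * g\<close>; thus \<open>g\<close> is the derivative of \<open>F\<close> with respect
  to \<open>\<phi>\<close>.\<close>

lemma prim_comp_inverse:
  assumes d: "diffeo \<phi> p q" and F: "prim F f" and f: "\<And>x. x \<in> {0..1} \<Longrightarrow> f x = p x * g x" and g: "L1 g"
  shows "prim (\<lambda>y. F (inv_into {0..1} \<phi> y)) (\<lambda>y. g (inv_into {0..1} \<phi> y))"
proof (rule primI)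
  show "L1 (\<lambda>y. g (inv_into {0..1} \<phi> y))"
    using change_of_variables(1)[OF d g, of 1] diffeoD(3)[OF d] by simp
  fix y :: real assume y: "y \<in> {0..1}"
  define x where "x = inv_into {0..1} \<phi> y"
  have x: "x \<in> {0..1}" "\<phi> x = y" using inv_diffeo[OF d y] by (simp_all add: x_def)
  have 0: "inv_into {0..1} \<phi> 0 = 0"
    using inv_into_f_f[OF diffeo_inj[OF d], of 0] diffeoD(2)[OF d] by simp
  have "integral {0..y} (\<lambda>y. g (inv_into {0..1} \<phi> y)) = integral {0..x} (\<lambda>x. p x * g x)"
    using change_of_variables(2)[OF d g x(1)] x(2) by simp
  also have "\<dots> = integral {0..x} f"
    by (rule HK_integral_cong) (use f x in auto)
  also have "\<dots> = F x - F 0" using prim_eq[OF F x(1)] by simp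
  finally show "F (inv_into {0..1} \<phi> y) = F (inv_into {0..1} \<phi> 0) + integral {0..y} (\<lambda>y. g (inv_into {0..1} \<phi> y))"
    unfolding 0 x_def[symmetric] by simp
qed

lemma L2_cont_mult: "continuous_on {0..1} g \<Longrightarrow> L2 f \<Longrightarrow> L2 (\<lambda>x. g x * f x)"
  using L2_mult_cont[of f g] by (simp add: mult.commute)

lemma diffeo_cont_inverse_power:
  assumes "diffeo \<phi> p q" shows "continuous_on {0..1} (\<lambda>x. inverse (p x ^ k))"
proof -
  have "p x ^ k \<noteq> 0" if "x \<in> {0..1}" for x using diffeoD(4)[OF assms that] by simp
  then show ?thesis by (intro continuous_intros h2D(5)[OF diffeoD(1)[OF assms]]) blast
qed

lemma L2_second_derivative_quotient:
  assumes d: "diffeo \<phi> p q" and X: "h2 X X1 X2"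
  shows "L2 (\<lambda>x. (X2 x * p x - X1 x * q x) / p x ^ k)"
  unfolding divide_inverse
  by (intro L2_mult_cont L2_diff L2_cont_mult diffeo_cont_inverse_power[OF d] h2D(3,5)[OF X]
      h2D(3,5)[OF diffeoD(1)[OF d]])

text \<open>Differentiating after composition with the inverse means differentiating in x and
  dividing by \<open>p\<close>. Doing this twice to \<open>X\<close> gives \<open>X1 / p\<close> and
  then \<open>(X2 * p - X1 * q) / p ^ 3\<close>.\<close>

lemma h2_comp_inverse:
  assumes d: "diffeo \<phi> p q" and X: "h2 X X1 X2"
  defines "\<psi> \<equiv> inv_into {0..1} \<phi>"
  shows "h2 (X \<circ> \<psi>) (\<lambda>y. X1 (\<psi> y) / p (\<psi> y)) (\<lambda>y. (X2 (\<psi> y) * p (\<psi> y) - X1 (\<psi> y) * q (\<psi> y)) / p (\<psi> y) ^ 3)"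
proof -
  have pos: "\<And>x. x \<in> {0..1} \<Longrightarrow> 0 < p x" using diffeoD(4)[OF d] .
  have cp: "continuous_on {0..1} p" by (rule h2D(5)[OF diffeoD(1)[OF d]])
  have c: "continuous_on {0..1} (\<lambda>x. X1 x / p x)"
    using pos by (intro continuous_intros h2D(5)[OF X] cp) force
  have 1: "prim (\<lambda>y. X (\<psi> y)) (\<lambda>y. X1 (\<psi> y) / p (\<psi> y))"
    unfolding \<psi>_def using pos by (intro prim_comp_inverse[OF d h2D(1)[OF X], where g = "\<lambda>x. X1 x / p x"] L1_cont c) force
  define e where "e = (\<lambda>x. (X2 x * p x - X1 x * q x) / p x ^ 3)"
  have Le: "L2 e" unfolding e_def by (rule L2_second_derivative_quotient[OF d X])
  have "prim (\<lambda>x. X1 x * inverse (p x)) (\<lambda>x. X2 x * inverse (p x) + X1 x * (- q x / (p x)\<^sup>2))"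
    by (rule prim_mult[OF h2D(2)[OF X] prim_inverse[OF h2D(2)[OF diffeoD(1)[OF d]] pos]])
  moreover have "X2 x * inverse (p x) + X1 x * (- q x / (p x)\<^sup>2) = p x * e x" if "x \<in> {0..1}" for x
    using pos[OF that] by (simp add: e_def field_simps power2_eq_square power3_eq_cube)
  ultimately have 2: "prim (\<lambda>y. X1 (\<psi> y) * inverse (p (\<psi> y))) (\<lambda>y. e (\<psi> y))"
    unfolding \<psi>_def by (rule prim_comp_inverse[OF d _ _ L2_imp_L1[OF Le]])
  have 3: "L2 (\<lambda>y. e (\<psi> y))" unfolding \<psi>_def by (rule change_of_variables_L2[OF d Le])
  show ?thesis using 1 2 3 unfolding h2_def e_def divide_inverse o_def by blast
qed

text \<open>Each of the two second derivatives contributes \<open>p ^ 3\<close> to the denominator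
  and the Jacobian of the substitution takes one power back, hence the exponent 5. The inverse of
  \<open>\<phi>\<close> has disappeared, so the formula can be differentiated with respect to
  \<open>\<phi>\<close>.\<close>

lemma G_eq:
  assumes d: "diffeo \<phi> p q" and X: "h2 X X1 X2" and Y: "h2 Y Y1 Y2"
  shows "G \<phi> X Y = integral {0..1} (\<lambda>x. (X2 x * p x - X1 x * q x) * (Y2 x * p x - Y1 x * q x) / p x ^ 5)"
proof -
  define \<psi> where "\<psi> = inv_into {0..1} \<phi>"
  define e where "e = (\<lambda>X1 X2 x. (X2 x * p x - X1 x * q x) / p x ^ 3)"
  have X': "h2 (X \<circ> \<psi>) (\<lambda>y. X1 (\<psi> y) / p (\<psi> y)) (\<lambda>y. e X1 X2 (\<psi> y))"
    unfolding e_def \<psi>_def by (rule h2_comp_inverse[OF d X])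
  have Y': "h2 (Y \<circ> \<psi>) (\<lambda>y. Y1 (\<psi> y) / p (\<psi> y)) (\<lambda>y. e Y1 Y2 (\<psi> y))"
    unfolding e_def \<psi>_def by (rule h2_comp_inverse[OF d Y])
  have a: "ae (\<lambda>y. wderiv (wderiv (X \<circ> \<psi>)) y * wderiv (wderiv (Y \<circ> \<psi>)) y = e X1 X2 (\<psi> y) * e Y1 Y2 (\<psi> y))"
    using h2_wderiv[OF X'] h2_wderiv[OF Y'] by eventually_elim simp
  have L: "L1 (\<lambda>y. e X1 X2 (\<psi> y) * e Y1 Y2 (\<psi> y))" by (rule L2_mult[OF h2D(3)[OF X'] h2D(3)[OF Y']])
  have "G \<phi> X Y = integral {0..1} (\<lambda>y. wderiv (wderiv (X \<circ> \<psi>)) y * wderiv (wderiv (Y \<circ> \<psi>)) y)"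
    unfolding G_def \<psi>_def[symmetric] by (rule LINT_eq[OF L1_cong_ae[OF L a]])
  also have "\<dots> = integral {0..1} (\<lambda>y. e X1 X2 (\<psi> y) * e Y1 Y2 (\<psi> y))"
    by (rule integral_cong_ae[OF a]) simp
  also have "\<dots> = integral {0..1} (\<lambda>x. p x * (e X1 X2 x * e Y1 Y2 x))"
  proof -
    have Le: "L2 (e Z1 Z2)" if Z: "h2 Z Z1 Z2" for Z Z1 Z2
      unfolding e_def by (rule L2_second_derivative_quotient[OF d Z])
    show ?thesis
      using change_of_variables(2)[OF d L2_mult[OF Le[OF X] Le[OF Y]], of 1] diffeoD(3)[OF d]
      by (simp add: \<psi>_def)
  qed
  also have "\<dots> = integral {0..1} (\<lambda>x. (X2 x * p x - X1 x * q x) * (Y2 x * p x - Y1 x * q x) / p x ^ 5)"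
  proof (rule HK_integral_cong)
    fix x :: real assume "x \<in> {0..1}"
    then have "p x \<noteq> 0" using diffeoD(4)[OF d] by force
    then show "p x * (e X1 X2 x * e Y1 Y2 x) = (X2 x * p x - X1 x * q x) * (Y2 x * p x - Y1 x * q x) / p x ^ 5"
      unfolding e_def by (simp add: divide_simps) (simp add: power_def numeral_eq_Suc)
  qed
  finally show ?thesis .
qed

section \<open>Limits and derivatives of curves of functions\<close>

lemma L1_integral_mono:
  assumes "L1 f" "L1 g" "\<And>x. x \<in> {0..1} \<Longrightarrow> f x \<le> g x"
  shows "integral {0..1} f \<le> integral {0..1} g"
  using assms by (intro integral_le L1_integrable) auto

lemma L1_integral_abs_le:
  assumes "L1 f" "{a..b} \<subseteq> {0..1}"
  shows "\<bar>integral {a..b} f\<bar> \<le> integral {0..1} (\<lambda>x. \<bar>f x\<bar>)"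
proof -
  have L: "L1 (\<lambda>x. \<bar>f x\<bar>)" by (rule set_integrable_abs[OF assms(1)])
  have "norm (integral {a..b} f) \<le> integral {a..b} (\<lambda>x. \<bar>f x\<bar>)"
    by (intro Henstock_Kurzweil_Integration.integral_norm_bound_integral L1_integrable assms L) simp
  also have "\<dots> \<le> integral {0..1} (\<lambda>x. \<bar>f x\<bar>)"
    by (intro integral_subset_le L1_integrable assms L) auto
  finally show ?thesis by simp
qed

lemma L2_integral_nonneg: "0 \<le> integral {0..1} (\<lambda>x. (f x)\<^sup>2)" for f :: "real \<Rightarrow> real"
  by (cases "(\<lambda>x. (f x)\<^sup>2) integrable_on {0..1}")
    (auto intro: Henstock_Kurzweil_Integration.integral_nonneg simp: not_integrable_integral)

lemma integral_cmult': "integral {a..b} (\<lambda>x. c * f x) = c * integral {a..b} f" for c :: real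
  by simp

text \<open>The nonnegative quadratic polynomial in \<open>t\<close> is evaluated at its minimum
  \<open>- b / c\<close>. If \<open>c = 0\<close> it is affine, and a nonzero slope would let it
  take the value -1.\<close>

lemma Cauchy_Schwarz:
  assumes "L2 f" "L2 g"
  shows "(integral {0..1} (\<lambda>x. f x * g x))\<^sup>2 \<le> integral {0..1} (\<lambda>x. (f x)\<^sup>2) * integral {0..1} (\<lambda>x. (g x)\<^sup>2)"
proof -
  define a b c where "a = integral {0..1} (\<lambda>x. (f x)\<^sup>2)"
    and "b = integral {0..1} (\<lambda>x. f x * g x)" and "c = integral {0..1} (\<lambda>x. (g x)\<^sup>2)"
  have q: "0 \<le> a + 2 * t * b + t\<^sup>2 * c" for t
  proof -
    have "integral {0..1} (\<lambda>x. (f x + t * g x)\<^sup>2)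
        = integral {0..1} (\<lambda>x. ((f x)\<^sup>2 + 2 * t * (f x * g x)) + t\<^sup>2 * (g x)\<^sup>2)"
      by (rule HK_integral_cong) (simp add: power2_sum power_mult_distrib)
    also have "\<dots> = a + 2 * t * b + t\<^sup>2 * c"
      unfolding a_def b_def c_def
      by (subst integral_add'; (subst integral_add')?)
        (auto intro!: set_integral_add(1) set_integrable_mult_right L2_square L2_mult assms)
    finally show ?thesis using L2_integral_nonneg[of "\<lambda>x. f x + t * g x"] by simp
  qed
  have "c \<ge> 0" unfolding c_def by (rule L2_integral_nonneg)
  show ?thesis
  proof (cases "c = 0")
    case True
    have "b = 0"
    proof (rule ccontr)
      assume "b \<noteq> 0"
      then have "2 * (- (a + 1) / (2 * b)) * b = - (a + 1)" by simp
      then show False using q[of "- (a + 1) / (2 * b)"] True by simp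
    qed
    then show ?thesis using True by (simp add: a_def[symmetric] b_def[symmetric] c_def[symmetric])
  next
    case False
    then have "0 \<le> (a + 2 * (- b / c) * b + (- b / c)\<^sup>2 * c) * c"
      using q[of "- b / c"] \<open>c \<ge> 0\<close> by (intro mult_nonneg_nonneg)
    also have "\<dots> = a * c - b\<^sup>2" using False by (simp add: field_simps power2_eq_square)
    finally show ?thesis by (simp add: a_def[symmetric] b_def[symmetric] c_def[symmetric])
  qed
qed

lemma Cauchy_Schwarz_abs:
  assumes "L2 f" "L2 g"
  shows "integral {0..1} (\<lambda>x. \<bar>f x * g x\<bar>)
    \<le> sqrt (integral {0..1} (\<lambda>x. (f x)\<^sup>2)) * sqrt (integral {0..1} (\<lambda>x. (g x)\<^sup>2))"
proof -
  have abs: "L2 (\<lambda>x. \<bar>h x\<bar>)" if "L2 h" for h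
    using that unfolding L2_iff by (auto intro: set_integrable_abs)
  have "integral {0..1} (\<lambda>x. \<bar>f x\<bar> * \<bar>g x\<bar>)
    \<le> sqrt ((integral {0..1} (\<lambda>x. \<bar>f x\<bar> * \<bar>g x\<bar>))\<^sup>2)" by simp
  also have "\<dots> \<le> sqrt (integral {0..1} (\<lambda>x. \<bar>f x\<bar>\<^sup>2) * integral {0..1} (\<lambda>x. \<bar>g x\<bar>\<^sup>2))"
    by (intro real_sqrt_le_mono Cauchy_Schwarz abs assms)
  finally show ?thesis by (simp add: abs_mult real_sqrt_mult)
qed

section \<open>Convergence in L2, in L1 and uniformly\<close>

text \<open>Families of second space derivatives converge only in L2, lower ones uniformly
  (\<open>ulim\<close>), and products of two L2 families in L1 (\<open>L1lim\<close>). Integrability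
  of the members is asked only eventually, since members outside the time interval are not
  controlled.\<close>

definition L2lim :: "('s \<Rightarrow> real \<Rightarrow> real) \<Rightarrow> (real \<Rightarrow> real) \<Rightarrow> 's filter \<Rightarrow> bool" where
  "L2lim H h F \<longleftrightarrow> L2 h \<and> (\<forall>\<^sub>F s in F. L2 (H s)) \<and>
     ((\<lambda>s. integral {0..1} (\<lambda>x. (H s x - h x)\<^sup>2)) \<longlongrightarrow> 0) F"

definition L1lim :: "('s \<Rightarrow> real \<Rightarrow> real) \<Rightarrow> (real \<Rightarrow> real) \<Rightarrow> 's filter \<Rightarrow> bool" where
  "L1lim H h F \<longleftrightarrow> L1 h \<and> (\<forall>\<^sub>F s in F. L1 (H s)) \<and>
     ((\<lambda>s. integral {0..1} (\<lambda>x. \<bar>H s x - h x\<bar>)) \<longlongrightarrow> 0) F"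

definition ulim :: "('s \<Rightarrow> real \<Rightarrow> real) \<Rightarrow> (real \<Rightarrow> real) \<Rightarrow> 's filter \<Rightarrow> bool" where
  "ulim R r F \<longleftrightarrow> uniform_limit {0..1} R r F \<and> continuous_on {0..1} r \<and>
     (\<forall>\<^sub>F s in F. continuous_on {0..1} (R s))"

lemma L2lim_const: "L2 h \<Longrightarrow> L2lim (\<lambda>_. h) h F"
  by (simp add: L2lim_def)

lemma ulim_const: "continuous_on {0..1} r \<Longrightarrow> ulim (\<lambda>_. r) r F"
  by (simp add: ulim_def uniform_limit_const)

lemma L2lim_add:
  assumes "L2lim H h F" "L2lim K k F"
  shows "L2lim (\<lambda>s x. H s x + K s x) (\<lambda>x. h x + k x) F"
  unfolding L2lim_def
proof (intro conjI)
  have L: "L2 h" "L2 k" "\<forall>\<^sub>F s in F. L2 (H s)" "\<forall>\<^sub>F s in F. L2 (K s)"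
    and t: "((\<lambda>s. integral {0..1} (\<lambda>x. (H s x - h x)\<^sup>2)) \<longlongrightarrow> 0) F"
    "((\<lambda>s. integral {0..1} (\<lambda>x. (K s x - k x)\<^sup>2)) \<longlongrightarrow> 0) F"
    using assms unfolding L2lim_def by blast+
  show "L2 (\<lambda>x. h x + k x)" by (intro L2_add L)
  show "\<forall>\<^sub>F s in F. L2 (\<lambda>x. H s x + K s x)" using L(3,4) by eventually_elim (rule L2_add)
  show "((\<lambda>s. integral {0..1} (\<lambda>x. (H s x + K s x - (h x + k x))\<^sup>2)) \<longlongrightarrow> 0) F"
  proof (rule tendsto_sandwich[OF _ _ tendsto_const])
    show "((\<lambda>s. 2 * integral {0..1} (\<lambda>x. (H s x - h x)\<^sup>2) + 2 * integral {0..1} (\<lambda>x. (K s x - k x)\<^sup>2)) \<longlongrightarrow> 0) F"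
      using tendsto_add[OF tendsto_mult_left[OF t(1), of 2] tendsto_mult_left[OF t(2), of 2]] by simp
    show "\<forall>\<^sub>F s in F. integral {0..1} (\<lambda>x. (H s x + K s x - (h x + k x))\<^sup>2)
        \<le> 2 * integral {0..1} (\<lambda>x. (H s x - h x)\<^sup>2) + 2 * integral {0..1} (\<lambda>x. (K s x - k x)\<^sup>2)"
      using L(3,4)
    proof eventually_elim
      case (elim s)
      have 1: "L1 (\<lambda>x. 2 * (H s x - h x)\<^sup>2)" "L1 (\<lambda>x. 2 * (K s x - k x)\<^sup>2)"
        by (intro set_integrable_mult_right L2_square L2_diff elim L)+
      have "integral {0..1} (\<lambda>x. (H s x + K s x - (h x + k x))\<^sup>2)
         \<le> integral {0..1} (\<lambda>x. 2 * (H s x - h x)\<^sup>2 + 2 * (K s x - k x)\<^sup>2)"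
      proof (rule L1_integral_mono)
        fix x
        have "0 \<le> ((H s x - h x) - (K s x - k x))\<^sup>2" by simp
        then show "(H s x + K s x - (h x + k x))\<^sup>2 \<le> 2 * (H s x - h x)\<^sup>2 + 2 * (K s x - k x)\<^sup>2"
          by (simp add: power2_eq_square algebra_simps)
      qed (intro L2_square L2_diff L2_add elim L set_integral_add(1) 1)+
      also have "\<dots> = 2 * integral {0..1} (\<lambda>x. (H s x - h x)\<^sup>2) + 2 * integral {0..1} (\<lambda>x. (K s x - k x)\<^sup>2)"
        using integral_add'[OF 1, of 0 1] by simp
      finally show ?case .
    qed
  qed (auto intro: always_eventually L2_integral_nonneg)
qed

lemma bounded_on_unit:
  assumes "continuous_on {0..1} r"
  obtains B :: real where "B > 0" "\<And>x::real. x \<in> {0..1} \<Longrightarrow> \<bar>r x :: real\<bar> \<le> B"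
proof -
  have "bounded (r ` {0..1})" using assms by (intro compact_imp_bounded compact_continuous_image) auto
  then obtain B where "B > 0" "\<And>y. y \<in> r ` {0..1} \<Longrightarrow> norm y \<le> B" unfolding bounded_pos by blast
  then show ?thesis using that by force
qed

text \<open>The error splits into \<open>(H - h) * R\<close> and \<open>h * (R - r)\<close>: in the
  first \<open>R\<close> is eventually bounded by \<open>B + 1\<close>, in the second the uniform
  error comes out of the integral of \<open>(h x)\<^sup>2\<close>.\<close>

lemma L2lim_mult_ulim:
  assumes "L2lim H h F" "ulim R r F"
  shows "L2lim (\<lambda>s x. H s x * R s x) (\<lambda>x. h x * r x) F"
proof -
  have L: "L2 h" "\<forall>\<^sub>F s in F. L2 (H s)"
    and t: "((\<lambda>s. integral {0..1} (\<lambda>x. (H s x - h x)\<^sup>2)) \<longlongrightarrow> 0) F"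
    using assms(1) unfolding L2lim_def by blast+
  have r: "continuous_on {0..1} r" "\<forall>\<^sub>F s in F. continuous_on {0..1} (R s)"
    and u: "\<And>e. e > 0 \<Longrightarrow> \<forall>\<^sub>F s in F. \<forall>x\<in>{0..1}. \<bar>R s x - r x\<bar> < e"
    using assms(2) unfolding ulim_def uniform_limit_iff dist_real_def by blast+
  obtain B where B: "B > 0" "\<And>x. x \<in> {0..1} \<Longrightarrow> \<bar>r x\<bar> \<le> B" by (rule bounded_on_unit[OF r(1)]) blast
  have "L2lim (\<lambda>s x. (H s x - h x) * R s x) (\<lambda>x. 0) F"
    unfolding L2lim_def
  proof (intro conjI)
    show "\<forall>\<^sub>F s in F. L2 (\<lambda>x. (H s x - h x) * R s x)"
      using L(2) r(2) by eventually_elim (intro L2_mult_cont L2_diff L)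
    show "((\<lambda>s. integral {0..1} (\<lambda>x. ((H s x - h x) * R s x - 0)\<^sup>2)) \<longlongrightarrow> 0) F"
    proof (rule tendsto_sandwich[OF _ _ tendsto_const])
      show "((\<lambda>s. (B + 1)\<^sup>2 * integral {0..1} (\<lambda>x. (H s x - h x)\<^sup>2)) \<longlongrightarrow> 0) F"
        using tendsto_mult_left[OF t, of "(B+1)\<^sup>2"] by simp
      show "\<forall>\<^sub>F s in F. integral {0..1} (\<lambda>x. ((H s x - h x) * R s x - 0)\<^sup>2)
          \<le> (B + 1)\<^sup>2 * integral {0..1} (\<lambda>x. (H s x - h x)\<^sup>2)"
        using L(2) r(2) u[OF zero_less_one]
      proof eventually_elim
        case (elim s)
        have "integral {0..1} (\<lambda>x. ((H s x - h x) * R s x - 0)\<^sup>2)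
            \<le> integral {0..1} (\<lambda>x. (B+1)\<^sup>2 * (H s x - h x)\<^sup>2)"
        proof (rule L1_integral_mono)
          fix x :: real assume x: "x \<in> {0..1}"
          have "\<bar>R s x\<bar> \<le> B + 1" using B(2)[OF x] bspec[OF elim(3) x] by linarith
          then have "(R s x)\<^sup>2 \<le> (B+1)\<^sup>2" by (metis abs_ge_zero power2_abs power_mono)
          then show "((H s x - h x) * R s x - 0)\<^sup>2 \<le> (B+1)\<^sup>2 * (H s x - h x)\<^sup>2"
            by (simp add: power_mult_distrib mult.commute mult_right_mono)
        next
          show "L1 (\<lambda>x. ((H s x - h x) * R s x - 0)\<^sup>2)"
            using L2_square[OF L2_mult_cont[OF L2_diff[OF elim(1) L(1)] elim(2)]] by simp
        qed (intro set_integrable_mult_right L2_square L2_diff L elim)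
        then show ?case by simp
      qed
    qed (auto intro: always_eventually L2_integral_nonneg)
  qed (auto intro: L2_cont)
  moreover have "L2lim (\<lambda>s x. h x * R s x) (\<lambda>x. h x * r x) F"
    unfolding L2lim_def
  proof (intro conjI)
    show "L2 (\<lambda>x. h x * r x)" by (intro L2_mult_cont L r)
    show "\<forall>\<^sub>F s in F. L2 (\<lambda>x. h x * R s x)"
      using r(2) by eventually_elim (intro L2_mult_cont L)
    show "((\<lambda>s. integral {0..1} (\<lambda>x. (h x * R s x - h x * r x)\<^sup>2)) \<longlongrightarrow> 0) F"
    proof (rule tendstoI)
      fix e :: real assume "e > 0"
      define I where "I = integral {0..1} (\<lambda>x. (h x)\<^sup>2)"
      have "I \<ge> 0" unfolding I_def by (rule L2_integral_nonneg)
      \<comment> \<open>The denominator \<open>I + 1\<close> excludes division by zero and makes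
        \<open>\<delta>\<^sup>2 * I\<close> strictly smaller than \<open>e\<close>.\<close>
      define \<delta> where "\<delta> = sqrt (e / (I + 1))"
      have \<delta>: "\<delta> > 0" "\<delta>\<^sup>2 * I < e"
        using \<open>e > 0\<close> \<open>I \<ge> 0\<close> by (auto simp: \<delta>_def field_simps)
      show "\<forall>\<^sub>F s in F. dist (integral {0..1} (\<lambda>x. (h x * R s x - h x * r x)\<^sup>2)) 0 < e"
        using r(2) u[OF \<delta>(1)]
      proof eventually_elim
        case (elim s)
        have "integral {0..1} (\<lambda>x. (h x * R s x - h x * r x)\<^sup>2) \<le> integral {0..1} (\<lambda>x. \<delta>\<^sup>2 * (h x)\<^sup>2)"
        proof (rule L1_integral_mono)
          fix x :: real assume x: "x \<in> {0..1}"
          have "\<bar>R s x - r x\<bar> \<le> \<delta>" using bspec[OF elim(2) x] by linarith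
          then have "(R s x - r x)\<^sup>2 \<le> \<delta>\<^sup>2" by (metis abs_ge_zero power2_abs power_mono)
          then show "(h x * R s x - h x * r x)\<^sup>2 \<le> \<delta>\<^sup>2 * (h x)\<^sup>2"
            unfolding right_diff_distrib[symmetric] power_mult_distrib mult.commute[of "\<delta>\<^sup>2"]
            by (rule mult_left_mono) simp
        qed (intro set_integrable_mult_right L2_square L2_diff L2_mult_cont L elim r)+
        also have "\<dots> < e" using \<delta>(2) by (simp add: I_def)
        finally show ?case using L2_integral_nonneg[of "\<lambda>x. h x * R s x - h x * r x"] by simp
      qed
    qed
  qed
  ultimately have "L2lim (\<lambda>s x. (H s x - h x) * R s x + h x * R s x) (\<lambda>x. 0 + h x * r x) F"
    by (rule L2lim_add)
  then show ?thesis by (simp add: left_diff_distrib)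
qed

lemma L2lim_cmult: "L2lim H h F \<Longrightarrow> L2lim (\<lambda>s x. c * H s x) (\<lambda>x. c * h x) F"
  using L2lim_mult_ulim[of H h F "\<lambda>_ _. c" "\<lambda>_. c"] ulim_const[of "\<lambda>_. c" F] by (simp add: mult.commute)

lemma L2lim_diff:
  "L2lim H h F \<Longrightarrow> L2lim K k F \<Longrightarrow> L2lim (\<lambda>s x. H s x - K s x) (\<lambda>x. h x - k x) F"
  using L2lim_add[of H h F "\<lambda>s x. (-1) * K s x" "\<lambda>x. (-1) * k x"] L2lim_cmult[of K k F "-1"] by simp

text \<open>The difference of the products is
  \<open>(H - h) * (K - k) + (H - h) * k + h * (K - k)\<close>, and Cauchy-Schwarz bounds each of
  these terms by L2 distances and norms.\<close>

lemma L2lim_mult: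
  assumes "L2lim H h F" "L2lim K k F"
  shows "L1lim (\<lambda>s x. H s x * K s x) (\<lambda>x. h x * k x) F"
  unfolding L1lim_def
proof (intro conjI)
  have L: "L2 h" "L2 k" "\<forall>\<^sub>F s in F. L2 (H s)" "\<forall>\<^sub>F s in F. L2 (K s)"
    and t: "((\<lambda>s. integral {0..1} (\<lambda>x. (H s x - h x)\<^sup>2)) \<longlongrightarrow> 0) F"
    "((\<lambda>s. integral {0..1} (\<lambda>x. (K s x - k x)\<^sup>2)) \<longlongrightarrow> 0) F"
    using assms unfolding L2lim_def by blast+
  show "L1 (\<lambda>x. h x * k x)" by (intro L2_mult L)
  show "\<forall>\<^sub>F s in F. L1 (\<lambda>x. H s x * K s x)" using L(3,4) by eventually_elim (rule L2_mult)
  define a where "a = (\<lambda>s. sqrt (integral {0..1} (\<lambda>x. (H s x - h x)\<^sup>2)))"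
  define b where "b = (\<lambda>s. sqrt (integral {0..1} (\<lambda>x. (K s x - k x)\<^sup>2)))"
  define ca where "ca = sqrt (integral {0..1} (\<lambda>x. (h x)\<^sup>2))"
  define cb where "cb = sqrt (integral {0..1} (\<lambda>x. (k x)\<^sup>2))"
  have ab: "(a \<longlongrightarrow> 0) F" "(b \<longlongrightarrow> 0) F"
    using tendsto_real_sqrt[OF t(1)] tendsto_real_sqrt[OF t(2)] by (simp_all add: a_def b_def)
  show "((\<lambda>s. integral {0..1} (\<lambda>x. \<bar>H s x * K s x - h x * k x\<bar>)) \<longlongrightarrow> 0) F"
  proof (rule tendsto_sandwich[OF _ _ tendsto_const])
    have "((\<lambda>s. a s * b s + a s * cb + ca * b s) \<longlongrightarrow> 0 * 0 + 0 * cb + ca * 0) F"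
      by (intro tendsto_intros ab)
    then show "((\<lambda>s. a s * b s + a s * cb + ca * b s) \<longlongrightarrow> 0) F" by simp
    show "\<forall>\<^sub>F s in F. 0 \<le> integral {0..1} (\<lambda>x. \<bar>H s x * K s x - h x * k x\<bar>)"
      using L(3,4)
      by eventually_elim
       (intro Henstock_Kurzweil_Integration.integral_nonneg L1_integrable set_integrable_abs set_integral_diff(1) L2_mult L; simp)
    show "\<forall>\<^sub>F s in F. integral {0..1} (\<lambda>x. \<bar>H s x * K s x - h x * k x\<bar>) \<le> a s * b s + a s * cb + ca * b s"
      using L(3,4)
    proof eventually_elim
      case (elim s)
      have D: "L2 (\<lambda>x. H s x - h x)" "L2 (\<lambda>x. K s x - k x)" by (intro L2_diff elim L)+
      have A: "L1 (\<lambda>x. \<bar>(H s x - h x) * (K s x - k x)\<bar>)" "L1 (\<lambda>x. \<bar>(H s x - h x) * k x\<bar>)"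
        "L1 (\<lambda>x. \<bar>h x * (K s x - k x)\<bar>)" by (intro set_integrable_abs L2_mult D L)+
      have "integral {0..1} (\<lambda>x. \<bar>H s x * K s x - h x * k x\<bar>) \<le>
         integral {0..1} (\<lambda>x. \<bar>(H s x - h x) * (K s x - k x)\<bar> + \<bar>(H s x - h x) * k x\<bar> + \<bar>h x * (K s x - k x)\<bar>)"
      proof (rule L1_integral_mono)
        fix x
        have "H s x * K s x - h x * k x = (H s x - h x) * (K s x - k x) + (H s x - h x) * k x + h x * (K s x - k x)"
          by (simp add: algebra_simps)
        then show "\<bar>H s x * K s x - h x * k x\<bar> \<le> \<bar>(H s x - h x) * (K s x - k x)\<bar> + \<bar>(H s x - h x) * k x\<bar> + \<bar>h x * (K s x - k x)\<bar>"
          by linarith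
      qed (intro set_integrable_abs set_integral_diff(1) set_integral_add(1) A L2_mult L elim)+
      also have "\<dots> = integral {0..1} (\<lambda>x. \<bar>(H s x - h x) * (K s x - k x)\<bar>) + integral {0..1} (\<lambda>x. \<bar>(H s x - h x) * k x\<bar>)
          + integral {0..1} (\<lambda>x. \<bar>h x * (K s x - k x)\<bar>)"
        using A by (simp add: integral_add' set_integral_add(1))
      also have "\<dots> \<le> a s * b s + a s * cb + ca * b s"
        unfolding a_def b_def ca_def cb_def by (intro add_mono Cauchy_Schwarz_abs D L)
      finally show ?case .
    qed
  qed
qed

lemma L2lim_imp_L1lim: "L2lim H h F \<Longrightarrow> L1lim H h F"
  using L2lim_mult[of H h F "\<lambda>_ _. 1" "\<lambda>_. 1"] L2lim_const[of "\<lambda>_. 1" F] by (simp add: L2_cont)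

text \<open>Whatever the upper end, the primitives differ by at most the L1 distance of the
  integrands. This turns L2 convergence of one derivative into uniform convergence of the derivative
  below it.\<close>

lemma L1lim_integral_uniform:
  assumes "L1lim H h F"
  shows "uniform_limit {0..1} (\<lambda>s x. integral {0..x} (H s)) (\<lambda>x. integral {0..x} h) F"
proof (rule uniform_limitI)
  fix e :: real assume "e > 0"
  have L: "L1 h" "\<forall>\<^sub>F s in F. L1 (H s)"
    and t: "((\<lambda>s. integral {0..1} (\<lambda>x. \<bar>H s x - h x\<bar>)) \<longlongrightarrow> 0) F"
    using assms unfolding L1lim_def by blast+
  have "\<forall>\<^sub>F s in F. dist (integral {0..1} (\<lambda>x. \<bar>H s x - h x\<bar>)) 0 < e"
    using t \<open>e > 0\<close> by (rule tendstoD)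
  then show "\<forall>\<^sub>F s in F. \<forall>x\<in>{0..1}. dist (integral {0..x} (H s)) (integral {0..x} h) < e"
    using L(2)
  proof eventually_elim
    case (elim s)
    show ?case
    proof
      fix x :: real assume "x \<in> {0..1}"
      then have sub: "{0..x} \<subseteq> {0..1}" by auto
      have "\<bar>integral {0..x} (\<lambda>x. H s x - h x)\<bar> \<le> integral {0..1} (\<lambda>x. \<bar>H s x - h x\<bar>)"
        by (intro L1_integral_abs_le set_integral_diff(1) elim L sub)
      then show "dist (integral {0..x} (H s)) (integral {0..x} h) < e"
        using elim(1) integral_diff'[OF elim(2) L(1) sub] by (simp add: dist_real_def)
    qed
  qed
qed

lemma L1lim_integral:
  assumes "L1lim H h F" "x \<in> {0..1}"
  shows "((\<lambda>s. integral {0..x} (H s)) \<longlongrightarrow> integral {0..x} h) F"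
  using tendsto_uniform_limitI[OF L1lim_integral_uniform[OF assms(1)] assms(2)] .

section \<open>Joint continuity and differentiability in time\<close>

definition jcont :: "real \<Rightarrow> real \<Rightarrow> (real \<Rightarrow> real \<Rightarrow> real) \<Rightarrow> bool" where
  "jcont a b R \<longleftrightarrow> continuous_on ({a..b} \<times> {0..1}) (\<lambda>z. R (fst z) (snd z))"

lemma jcont_slice:
  assumes "jcont a b R"
  shows "s \<in> {a..b} \<Longrightarrow> continuous_on {0..1} (R s)"
    and "x \<in> {0..1} \<Longrightarrow> continuous_on {a..b} (\<lambda>s. R s x)"
proof -
  show "s \<in> {a..b} \<Longrightarrow> continuous_on {0..1} (R s)"
    using continuous_on_compose2[OF assms[unfolded jcont_def], of "{0..1}" "\<lambda>x. (s, x)"]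
    by (force intro: continuous_intros)
  show "x \<in> {0..1} \<Longrightarrow> continuous_on {a..b} (\<lambda>s. R s x)"
    using continuous_on_compose2[OF assms[unfolded jcont_def], of "{a..b}" "\<lambda>s. (s, x)"]
    by (force intro: continuous_intros)
qed

lemma jcont_mult: "jcont a b R \<Longrightarrow> jcont a b S \<Longrightarrow> jcont a b (\<lambda>t x. R t x * S t x)"
  and jcont_add: "jcont a b R \<Longrightarrow> jcont a b S \<Longrightarrow> jcont a b (\<lambda>t x. R t x + S t x)"
  and jcont_const: "jcont a b (\<lambda>t x. z)"
  unfolding jcont_def by (auto intro!: continuous_intros)

lemma jcont_time: "continuous_on {a..b} r \<Longrightarrow> jcont a b (\<lambda>t x. r t)"
  unfolding jcont_def by (rule continuous_on_compose2[where f = fst]) (auto intro: continuous_intros)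

lemma jcont_uniform:
  assumes "jcont a b R" "e > 0"
  obtains d where "d > 0" "\<And>s t x y. s \<in> {a..b} \<Longrightarrow> t \<in> {a..b} \<Longrightarrow> x \<in> {0..1} \<Longrightarrow> y \<in> {0..1} \<Longrightarrow>
     \<bar>s - t\<bar> < d \<Longrightarrow> \<bar>x - y\<bar> < d \<Longrightarrow> \<bar>R s x - R t y\<bar> < e"
proof -
  have "uniformly_continuous_on ({a..b} \<times> {0..1}) (\<lambda>z. R (fst z) (snd z))"
    using assms(1) unfolding jcont_def by (intro compact_uniformly_continuous compact_Times) auto
  then obtain d where d: "d > 0" "\<And>z w. z \<in> {a..b} \<times> {0..1} \<Longrightarrow> w \<in> {a..b} \<times> {0..1} \<Longrightarrow> dist w z < d \<Longrightarrow>
     dist (R (fst w) (snd w)) (R (fst z) (snd z)) < e"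
    using \<open>e > 0\<close> unfolding uniformly_continuous_on_def by meson
  have "\<bar>R s x - R t y\<bar> < e"
    if "s \<in> {a..b}" "t \<in> {a..b}" "x \<in> {0..1}" "y \<in> {0..1}" "\<bar>s - t\<bar> < d/2" "\<bar>x - y\<bar> < d/2" for s t x y
  proof -
    have "dist (s, x) (t, y) \<le> \<bar>s - t\<bar> + \<bar>x - y\<bar>"
      unfolding dist_prod_def by (simp add: dist_real_def) (metis sqrt_sum_squares_le_sum_abs power2_abs)
    then have "dist (s, x) (t, y) < d" using that by linarith
    then show ?thesis using d(2)[of "(t, y)" "(s, x)"] that by (simp add: dist_real_def)
  qed
  then show ?thesis using that[of "d/2"] d(1) by simp
qed

lemma jcont_ulim:
  assumes "jcont a b R" "t \<in> {a..b}"
  shows "ulim R (R t) (at t within {a..b})"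
  unfolding ulim_def
proof (intro conjI)
  show "continuous_on {0..1} (R t)" by (rule jcont_slice(1)[OF assms])
  have T: "\<forall>\<^sub>F s in at t within {a..b}. s \<in> {a..b}" by (simp add: eventually_at_filter)
  then show "\<forall>\<^sub>F s in at t within {a..b}. continuous_on {0..1} (R s)"
    by eventually_elim (rule jcont_slice(1)[OF assms(1)])
  show "uniform_limit {0..1} R (R t) (at t within {a..b})"
  proof (rule uniform_limitI)
    fix e :: real assume "e > 0"
    obtain d where d: "d > 0" "\<And>s t x y. s \<in> {a..b} \<Longrightarrow> t \<in> {a..b} \<Longrightarrow> x \<in> {0..1} \<Longrightarrow> y \<in> {0..1} \<Longrightarrow>
     \<bar>s - t\<bar> < d \<Longrightarrow> \<bar>x - y\<bar> < d \<Longrightarrow> \<bar>R s x - R t y\<bar> < e" by (rule jcont_uniform[OF assms(1) \<open>e > 0\<close>]) blast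
    have "\<forall>\<^sub>F s in at t within {a..b}. dist s t < d"
      using d(1) by (metis eventually_at)
    then show "\<forall>\<^sub>F s in at t within {a..b}. \<forall>x\<in>{0..1}. dist (R s x) (R t x) < e"
      using T by eventually_elim (use d assms(2) in \<open>auto simp: dist_real_def\<close>)
  qed
qed

lemma jcontI_uniform:
  assumes c: "\<And>t. t \<in> {a..b} \<Longrightarrow> continuous_on {0..1} (R t)"
    and u: "\<And>t. t \<in> {a..b} \<Longrightarrow> uniform_limit {0..1} R (R t) (at t within {a..b})"
  shows "jcont a b R"
  unfolding jcont_def continuous_on_iff
proof (intro ballI allI impI)
  fix z :: "real \<times> real" and e :: real assume z: "z \<in> {a..b} \<times> {0..1}" and "e > 0"
  obtain t x where tx: "z = (t, x)" "t \<in> {a..b}" "x \<in> {0..1}" using z by auto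
  have "\<forall>\<^sub>F s in at t within {a..b}. \<forall>x\<in>{0..1}. dist (R s x) (R t x) < e / 2"
    by (rule uniform_limitD[OF u[OF tx(2)]]) (use \<open>e > 0\<close> in simp)
  then obtain d where d: "d > 0" "\<And>s y. s \<in> {a..b} \<Longrightarrow> s \<noteq> t \<Longrightarrow> dist s t < d \<Longrightarrow> y \<in> {0..1} \<Longrightarrow> dist (R s y) (R t y) < e / 2"
    unfolding eventually_at by blast
  have "e / 2 > 0" using \<open>e > 0\<close> by simp
  then obtain d' where d': "d' > 0" "\<And>y. y \<in> {0..1} \<Longrightarrow> dist y x < d' \<Longrightarrow> dist (R t y) (R t x) < e / 2"
    using c[OF tx(2)] tx(3) unfolding continuous_on_iff by blast
  show "\<exists>d>0. \<forall>w\<in>{a..b} \<times> {0..1}. dist w z < d \<longrightarrow> dist (R (fst w) (snd w)) (R (fst z) (snd z)) < e"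
  proof (intro exI[of _ "min d d'"] conjI ballI impI)
    fix w :: "real \<times> real" assume w: "w \<in> {a..b} \<times> {0..1}" "dist w z < min d d'"
    have 1: "dist (fst w) t < d" "dist (snd w) x < d'"
      using dist_fst_le[of w z] dist_snd_le[of w z] w(2) tx(1) by auto
    have "dist (R (fst w) (snd w)) (R t (snd w)) < e / 2"
      using d(2)[of "fst w" "snd w"] 1(1) w(1) \<open>e > 0\<close> by (cases "fst w = t") auto
    moreover have "dist (R t (snd w)) (R t x) < e / 2" using d'(2)[of "snd w"] 1(2) w(1) by auto
    ultimately show "dist (R (fst w) (snd w)) (R (fst z) (snd z)) < e"
      using dist_triangle[of "R (fst w) (snd w)" "R t x" "R t (snd w)"] tx(1) by simp
  qed (use d(1) d'(1) in simp)
qed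

definition C1t :: "real \<Rightarrow> real \<Rightarrow> (real \<Rightarrow> real \<Rightarrow> real) \<Rightarrow> (real \<Rightarrow> real \<Rightarrow> real) \<Rightarrow> bool" where
  "C1t a b R R' \<longleftrightarrow> jcont a b R \<and> jcont a b R' \<and>
    (\<forall>s\<in>{a..b}. \<forall>x\<in>{0..1}. ((\<lambda>s. R s x) has_real_derivative R' s x) (at s within {a..b}))"

lemma C1tD:
  assumes "C1t a b R R'"
  shows "jcont a b R" "jcont a b R'"
    "s \<in> {a..b} \<Longrightarrow> x \<in> {0..1} \<Longrightarrow> ((\<lambda>s. R s x) has_real_derivative R' s x) (at s within {a..b})"
  using assms unfolding C1t_def by blast+

text \<open>For fixed x the mean value theorem in time makes the quotient equal to \<open>R'\<close>
  at an intermediate time; uniform continuity of \<open>R'\<close> on the compact rectangle makes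
  the error independent of x.\<close>

lemma C1t_quotient:
  assumes "C1t a b R R'" "t \<in> {a..b}"
  shows "ulim (\<lambda>s x. (R s x - R t x) / (s - t)) (R' t) (at t within {a..b})"
  unfolding ulim_def
proof (intro conjI)
  note R = C1tD[OF assms(1)]
  show "continuous_on {0..1} (R' t)" by (rule jcont_slice(1)[OF R(2) assms(2)])
  have T: "\<forall>\<^sub>F s in at t within {a..b}. s \<in> {a..b} \<and> s \<noteq> t" by (simp add: eventually_at_filter)
  then show "\<forall>\<^sub>F s in at t within {a..b}. continuous_on {0..1} (\<lambda>x. (R s x - R t x) / (s - t))"
    by eventually_elim (intro continuous_intros jcont_slice(1)[OF R(1)] assms; simp)
  show "uniform_limit {0..1} (\<lambda>s x. (R s x - R t x) / (s - t)) (R' t) (at t within {a..b})"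
  proof (rule uniform_limitI)
    fix e :: real assume "e > 0"
    obtain d where d: "d > 0" "\<And>s t x y. s \<in> {a..b} \<Longrightarrow> t \<in> {a..b} \<Longrightarrow> x \<in> {0..1} \<Longrightarrow> y \<in> {0..1} \<Longrightarrow>
     \<bar>s - t\<bar> < d \<Longrightarrow> \<bar>x - y\<bar> < d \<Longrightarrow> \<bar>R' s x - R' t y\<bar> < e" by (rule jcont_uniform[OF R(2) \<open>e > 0\<close>]) blast
    have "\<forall>\<^sub>F s in at t within {a..b}. dist s t < d"
      using d(1) by (metis eventually_at)
    then show "\<forall>\<^sub>F s in at t within {a..b}. \<forall>x\<in>{0..1}. dist ((R s x - R t x) / (s - t)) (R' t x) < e"
      using T
    proof eventually_elim
      case (elim s)
      show ?case
      proof
        fix x :: real assume x: "x \<in> {0..1}"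
        have mv: "\<exists>u\<in>{v<..<w}. R w x - R v x = R' u x * (w - v)" if "v < w" "v \<in> {a..b}" "w \<in> {a..b}" for v w
        proof (rule mvt_simple[OF that(1), where f = "\<lambda>s. R s x" and f' = "\<lambda>u h. R' u x * h"])
          fix u assume u: "v \<le> u" "u \<le> w"
          then have "u \<in> {a..b}" using that by simp
          from R(3)[OF this x, unfolded has_field_derivative_def]
          show "((\<lambda>s. R s x) has_derivative (\<lambda>h. R' u x * h)) (at u within {v..w})"
            by (rule has_derivative_subset) (use that in auto)
        qed
        have "\<exists>u\<in>{a..b}. \<bar>u - t\<bar> < d \<and> (R s x - R t x) / (s - t) = R' u x"
        proof (cases "s < t")
          case True
          then obtain u where u: "u \<in> {s<..<t}" "R t x - R s x = R' u x * (t - s)" using mv[of s t] elim assms(2) by blast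
          then have "R s x - R t x = R' u x * (s - t)" by (simp add: algebra_simps)
          then have "(R s x - R t x) / (s - t) = R' u x" using True by simp
          then show ?thesis using u elim assms(2) by (intro bexI[of _ u]) (auto simp: dist_real_def)
        next
          case False
          then have "t < s" using elim by simp
          then obtain u where u: "u \<in> {t<..<s}" "R s x - R t x = R' u x * (s - t)" using mv[of t s] elim assms(2) by blast
          then have "(R s x - R t x) / (s - t) = R' u x" using \<open>t < s\<close> by simp
          then show ?thesis using u elim assms(2) by (intro bexI[of _ u]) (auto simp: dist_real_def)
        qed
        then obtain u where u: "u \<in> {a..b}" "\<bar>u - t\<bar> < d" "(R s x - R t x) / (s - t) = R' u x" by blast
        show "dist ((R s x - R t x) / (s - t)) (R' t x) < e"
          using d(2)[OF u(1) assms(2) x x u(2)] d(1) u(3) by (simp add: dist_real_def)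
      qed
    qed
  qed
qed

lemma C1t_const: "continuous_on {0..1} r \<Longrightarrow> C1t a b (\<lambda>_. r) (\<lambda>_ _. 0)"
  unfolding C1t_def jcont_def
  by (auto intro!: derivative_eq_intros continuous_on_compose2[of "{0..1}" r] continuous_intros)

lemma C1t_linear: "continuous_on {0..1} r \<Longrightarrow> C1t a b (\<lambda>s x. s * r x) (\<lambda>_. r)"
  unfolding C1t_def jcont_def
  by (auto intro!: derivative_eq_intros continuous_on_compose2[of "{0..1}" r] continuous_intros)

lemma C1t_add: "C1t a b R R' \<Longrightarrow> C1t a b S S' \<Longrightarrow> C1t a b (\<lambda>s x. R s x + S s x) (\<lambda>s x. R' s x + S' s x)"
  unfolding C1t_def jcont_def by (auto intro!: derivative_intros continuous_intros)

lemma C1t_mult: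
  "C1t a b R R' \<Longrightarrow> C1t a b S S' \<Longrightarrow> C1t a b (\<lambda>s x. R s x * S s x) (\<lambda>s x. R' s x * S s x + R s x * S' s x)"
  unfolding C1t_def jcont_def by (auto intro!: derivative_eq_intros continuous_intros simp: mult.commute)

text \<open>Stated for \<open>Suc k\<close>, so that the derivative has exponent
  \<open>k + 2\<close> without a truncated subtraction.\<close>

lemma C1t_inverse_power:
  assumes R: "C1t a b R R'" and p: "\<And>s x. s \<in> {a..b} \<Longrightarrow> x \<in> {0..1} \<Longrightarrow> 0 < R s x"
  shows "C1t a b (\<lambda>s x. inverse (R s x) ^ Suc k) (\<lambda>s x. - real (Suc k) * R' s x * inverse (R s x) ^ (k + 2))"
  unfolding C1t_def
proof (intro conjI ballI)
  have n: "R s x \<noteq> 0" if "s \<in> {a..b}" "x \<in> {0..1}" for s x using p[OF that] by simp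
  have nz: "\<forall>z\<in>{a..b} \<times> {0..1}. R (fst z) (snd z) \<noteq> 0" using n by auto
  have c: "continuous_on ({a..b} \<times> {0..1}) (\<lambda>z. inverse (R (fst z) (snd z)))"
    using C1tD(1)[OF R] nz unfolding jcont_def by (rule continuous_on_inverse)
  show "jcont a b (\<lambda>s x. inverse (R s x) ^ Suc k)"
    unfolding jcont_def by (intro continuous_on_power c)
  show "jcont a b (\<lambda>s x. - real (Suc k) * R' s x * inverse (R s x) ^ (k + 2))"
    unfolding jcont_def
    by (intro continuous_on_mult continuous_on_power c C1tD(2)[OF R, unfolded jcont_def] continuous_intros)
  fix s x :: real assume sx: "s \<in> {a..b}" "x \<in> {0..1}"
  have "((\<lambda>s. inverse (R s x)) has_real_derivative - (inverse (R s x) * R' s x * inverse (R s x))) (at s within {a..b})"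
    by (rule DERIV_inverse'[OF C1tD(3)[OF R sx] n[OF sx]])
  from DERIV_power[OF this, of "Suc k"]
  show "((\<lambda>s. inverse (R s x) ^ Suc k) has_real_derivative - real (Suc k) * R' s x * inverse (R s x) ^ (k + 2)) (at s within {a..b})"
    by (rule DERIV_cong) (simp add: algebra_simps)
qed

section \<open>Differentiable curves in L2\<close>

text \<open>Functions such as the second derivative of a curve are known only up to null sets that
  may vary with time, so they are differentiated in time as points of L2 and not at fixed x.\<close>

definition L2deriv :: "real \<Rightarrow> real \<Rightarrow> (real \<Rightarrow> real \<Rightarrow> real) \<Rightarrow> (real \<Rightarrow> real) \<Rightarrow> real \<Rightarrow> bool" where
  "L2deriv a b H h t \<longleftrightarrow> t \<in> {a..b} \<and> (\<forall>s\<in>{a..b}. L2 (H s)) \<and>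
     L2lim (\<lambda>s x. (H s x - H t x) / (s - t)) h (at t within {a..b})"

lemma eventually_at_within_interval: "\<forall>\<^sub>F s in at t within {a..b}. s \<in> {a..b} \<and> s \<noteq> (t::real)"
  by (simp add: eventually_at_filter)

lemma L2lim_cong:
  assumes "L2lim H h F" "\<forall>\<^sub>F s in F. \<forall>x\<in>{0..1}. K s x = H s x" "\<And>x. x \<in> {0..1} \<Longrightarrow> k x = h x"
  shows "L2lim K k F"
  unfolding L2lim_def
proof (intro conjI)
  have L: "L2 h" "\<forall>\<^sub>F s in F. L2 (H s)"
    and t: "((\<lambda>s. integral {0..1} (\<lambda>x. (H s x - h x)\<^sup>2)) \<longlongrightarrow> 0) F"
    using assms(1) unfolding L2lim_def by blast+
  show "L2 k" using L(1) assms(3) by (rule L2_cong_ae[OF _ aeI])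
  show "\<forall>\<^sub>F s in F. L2 (K s)" using L(2) assms(2) by eventually_elim (erule L2_cong_ae[OF _ aeI], blast)
  have "\<forall>\<^sub>F s in F. integral {0..1} (\<lambda>x. (H s x - h x)\<^sup>2) = integral {0..1} (\<lambda>x. (K s x - k x)\<^sup>2)"
    using assms(2) by eventually_elim (rule HK_integral_cong, simp add: assms(3))
  then show "((\<lambda>s. integral {0..1} (\<lambda>x. (K s x - k x)\<^sup>2)) \<longlongrightarrow> 0) F"
    by (rule Lim_transform_eventually[OF t])
qed

lemma L2deriv_imp_L2lim:
  assumes "L2deriv a b H h t"
  shows "L2lim H (H t) (at t within {a..b})"
proof -
  have H: "t \<in> {a..b}" "L2 (H t)" "L2lim (\<lambda>s x. (H s x - H t x) / (s - t)) h (at t within {a..b})"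
    using assms unfolding L2deriv_def by blast+
  have "ulim (\<lambda>s x. s - t) (\<lambda>_. t - t) (at t within {a..b})"
    using jcont_ulim[of a b "\<lambda>s x. s - t" t] H(1) by (simp add: jcont_def continuous_intros)
  from L2lim_add[OF L2lim_mult_ulim[OF H(3) this] L2lim_const[OF H(2)]]
  show ?thesis
    by (rule L2lim_cong) (auto simp: eventually_at_filter)
qed

lemma L2deriv_const: "t \<in> {a..b} \<Longrightarrow> L2 h \<Longrightarrow> L2deriv a b (\<lambda>_. h) (\<lambda>_. 0) t"
  unfolding L2deriv_def using L2lim_const[OF L2_cont, of "\<lambda>_. 0"] by simp

lemma L2deriv_linear:
  assumes "t \<in> {a..b}" "L2 h" shows "L2deriv a b (\<lambda>s x. s * h x) h t"
  unfolding L2deriv_def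
proof (intro conjI ballI assms(1) L2_cmult assms(2))
  show "L2lim (\<lambda>s x. (s * h x - t * h x) / (s - t)) h (at t within {a..b})"
    by (rule L2lim_cong[OF L2lim_const[OF assms(2)]])
      (auto simp: eventually_at_filter left_diff_distrib[symmetric])
qed

lemma L2deriv_add:
  assumes "L2deriv a b H h t" "L2deriv a b K k t"
  shows "L2deriv a b (\<lambda>s x. H s x + K s x) (\<lambda>x. h x + k x) t"
  unfolding L2deriv_def
proof (intro conjI ballI)
  show "t \<in> {a..b}" "\<And>s. s \<in> {a..b} \<Longrightarrow> L2 (\<lambda>x. H s x + K s x)"
    using assms unfolding L2deriv_def by (auto intro: L2_add)
  have "L2lim (\<lambda>s x. (H s x - H t x) / (s - t) + (K s x - K t x) / (s - t)) (\<lambda>x. h x + k x) (at t within {a..b})"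
    using assms unfolding L2deriv_def by (intro L2lim_add) blast+
  then show "L2lim (\<lambda>s x. (H s x + K s x - (H t x + K t x)) / (s - t)) (\<lambda>x. h x + k x) (at t within {a..b})"
    by (simp add: add_divide_distrib[symmetric] algebra_simps)
qed

text \<open>The quotient of the product is that of \<open>H\<close> times \<open>R t\<close> plus
  \<open>H s\<close> times that of \<open>R\<close>: in each summand an L2 limit meets a uniform
  one.\<close>

lemma L2deriv_mult_C1t:
  assumes H: "L2deriv a b H h t" and R: "C1t a b R R'"
  shows "L2deriv a b (\<lambda>s x. H s x * R s x) (\<lambda>x. h x * R t x + H t x * R' t x) t"
  unfolding L2deriv_def
proof (intro conjI ballI)
  show t: "t \<in> {a..b}" using H unfolding L2deriv_def by blast
  show "L2 (\<lambda>x. H s x * R s x)" if "s \<in> {a..b}" for s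
    using H that unfolding L2deriv_def by (intro L2_mult_cont jcont_slice(1)[OF C1tD(1)[OF R]]) blast+
  have "L2lim (\<lambda>s x. (H s x - H t x) / (s - t) * R t x + H s x * ((R s x - R t x) / (s - t)))
     (\<lambda>x. h x * R t x + H t x * R' t x) (at t within {a..b})"
    using H unfolding L2deriv_def
    by (intro L2lim_add L2lim_mult_ulim C1t_quotient[OF R t] ulim_const jcont_slice(1)[OF C1tD(1)[OF R] t]
        L2deriv_imp_L2lim[OF H]) blast
  then show "L2lim (\<lambda>s x. (H s x * R s x - H t x * R t x) / (s - t)) (\<lambda>x. h x * R t x + H t x * R' t x) (at t within {a..b})"
    by (rule L2lim_cong) (auto simp: add_divide_distrib[symmetric] algebra_simps)
qed

lemma L2deriv_diff:
  assumes "L2deriv a b H h t" "L2deriv a b K k t"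
  shows "L2deriv a b (\<lambda>s x. H s x - K s x) (\<lambda>x. h x - k x) t"
  using L2deriv_add[OF assms(1) L2deriv_mult_C1t[OF assms(2) C1t_const[of "\<lambda>_. -1"]]] by simp

text \<open>Both factors may be merely L2 curves: the difference quotient of the product converges
  in L1, which is enough under the integral. This is what differentiates the metric in its base
  point.\<close>

lemma L2deriv_integral_product:
  assumes H: "L2deriv a b H h t" and K: "L2deriv a b K k t" and x: "x \<in> {0..1}"
  shows "((\<lambda>s. integral {0..x} (\<lambda>y. H s y * K s y)) has_real_derivative
     integral {0..x} (\<lambda>y. h y * K t y + H t y * k y)) (at t within {a..b})"
proof -
  have sub: "{0..x} \<subseteq> {0..1}" using x by auto
  have H': "L2 (H s)" if "s \<in> {a..b}" for s using H that unfolding L2deriv_def by blast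
  have K': "L2 (K s)" if "s \<in> {a..b}" for s using K that unfolding L2deriv_def by blast
  have t: "t \<in> {a..b}" and l: "L2lim (\<lambda>s x. (H s x - H t x) / (s - t)) h (at t within {a..b})"
    "L2lim (\<lambda>s x. (K s x - K t x) / (s - t)) k (at t within {a..b})"
    using H K unfolding L2deriv_def by blast+
  have L: "L1 (\<lambda>y. h y * K t y)" "L1 (\<lambda>y. H t y * k y)"
    using l H'[OF t] K'[OF t] unfolding L2lim_def by (blast intro: L2_mult)+
  have 1: "((\<lambda>s. integral {0..x} (\<lambda>y. (H s y - H t y) / (s - t) * K t y)) \<longlongrightarrow> integral {0..x} (\<lambda>y. h y * K t y)) (at t within {a..b})"
    by (intro L1lim_integral L2lim_mult l L2lim_const K' t x)
  have 2: "((\<lambda>s. integral {0..x} (\<lambda>y. H s y * ((K s y - K t y) / (s - t)))) \<longlongrightarrow> integral {0..x} (\<lambda>y. H t y * k y)) (at t within {a..b})"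
    by (intro L1lim_integral L2lim_mult l L2deriv_imp_L2lim[OF H] x)
  have "\<forall>\<^sub>F s in at t within {a..b}.
      integral {0..x} (\<lambda>y. (H s y - H t y) / (s - t) * K t y) + integral {0..x} (\<lambda>y. H s y * ((K s y - K t y) / (s - t)))
    = (integral {0..x} (\<lambda>y. H s y * K s y) - integral {0..x} (\<lambda>y. H t y * K t y)) / (s - t)"
    using eventually_at_within_interval
  proof eventually_elim
    case (elim s)
    then have s: "s \<in> {a..b}" "s \<noteq> t" by blast+
    have LL: "L1 (\<lambda>y. H s y * K s y)" "L1 (\<lambda>y. H t y * K t y)" "L1 (\<lambda>y. H s y * K t y)" by (intro L2_mult H' K' s t)+
    have "integral {0..x} (\<lambda>y. (H s y - H t y) / (s - t) * K t y) = integral {0..x} (\<lambda>y. (H s y * K t y - H t y * K t y) / (s - t))"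
      by (simp add: left_diff_distrib)
    also have "\<dots> = (integral {0..x} (\<lambda>y. H s y * K t y) - integral {0..x} (\<lambda>y. H t y * K t y)) / (s - t)"
      using LL sub by (simp add: integral_diff')
    finally have a: "integral {0..x} (\<lambda>y. (H s y - H t y) / (s - t) * K t y) = \<dots>" .
    have "integral {0..x} (\<lambda>y. H s y * ((K s y - K t y) / (s - t))) = integral {0..x} (\<lambda>y. (H s y * K s y - H s y * K t y) / (s - t))"
      by (simp add: right_diff_distrib)
    also have "\<dots> = (integral {0..x} (\<lambda>y. H s y * K s y) - integral {0..x} (\<lambda>y. H s y * K t y)) / (s - t)"
      using LL sub by (simp add: integral_diff')
    finally have b: "integral {0..x} (\<lambda>y. H s y * ((K s y - K t y) / (s - t))) = \<dots>" .
    show ?case unfolding a b by (simp add: add_divide_distrib[symmetric])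
  qed
  from Lim_transform_eventually[OF tendsto_add[OF 1 2] this]
  show ?thesis unfolding has_field_derivative_iff integral_add'[OF L sub] .
qed

section \<open>The momentum equation\<close>

text \<open>The positive continuous function \<open>p\<close> has a positive minimum on the compact
  interval and \<open>z1\<close> is bounded, so small multiples of \<open>Z\<close> keep the
  derivative positive.\<close>

lemma diffeo_perturb:
  assumes d: "diffeo \<phi> p q" and Z: "h2 Z z1 z2" "Z 0 = 0" "Z 1 = 0"
  obtains \<delta> where "\<delta> > 0" "\<And>s. s \<in> {-\<delta>..\<delta>} \<Longrightarrow> diffeo (\<lambda>x. \<phi> x + s * Z x) (\<lambda>x. p x + s * z1 x) (\<lambda>x. q x + s * z2 x)"
proof -
  have "\<exists>x0\<in>{0..1}. \<forall>x\<in>{0..1}. p x0 \<le> p x"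
    by (rule continuous_attains_inf) (use h2D(5)[OF diffeoD(1)[OF d]] in auto)
  then obtain x0 where x0: "x0 \<in> {0..1}" "\<And>x. x \<in> {0..1} \<Longrightarrow> p x0 \<le> p x" by blast
  have pos: "p x0 > 0" by (rule diffeoD(4)[OF d x0(1)])
  obtain B where B: "B > 0" "\<And>x. x \<in> {0..1} \<Longrightarrow> \<bar>z1 x\<bar> \<le> B" by (rule bounded_on_unit[OF h2D(5)[OF Z(1)]]) blast
  \<comment> \<open>The factor 2 leaves half of the minimum of \<open>p\<close> as a margin.\<close>
  define \<delta> where "\<delta> = p x0 / (2 * B)"
  have \<delta>: "\<delta> > 0" "\<delta> * B < p x0" using pos B(1) by (simp_all add: \<delta>_def)
  show ?thesis
  proof (rule that[OF \<delta>(1)])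
    fix s assume s: "s \<in> {-\<delta>..\<delta>}"
    have "0 < p x + s * z1 x" if x: "x \<in> {0..1}" for x
    proof -
      have "\<bar>s * z1 x\<bar> \<le> \<delta> * B" unfolding abs_mult using s B(2)[OF x] by (intro mult_mono) auto
      then show ?thesis using x0(2)[OF x] \<delta>(2) by linarith
    qed
    then show "diffeo (\<lambda>x. \<phi> x + s * Z x) (\<lambda>x. p x + s * z1 x) (\<lambda>x. q x + s * z2 x)"
      unfolding diffeo_def using h2_add[OF diffeoD(1)[OF d] h2_cmult[OF Z(1), of s]] diffeoD(2,3)[OF d] Z(2,3) by simp
  qed
qed

text \<open>By \<open>G_eq\<close> the metric along \<open>\<phi> + s * Z\<close> is the integral of
  a product of two L2 curves affine in \<open>s\<close>, divided by \<open>(p + s * z1) ^ 5\<close>.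
  Differentiating the curves gives the terms over \<open>p ^ 5\<close>, differentiating the
  denominator the term over \<open>p ^ 6\<close>.\<close>

lemma G_deriv_eq:
  assumes d: "diffeo \<phi> p q" and Z: "h2 Z z1 z2" "Z 0 = 0" "Z 1 = 0" and X: "h2 X X1 X2" and Y: "h2 Y Y1 Y2"
  shows "G_deriv \<phi> Z X Y = integral {0..1} (\<lambda>x.
     ((X2 x * z1 x - X1 x * z2 x) * (Y2 x * p x - Y1 x * q x)
      + (X2 x * p x - X1 x * q x) * (Y2 x * z1 x - Y1 x * z2 x)) / p x ^ 5
     - 5 * (X2 x * p x - X1 x * q x) * (Y2 x * p x - Y1 x * q x) * z1 x / p x ^ 6)"
proof -
  obtain \<delta> where \<delta>: "\<delta> > 0" and ds: "\<And>s. s \<in> {-\<delta>..\<delta>} \<Longrightarrow>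
      diffeo (\<lambda>x. \<phi> x + s * Z x) (\<lambda>x. p x + s * z1 x) (\<lambda>x. q x + s * z2 x)"
    by (rule diffeo_perturb[OF d Z]) blast
  have 0: "0 \<in> {-\<delta>..\<delta>}" using \<delta> by simp
  define P where "P = (\<lambda>s x. p x + s * z1 x)"
  define Q where "Q = (\<lambda>s x. q x + s * z2 x)"
  have P: "C1t (-\<delta>) \<delta> P (\<lambda>_ x. 0 + z1 x)"
    unfolding P_def by (intro C1t_add C1t_const C1t_linear h2D(5)[OF Z(1)] h2D(5)[OF diffeoD(1)[OF d]])
  have Ppos: "0 < P s x" if "s \<in> {-\<delta>..\<delta>}" "x \<in> {0..1}" for s x
    using diffeoD(4)[OF ds[OF that(1)] that(2)] by (simp add: P_def)
  have Q: "L2deriv (-\<delta>) \<delta> Q (\<lambda>x. 0 + z2 x) 0"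
    unfolding Q_def by (intro L2deriv_add L2deriv_const L2deriv_linear 0 h2D(3)[OF Z(1)] h2D(3)[OF diffeoD(1)[OF d]])
  define E where "E = (\<lambda>W1 W2 s x. W2 x * P s x - Q s x * W1 x)"
  define E' where "E' = (\<lambda>W1 W2 x. (0 * P 0 x + W2 x * (0 + z1 x)) - ((0 + z2 x) * W1 x + Q 0 x * 0))"
  have E: "L2deriv (-\<delta>) \<delta> (E W1 W2) (E' W1 W2) 0" if W: "h2 W W1 W2" for W W1 W2
    unfolding E_def E'_def
    by (intro L2deriv_diff L2deriv_mult_C1t[OF L2deriv_const P] L2deriv_mult_C1t[OF Q C1t_const] 0 h2D(3,5)[OF W])
  have I: "C1t (-\<delta>) \<delta> (\<lambda>s x. inverse (P s x) ^ Suc 4) (\<lambda>s x. - real (Suc 4) * (0 + z1 x) * inverse (P s x) ^ (4 + 2))"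
    by (rule C1t_inverse_power[OF P Ppos])
  note D = L2deriv_integral_product[OF E[OF X] L2deriv_mult_C1t[OF E[OF Y] I], of 1]
  define J where "J = (\<lambda>s. integral {0..1} (\<lambda>y. E X1 X2 s y * (E Y1 Y2 s y * inverse (P s y) ^ Suc 4)))"
  define J' where "J' = integral {0..1} (\<lambda>x.
     ((X2 x * z1 x - X1 x * z2 x) * (Y2 x * p x - Y1 x * q x)
      + (X2 x * p x - X1 x * q x) * (Y2 x * z1 x - Y1 x * z2 x)) / p x ^ 5
     - 5 * (X2 x * p x - X1 x * q x) * (Y2 x * p x - Y1 x * q x) * z1 x / p x ^ 6)"
  have "(J has_real_derivative integral {0..1} (\<lambda>y. E' X1 X2 y * (E Y1 Y2 0 y * inverse (P 0 y) ^ Suc 4) +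
      E X1 X2 0 y * (E' Y1 Y2 y * inverse (P 0 y) ^ Suc 4 + E Y1 Y2 0 y * (- real (Suc 4) * (0 + z1 y) * inverse (P 0 y) ^ (4 + 2)))))
     (at 0 within {-\<delta>..\<delta>})" (is "(_ has_real_derivative ?I) _")
    unfolding J_def using D by simp
  also have "?I = J'" unfolding J'_def
  proof (rule HK_integral_cong)
    fix x :: real assume "x \<in> {0..1}"
    then have p: "p x \<noteq> 0" using diffeoD(4)[OF d, of x] by simp
    define r where "r = inverse (p x)"
    have r5: "u / p x ^ 5 = u * r ^ 5" "u / p x ^ 6 = u * r ^ 6" for u by (simp_all add: r_def divide_inverse power_inverse)
    show "E' X1 X2 x * (E Y1 Y2 0 x * inverse (P 0 x) ^ Suc 4) +
      E X1 X2 0 x * (E' Y1 Y2 x * inverse (P 0 x) ^ Suc 4 + E Y1 Y2 0 x * (- real (Suc 4) * (0 + z1 x) * inverse (P 0 x) ^ (4 + 2)))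
     = ((X2 x * z1 x - X1 x * z2 x) * (Y2 x * p x - Y1 x * q x)
      + (X2 x * p x - X1 x * q x) * (Y2 x * z1 x - Y1 x * z2 x)) / p x ^ 5
     - 5 * (X2 x * p x - X1 x * q x) * (Y2 x * p x - Y1 x * q x) * z1 x / p x ^ 6"
      unfolding r5 E_def E'_def P_def Q_def r_def[symmetric] by (simp add: r_def[symmetric]) algebra
  qed
  finally have "(J has_real_derivative J') (at 0 within {-\<delta>..\<delta>})" .
  \<comment> \<open>\<open>deriv\<close> asks for a two-sided derivative; 0 is interior to the
    interval of admissible parameters, so the derivative within that interval suffices.\<close>
  moreover have "at 0 within {-\<delta>..\<delta>} = at (0::real)" using \<delta> by (intro at_within_interior) (simp add: interior_atLeastAtMost_real)
  ultimately have J: "(J has_real_derivative J') (at 0)" by simp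
  have GJ: "J s = G (\<lambda>x. \<phi> x + s * Z x) X Y" if s: "s \<in> {-\<delta>..\<delta>}" for s
    unfolding G_eq[OF ds[OF s] X Y] J_def
  proof (rule HK_integral_cong)
    fix x
    show "E X1 X2 s x * (E Y1 Y2 s x * inverse (P s x) ^ Suc 4) =
         (X2 x * (p x + s * z1 x) - X1 x * (q x + s * z2 x)) * (Y2 x * (p x + s * z1 x) - Y1 x * (q x + s * z2 x)) / (p x + s * z1 x) ^ 5"
      by (simp add: E_def P_def Q_def divide_inverse power_inverse mult.assoc mult.commute[of "X1 x"] mult.commute[of "Y1 x"])
  qed
  have "((\<lambda>s. G (\<lambda>x. \<phi> x + s * Z x) X Y) has_real_derivative J') (at 0)"
    by (rule has_field_derivative_transform_within[OF J \<delta>]) (auto simp: dist_real_def intro!: GJ)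
  then show ?thesis unfolding G_deriv_def J'_def[symmetric] by (rule DERIV_imp_deriv)
qed

text \<open>The Koszul formula for \<open>C = - A\<close>, halved. The mixed term has coefficient 2
  because it arises once from differentiating \<open>G\<close> in direction \<open>V\<close> and
  once from direction \<open>Z\<close>; the coefficient 5 / 2 is half the exponent of
  \<open>p\<close> in the metric.\<close>

lemma geodesic_equation:
  assumes d: "diffeo \<phi> p q" and V: "h2 V V1 V2" "V 0 = 0" "V 1 = 0" and A: "h2 A A1 A2"
    and C: "christoffel \<phi> V V C" and AC: "\<And>x. x \<in> {0..1} \<Longrightarrow> A x + C x = 0"
    and Z: "h2 Z z1 z2" "Z 0 = 0" "Z 1 = 0" "z1 0 = 0" "z1 1 = 0"
  shows "integral {0..1} (\<lambda>x. (A2 x * p x - A1 x * q x) * (z2 x * p x - z1 x * q x) / p x ^ 5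
     + 2 * (V2 x * p x - V1 x * q x) * (z2 x * V1 x - z1 x * V2 x) / p x ^ 5
     - 5 * (V2 x * p x - V1 x * q x) * (z2 x * p x - z1 x * q x) * V1 x / p x ^ 6
     + 5 / 2 * (V2 x * p x - V1 x * q x)\<^sup>2 * z1 x / p x ^ 6) = 0"
proof -
  define e where "e = (\<lambda>x. V2 x * p x - V1 x * q x)"
  define f where "f = (\<lambda>x. z2 x * p x - z1 x * q x)"
  define a where "a = (\<lambda>x. A2 x * p x - A1 x * q x)"
  define f' where "f' = (\<lambda>x. z2 x * V1 x - z1 x * V2 x)"
  have C': "h2 C (\<lambda>x. (-1) * A1 x) (\<lambda>x. (-1) * A2 x)"
    by (rule h2_cong[OF h2_cmult[OF A, of "-1"]]) (use AC in \<open>simp add: add_eq_0_iff\<close>)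
  have "Z \<in> H2_0" by (rule H2_0I[OF Z])
  then have K: "2 * G \<phi> C Z = G_deriv \<phi> V V Z + G_deriv \<phi> V V Z - G_deriv \<phi> Z V V"
    using C unfolding christoffel_def by blast
  have cp: "continuous_on {0..1} p" and qL: "L2 q" using h2D(3,5)[OF diffeoD(1)[OF d]] by blast+
  note cs = cp h2D(5)[OF V(1)] h2D(5)[OF Z(1)] h2D(5)[OF A]
  note Ls = qL h2D(3)[OF V(1)] h2D(3)[OF Z(1)] h2D(3)[OF A]
  have L: "L2 e" "L2 f" "L2 a" "L2 f'" unfolding e_def f_def a_def f'_def
    by (intro L2_diff L2_mult_cont L2_cont_mult cs Ls)+
  note ip = diffeo_cont_inverse_power[OF d]
  have L1s: "L1 (\<lambda>x. a x * f x / p x ^ 5)" "L1 (\<lambda>x. e x * f' x / p x ^ 5)"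
    "L1 (\<lambda>x. 5 * e x * f x * V1 x / p x ^ 6)" "L1 (\<lambda>x. 5 * e x * e x * z1 x / p x ^ 6)"
    unfolding divide_inverse mult.assoc
    by (intro L2_mult L2_mult_cont L L2_cmult continuous_on_mult ip cs set_integrable_mult_right)+
  have 1: "G \<phi> C Z = - integral {0..1} (\<lambda>x. a x * f x / p x ^ 5)"
    unfolding G_eq[OF d C' Z(1)] integral_neg[symmetric]
    by (rule HK_integral_cong) (simp add: a_def f_def minus_divide_left algebra_simps)
  have 2: "G_deriv \<phi> V V Z = integral {0..1} (\<lambda>x. e x * f' x / p x ^ 5 - 5 * e x * f x * V1 x / p x ^ 6)"
    unfolding G_deriv_eq[OF d V V(1) Z(1)]
    by (rule HK_integral_cong) (simp add: e_def f_def f'_def algebra_simps)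
  have 3: "G_deriv \<phi> Z V V = - 2 * integral {0..1} (\<lambda>x. e x * f' x / p x ^ 5) - integral {0..1} (\<lambda>x. 5 * e x * e x * z1 x / p x ^ 6)"
  proof -
    have "G_deriv \<phi> Z V V = integral {0..1} (\<lambda>x. (- 2) * (e x * f' x / p x ^ 5) - 5 * e x * e x * z1 x / p x ^ 6)"
      unfolding G_deriv_eq[OF d Z(1-3) V(1) V(1)]
    proof (rule HK_integral_cong)
      fix x
      have "((V2 x * z1 x - V1 x * z2 x) * (V2 x * p x - V1 x * q x) + (V2 x * p x - V1 x * q x) * (V2 x * z1 x - V1 x * z2 x)) = (-2) * (e x * f' x)"
        by (simp add: e_def f'_def algebra_simps)
      then show "((V2 x * z1 x - V1 x * z2 x) * (V2 x * p x - V1 x * q x) + (V2 x * p x - V1 x * q x) * (V2 x * z1 x - V1 x * z2 x)) / p x ^ 5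
        - 5 * (V2 x * p x - V1 x * q x) * (V2 x * p x - V1 x * q x) * z1 x / p x ^ 6
        = (- 2) * (e x * f' x / p x ^ 5) - 5 * e x * e x * z1 x / p x ^ 6"
        by (simp only: e_def times_divide_eq_right)
    qed
    also have "\<dots> = (- 2) * integral {0..1} (\<lambda>x. e x * f' x / p x ^ 5) - integral {0..1} (\<lambda>x. 5 * e x * e x * z1 x / p x ^ 6)"
      by (simp only: integral_diff'[OF set_integrable_mult_right[OF L1s(2)] L1s(4) order_refl] integral_cmult')
    finally show ?thesis .
  qed
  have 22: "G_deriv \<phi> V V Z = integral {0..1} (\<lambda>x. e x * f' x / p x ^ 5) - integral {0..1} (\<lambda>x. 5 * e x * f x * V1 x / p x ^ 6)"
    unfolding 2 by (rule integral_diff'[OF L1s(2,3)]) simp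
  have "integral {0..1} (\<lambda>x. a x * f x / p x ^ 5 + 2 * (e x * f' x / p x ^ 5) - 5 * e x * f x * V1 x / p x ^ 6
     + 1 / 2 * (5 * e x * e x * z1 x / p x ^ 6))
     = integral {0..1} (\<lambda>x. a x * f x / p x ^ 5) + 2 * integral {0..1} (\<lambda>x. e x * f' x / p x ^ 5)
       - integral {0..1} (\<lambda>x. 5 * e x * f x * V1 x / p x ^ 6) + 1 / 2 * integral {0..1} (\<lambda>x. 5 * e x * e x * z1 x / p x ^ 6)"
    unfolding integral_cmult'[symmetric]
    by (subst integral_add', (intro set_integral_add(1) set_integral_diff(1) set_integrable_mult_right L1s)+, simp,
        subst integral_diff', (intro set_integral_add(1) set_integral_diff(1) set_integrable_mult_right L1s)+, simp,
        subst integral_add', (intro set_integral_add(1) set_integral_diff(1) set_integrable_mult_right L1s)+, simp, rule refl)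
  also have "\<dots> = 0" using K unfolding 1 22 3 by linarith
  finally have "integral {0..1} (\<lambda>x. a x * f x / p x ^ 5 + 2 * (e x * f' x / p x ^ 5) - 5 * e x * f x * V1 x / p x ^ 6
     + 1 / 2 * (5 * e x * e x * z1 x / p x ^ 6)) = 0" .
  moreover have "integral {0..1} (\<lambda>x. a x * f x / p x ^ 5 + 2 * e x * f' x / p x ^ 5 - 5 * e x * f x * V1 x / p x ^ 6 + 5 / 2 * (e x)\<^sup>2 * z1 x / p x ^ 6) =
    integral {0..1} (\<lambda>x. a x * f x / p x ^ 5 + 2 * (e x * f' x / p x ^ 5) - 5 * e x * f x * V1 x / p x ^ 6
     + 1 / 2 * (5 * e x * e x * z1 x / p x ^ 6))"
    by (rule HK_integral_cong) (simp add: power2_eq_square)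
  ultimately show ?thesis unfolding e_def a_def f_def f'_def by simp
qed

text \<open>With \<open>z1 = p * \<mu>\<close> the geodesic equation becomes \<open>\<integral> m' * \<mu>' + K' * \<mu> = 0\<close>. The admissible
  \<open>\<mu>\<close> satisfy \<open>\<integral> p * \<mu> = 0\<close> (the endpoint condition on \<open>Z\<close>), which after an integration by parts
  reads \<open>\<integral> \<phi> * \<mu>' = 0\<close>; so \<open>m' - K\<close> is a combination of \<open>1\<close> and \<open>\<phi>\<close>.\<close>

lemma momentum_equation:
  assumes d: "diffeo \<phi> p q" and V: "h2 V V1 V2" "V 0 = 0" "V 1 = 0" and A: "h2 A A1 A2"
    and C: "christoffel \<phi> V V C" and AC: "\<And>x. x \<in> {0..1} \<Longrightarrow> A x + C x = 0"
  defines "e \<equiv> \<lambda>x. V2 x * p x - V1 x * q x"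
  defines "m' \<equiv> \<lambda>x. (A2 x * p x - A1 x * q x) / p x ^ 3 - 3 * e x * V1 x / p x ^ 4"
  defines "K \<equiv> \<lambda>x. integral {0..x} (\<lambda>x. (e x)\<^sup>2 / (2 * p x ^ 5))"
  defines "c \<equiv> 12 * integral {0..1} (\<lambda>x. (m' x - K x) * (p x * \<phi> x)) - 6 * integral {0..1} (\<lambda>x. (m' x - K x) * p x)"
  defines "b \<equiv> integral {0..1} (\<lambda>x. (m' x - K x) * p x) - c / 2"
  shows "ae (\<lambda>x. m' x = K x + c * \<phi> x + b)"
proof -
  have h: "h2 \<phi> p q" and \<phi>01: "\<phi> 0 = 0" "\<phi> 1 = 1" and pos: "\<And>x. x \<in> {0..1} \<Longrightarrow> 0 < p x"
    using diffeoD[OF d] by blast+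
  have cp: "continuous_on {0..1} p" and c\<phi>: "continuous_on {0..1} \<phi>" and qL: "L2 q" using h2D(3,4,5)[OF h] by blast+
  note cs = cp c\<phi> h2D(5)[OF V(1)] h2D(5)[OF A]
  note Ls = qL h2D(3)[OF V(1)] h2D(3)[OF A]
  note ip = diffeo_cont_inverse_power[OF d]
  have eL: "L2 e" unfolding e_def by (intro L2_diff L2_mult_cont L2_cont_mult cs Ls)
  have mL: "L2 m'" unfolding m'_def divide_inverse mult.assoc
    by (intro L2_diff L2_mult_cont L2_cont_mult L2_cmult cs Ls ip eL continuous_on_mult)
  have kL: "L1 (\<lambda>x. (e x)\<^sup>2 / (2 * p x ^ 5))"
  proof -
    have eq: "(\<lambda>x. (e x)\<^sup>2 / (2 * p x ^ 5)) = (\<lambda>x. (1/2) * (e x * (e x * inverse (p x ^ 5))))"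
      by (rule ext) (simp only: power2_eq_square divide_inverse inverse_mult_distrib mult_1 mult.assoc mult.left_commute)
    show ?thesis unfolding eq by (intro set_integrable_mult_right L2_mult L2_mult_cont eL ip)
  qed
  have pK: "prim K (\<lambda>x. (e x)\<^sup>2 / (2 * p x ^ 5))" using prim_integral[OF kL, of 0] by (simp add: K_def)
  have cK: "continuous_on {0..1} K" by (rule prim_cont[OF pK])
  define g where "g = (\<lambda>x. m' x - K x)"
  have gL: "L2 g" unfolding g_def by (intro L2_diff mL L2_cont cK)
  have orth: "integral {0..1} (\<lambda>x. g x * \<eta> x) = 0"
    if \<eta>: "L2 \<eta>" "integral {0..1} \<eta> = 0" "integral {0..1} (\<lambda>x. \<phi> x * \<eta> x) = 0" for \<eta>
  proof -
    \<comment> \<open>A direction is built backwards from its test function: \<open>\<eta>\<close>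
      is integrated to \<open>\<mu>\<close>, and \<open>p * \<mu>\<close> to \<open>Z\<close>. The
      two conditions on \<open>\<eta>\<close> give the boundary values of \<open>\<mu>\<close> and
      \<open>Z\<close> at 1.\<close>
    define \<mu> where "\<mu> = (\<lambda>x. integral {0..x} \<eta>)"
    have \<mu>: "prim \<mu> \<eta>" using prim_integral[OF L2_imp_L1[OF \<eta>(1)], of 0] by (simp add: \<mu>_def)
    have \<mu>01: "\<mu> 0 = 0" "\<mu> 1 = 0" using \<eta>(2) by (simp_all add: \<mu>_def)
    have c\<mu>: "continuous_on {0..1} \<mu>" by (rule prim_cont[OF \<mu>])
    define Z where "Z = (\<lambda>x. integral {0..x} (\<lambda>x. p x * \<mu> x))"
    have Z': "prim Z (\<lambda>x. p x * \<mu> x)"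
      using prim_integral[of "\<lambda>x. p x * \<mu> x" 0] L1_cont[OF continuous_on_mult[OF cp c\<mu>]] by (simp add: Z_def)
    have Z: "h2 Z (\<lambda>x. p x * \<mu> x) (\<lambda>x. q x * \<mu> x + p x * \<eta> x)"
      unfolding h2_def using Z' prim_mult[OF h2D(2)[OF h] \<mu>]
      by (intro conjI L2_add L2_mult_cont L2_cont_mult qL c\<mu> cp \<eta>(1))
    have "integral {0..1} (\<lambda>x. p x * \<mu> x + \<phi> x * \<eta> x) = 0"
      using prim_eq[OF prim_mult[OF h2D(1)[OF h] \<mu>], of 1] \<mu>01 by simp
    then have "Z 1 = 0"
      unfolding Z_def integral_add'[OF L1_cont[OF continuous_on_mult[OF cp c\<mu>]] L2_imp_L1[OF L2_cont_mult[OF c\<phi> \<eta>(1)]] order_refl]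
      using \<eta>(3) by simp
    then have Z0: "Z 0 = 0" "Z 1 = 0" "p 0 * \<mu> 0 = 0" "p 1 * \<mu> 1 = 0" using \<mu>01 by (simp_all add: Z_def)
    note E = geodesic_equation[OF d V A C AC Z Z0]
    have "integral {0..1} (\<lambda>x. m' x * \<eta> x + (e x)\<^sup>2 / (2 * p x ^ 5) * \<mu> x) = 0"
    proof (rule trans[OF HK_integral_cong E])
      fix x :: real assume "x \<in> {0..1}"
      define r where "r = inverse (p x)"
      have pr: "p x * r = 1" using pos[OF \<open>x \<in> {0..1}\<close>] by (simp add: r_def)
      have dv: "u / p x ^ k = u * r ^ k" "u / (2 * p x ^ k) = u * r ^ k / 2" for u and k :: nat
        unfolding r_def divide_inverse power_inverse inverse_mult_distrib by (simp_all only: mult_ac)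
      show "m' x * \<eta> x + (e x)\<^sup>2 / (2 * p x ^ 5) * \<mu> x =
        (A2 x * p x - A1 x * q x) * ((q x * \<mu> x + p x * \<eta> x) * p x - p x * \<mu> x * q x) / p x ^ 5 +
        2 * (V2 x * p x - V1 x * q x) * ((q x * \<mu> x + p x * \<eta> x) * V1 x - p x * \<mu> x * V2 x) / p x ^ 5 -
        5 * (V2 x * p x - V1 x * q x) * ((q x * \<mu> x + p x * \<eta> x) * p x - p x * \<mu> x * q x) * V1 x / p x ^ 6 +
        5 / 2 * (V2 x * p x - V1 x * q x)\<^sup>2 * (p x * \<mu> x) / p x ^ 6"
      proof -
        have f: "(q x * \<mu> x + p x * \<eta> x) * p x - p x * \<mu> x * q x = p x ^ 2 * \<eta> x"
          by (simp add: algebra_simps power2_eq_square)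
        have f': "(q x * \<mu> x + p x * \<eta> x) * V1 x - p x * \<mu> x * V2 x = p x * \<eta> x * V1 x - \<mu> x * e x"
          by (simp add: e_def algebra_simps)
        have e5: "5 / 2 * (e x)\<^sup>2 * (p x * \<mu> x) / p x ^ 6 = 5 / 2 * ((e x)\<^sup>2 * \<mu> x * (p x * r ^ 6))"
          unfolding dv by (simp add: mult_ac)
        have r: "p x ^ 2 * r ^ 5 = r ^ 3" "p x * r ^ 5 = r ^ 4" "p x ^ 2 * r ^ 6 = r ^ 4" "p x * r ^ 6 = r ^ 5"
          using pr by algebra+
        have "(A2 x * p x - A1 x * q x) * (p x ^ 2 * \<eta> x) * r ^ 5 + 2 * e x * (p x * \<eta> x * V1 x - \<mu> x * e x) * r ^ 5
            - 5 * e x * (p x ^ 2 * \<eta> x) * V1 x * r ^ 6 + 5 / 2 * ((e x)\<^sup>2 * \<mu> x * (p x * r ^ 6))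
          = (A2 x * p x - A1 x * q x) * \<eta> x * (p x ^ 2 * r ^ 5) + 2 * e x * \<eta> x * V1 x * (p x * r ^ 5) - 2 * (e x)\<^sup>2 * \<mu> x * r ^ 5
            - 5 * e x * \<eta> x * V1 x * (p x ^ 2 * r ^ 6) + 5 / 2 * ((e x)\<^sup>2 * \<mu> x * (p x * r ^ 6))"
          by (simp add: algebra_simps power2_eq_square)
        \<comment> \<open>The coefficients combine to 2 - 5 = -3, the one in \<open>m'\<close>, and
          to -2 + 5/2 = 1/2, the one in \<open>K\<close>.\<close>
        also have "\<dots> = m' x * \<eta> x + (e x)\<^sup>2 * r ^ 5 / 2 * \<mu> x"
          unfolding r m'_def dv by (simp add: algebra_simps)
        finally have fin: "(A2 x * p x - A1 x * q x) * (p x ^ 2 * \<eta> x) * r ^ 5 + 2 * e x * (p x * \<eta> x * V1 x - \<mu> x * e x) * r ^ 5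
            - 5 * e x * (p x ^ 2 * \<eta> x) * V1 x * r ^ 6 + 5 / 2 * ((e x)\<^sup>2 * \<mu> x * (p x * r ^ 6)) = m' x * \<eta> x + (e x)\<^sup>2 * r ^ 5 / 2 * \<mu> x" .
        have ed: "V2 x * p x - V1 x * q x = e x" by (simp add: e_def)
        show ?thesis unfolding ed f f' e5 unfolding dv by (rule fin[symmetric])
      qed
    qed
    also have "integral {0..1} (\<lambda>x. m' x * \<eta> x + (e x)\<^sup>2 / (2 * p x ^ 5) * \<mu> x)
      = integral {0..1} (\<lambda>x. m' x * \<eta> x) + integral {0..1} (\<lambda>x. (e x)\<^sup>2 / (2 * p x ^ 5) * \<mu> x)"
      by (intro integral_add' L2_mult mL \<eta>(1) L1_mult_cont kL c\<mu>) simp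
    also have "integral {0..1} (\<lambda>x. (e x)\<^sup>2 / (2 * p x ^ 5) * \<mu> x) = - integral {0..1} (\<lambda>x. K x * \<eta> x)"
    proof -
      have "integral {0..1} (\<lambda>x. (e x)\<^sup>2 / (2 * p x ^ 5) * \<mu> x + K x * \<eta> x) = 0"
        using prim_eq[OF prim_mult[OF pK \<mu>], of 1] \<mu>01 by simp
      then show ?thesis
        unfolding integral_add'[OF L1_mult_cont[OF kL c\<mu>] L2_imp_L1[OF L2_cont_mult[OF cK \<eta>(1)]] order_refl] by simp
    qed
    finally have "integral {0..1} (\<lambda>x. m' x * \<eta> x) - integral {0..1} (\<lambda>x. K x * \<eta> x) = 0" by simp
    also have "integral {0..1} (\<lambda>x. m' x * \<eta> x) - integral {0..1} (\<lambda>x. K x * \<eta> x) = integral {0..1} (\<lambda>x. m' x * \<eta> x - K x * \<eta> x)"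
      by (intro integral_diff'[symmetric] L2_mult mL \<eta>(1) L2_cont cK) simp
    finally show ?thesis by (simp add: g_def left_diff_distrib)
  qed
  \<comment> \<open>With weight \<open>p\<close> the functions 1 and \<open>\<phi>\<close> have the
    Gram matrix with rows (1, 1/2) and (1/2, 1/3), as 1 and y have on the unit interval. Its inverse
    has rows (4, -6) and (-6, 12), whence the constants 12 and 6 in \<open>c\<close>.\<close>
  have I1: "integral {0..1} p = 1" using prim_eq[OF h2D(1)[OF h], of 1] \<phi>01 by simp
  have I2: "integral {0..1} (\<lambda>x. p x * \<phi> x) = 1/2"
  proof -
    have "integral {0..1} (\<lambda>x. 2 * (p x * \<phi> x)) = 1"
      using prim_eq[OF prim_square[OF h2D(1)[OF h]], of 1] \<phi>01 by (simp add: mult_ac)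
    then show ?thesis by simp
  qed
  have I3: "integral {0..1} (\<lambda>x. p x * (\<phi> x)\<^sup>2) = 1/3"
  proof -
    have "integral {0..1} (\<lambda>x. 2 * \<phi> x * p x * \<phi> x + (\<phi> x)\<^sup>2 * p x) = 1"
      using prim_eq[OF prim_mult[OF prim_square[OF h2D(1)[OF h]] h2D(1)[OF h]], of 1] \<phi>01 by simp
    also have "integral {0..1} (\<lambda>x. 2 * \<phi> x * p x * \<phi> x + (\<phi> x)\<^sup>2 * p x) = integral {0..1} (\<lambda>x. 3 * (p x * (\<phi> x)\<^sup>2))"
      by (rule HK_integral_cong) (simp add: power2_eq_square)
    finally show ?thesis by simp
  qed
  \<comment> \<open>By the three moments of \<open>\<phi>\<close>, the constants \<open>c\<close> and \<open>b\<close> are those for which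
    \<open>p * (g - c * \<phi> - b)\<close> is orthogonal to \<open>1\<close> and \<open>\<phi>\<close>.\<close>
  define w where "w = (\<lambda>x. g x - c * \<phi> x - b)"
  have wL: "L2 w" unfolding w_def by (intro L2_diff gL L2_cont continuous_intros c\<phi>)
  define \<eta> where "\<eta> = (\<lambda>x. w x * p x)"
  have \<eta>L: "L2 \<eta>" unfolding \<eta>_def by (intro L2_mult_cont wL cp)
  have ex: "integral {0..1} (\<lambda>x. u x * \<eta> x) = integral {0..1} (\<lambda>x. g x * (p x * u x)) - c * integral {0..1} (\<lambda>x. p x * \<phi> x * u x) - b * integral {0..1} (\<lambda>x. p x * u x)"
    if u: "continuous_on {0..1} u" for u
  proof -
    have "integral {0..1} (\<lambda>x. u x * \<eta> x) = integral {0..1} (\<lambda>x. g x * (p x * u x) - c * (p x * \<phi> x * u x) - b * (p x * u x))"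
      by (rule HK_integral_cong) (simp add: \<eta>_def w_def algebra_simps)
    also have "\<dots> = integral {0..1} (\<lambda>x. g x * (p x * u x)) - integral {0..1} (\<lambda>x. c * (p x * \<phi> x * u x)) - integral {0..1} (\<lambda>x. b * (p x * u x))"
    proof -
      have L: "L1 (\<lambda>x. g x * (p x * u x))" "L1 (\<lambda>x. c * (p x * \<phi> x * u x))" "L1 (\<lambda>x. b * (p x * u x))"
        by (rule L2_imp_L1[OF L2_mult_cont[OF gL continuous_on_mult[OF cp u]]],
            intro L1_cont continuous_intros cp c\<phi> u, intro L1_cont continuous_intros cp u)
      show ?thesis
        by (simp only: integral_diff'[OF set_integral_diff(1)[OF L(1,2)] L(3) order_refl] integral_diff'[OF L(1,2) order_refl])
    qed
    finally show ?thesis by simp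
  qed
  have c1: "c = 12 * integral {0..1} (\<lambda>x. g x * (p x * \<phi> x)) - 6 * integral {0..1} (\<lambda>x. g x * p x)"
    and b1: "b = integral {0..1} (\<lambda>x. g x * p x) - c / 2" unfolding c_def b_def g_def by simp_all
  have e1: "integral {0..1} \<eta> = 0"
    using ex[of "\<lambda>_. 1"] I1 I2 b1 by simp
  have e2: "integral {0..1} (\<lambda>x. \<phi> x * \<eta> x) = 0"
  proof -
    have I3': "integral {0..1} (\<lambda>x. p x * \<phi> x * \<phi> x) = 1/3" using I3 by (simp add: power2_eq_square mult.assoc)
    show ?thesis using b1 c1 unfolding ex[OF c\<phi>] I2 I3' by linarith
  qed
  \<comment> \<open>\<open>\<eta>\<close>, which is \<open>p\<close> times \<open>w\<close>, is
    itself an admissible test function. Testing with it makes the weighted square integral of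
    \<open>w\<close> vanish; \<open>sqrt (p x)\<close> below turns the weight into part of a
    square.\<close>
  have e3: "integral {0..1} (\<lambda>x. g x * \<eta> x) = 0" by (rule orth[OF \<eta>L e1 e2])
  have "integral {0..1} (\<lambda>x. (w x * sqrt (p x))\<^sup>2) = integral {0..1} (\<lambda>x. g x * \<eta> x - c * (\<phi> x * \<eta> x) - b * \<eta> x)"
  proof (rule HK_integral_cong)
    fix x :: real assume "x \<in> {0..1}"
    then have "(sqrt (p x))\<^sup>2 = p x" using pos[of x] by simp
    then show "(w x * sqrt (p x))\<^sup>2 = g x * \<eta> x - c * (\<phi> x * \<eta> x) - b * \<eta> x"
      unfolding power_mult_distrib by (simp add: \<eta>_def w_def power2_eq_square algebra_simps)
  qed
  also have "\<dots> = integral {0..1} (\<lambda>x. g x * \<eta> x) - integral {0..1} (\<lambda>x. c * (\<phi> x * \<eta> x)) - integral {0..1} (\<lambda>x. b * \<eta> x)"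
  proof -
    have L: "L1 (\<lambda>x. g x * \<eta> x)" "L1 (\<lambda>x. c * (\<phi> x * \<eta> x))" "L1 (\<lambda>x. b * \<eta> x)"
      by (rule L2_mult[OF gL \<eta>L], rule L2_imp_L1[OF L2_cmult[OF L2_cont_mult[OF c\<phi> \<eta>L]]], rule L2_imp_L1[OF L2_cmult[OF \<eta>L]])
    show ?thesis
      by (simp only: integral_diff'[OF set_integral_diff(1)[OF L(1,2)] L(3) order_refl] integral_diff'[OF L(1,2) order_refl])
  qed
  also have "\<dots> = 0" using e1 e2 e3 by simp
  finally have "ae (\<lambda>x. w x * sqrt (p x) = 0)"
    by (intro L2_zero_ae L2_mult_cont wL continuous_intros cp)
  then have "ae (\<lambda>x. w x * sqrt (p x) = 0 \<and> x \<in> {0..1})" by (auto intro: aeI eventually_conj)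
  then show ?thesis
  proof eventually_elim
    case (elim x)
    then have "w x = 0" using pos[of x] by simp
    then show ?case by (simp add: w_def g_def)
  qed
qed

section \<open>Time evolution of the momentum\<close>

lemma L2deriv_cong:
  assumes "L2deriv a b H h t" "\<And>s x. s \<in> {a..b} \<Longrightarrow> x \<in> {0..1} \<Longrightarrow> K s x = H s x" "\<And>x. x \<in> {0..1} \<Longrightarrow> k x = h x"
  shows "L2deriv a b K k t"
proof -
  have H: "t \<in> {a..b}" "\<And>s. s \<in> {a..b} \<Longrightarrow> L2 (H s)" "L2lim (\<lambda>s x. (H s x - H t x) / (s - t)) h (at t within {a..b})"
    using assms(1) unfolding L2deriv_def by blast+
  have "L2 (K s)" if "s \<in> {a..b}" for s
    by (rule L2_cong_ae[OF H(2)[OF that]], rule aeI, rule assms(2)[OF that])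
  moreover have "L2lim (\<lambda>s x. (K s x - K t x) / (s - t)) k (at t within {a..b})"
  proof (rule L2lim_cong[OF H(3) _ assms(3)])
    show "\<forall>\<^sub>F s in at t within {a..b}. \<forall>x\<in>{0..1}. (K s x - K t x) / (s - t) = (H s x - H t x) / (s - t)"
      using eventually_at_within_interval by eventually_elim (simp add: assms(2) H(1)[simplified])
  qed
  ultimately show ?thesis using H(1) unfolding L2deriv_def by blast
qed

lemma C1t_imp_L2deriv:
  assumes "C1t a b R R'" "t \<in> {a..b}" shows "L2deriv a b R (R' t) t"
proof (rule L2deriv_cong)
  show "L2deriv a b (\<lambda>s x. 1 * R s x) (\<lambda>x. 0 * R t x + 1 * R' t x) t"
    using assms(2) by (intro L2deriv_mult_C1t[OF L2deriv_const assms(1)] L2_cont) auto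
qed simp_all

lemma ulim_imp_L2lim: "ulim R r F \<Longrightarrow> L2lim R r F"
  using L2lim_mult_ulim[OF L2lim_const[of "\<lambda>_. 1"]] by (simp add: L2_cont)

lemma L2deriv_integral:
  assumes "L2deriv a b H h t" "x \<in> {0..1}"
  shows "((\<lambda>s. integral {0..x} (H s)) has_real_derivative integral {0..x} h) (at t within {a..b})"
proof -
  have "t \<in> {a..b}" using assms(1) unfolding L2deriv_def by blast
  from L2deriv_integral_product[OF assms(1) L2deriv_const[OF this] assms(2), of "\<lambda>_. 1"]
  show ?thesis by (simp add: L2_cont)
qed

lemma prim_uniform_limit:
  assumes l: "L1lim f f0 F" and p: "\<forall>\<^sub>F s in F. prim (P s) (f s) \<and> P s 0 = P0 0" and p0: "prim P0 f0"
  shows "uniform_limit {0..1} P P0 F"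
proof (rule uniform_limitI)
  fix e :: real assume "e > 0"
  show "\<forall>\<^sub>F s in F. \<forall>x\<in>{0..1}. dist (P s x) (P0 x) < e"
    using uniform_limitD[OF L1lim_integral_uniform[OF l] \<open>e > 0\<close>] p
  proof eventually_elim
    case (elim s)
    then have pr: "prim (P s) (f s)" and z: "P s 0 = P0 0" by blast+
    show ?case
    proof
      fix x :: real assume x: "x \<in> {0..1}"
      show "dist (P s x) (P0 x) < e"
        using bspec[OF elim(1) x] prim_eq[OF pr x] prim_eq[OF p0 x] z by (simp add: dist_real_def)
    qed
  qed
qed

text \<open>For each time, continuity in x is that of a parameter integral; a bound \<open>B\<close>
  on the compact rectangle makes the integral Lipschitz in time uniformly in x, and the two combine
  to joint continuity.\<close>

lemma jcont_integral_time:
  assumes W: "jcont 0 b W"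
  shows "C1t 0 b (\<lambda>t x. integral {0..t} (\<lambda>s. W s x)) W"
  unfolding C1t_def
proof (intro conjI ballI W)
  have W': "continuous_on ({0..1} \<times> {0..b}) (\<lambda>(x, s). W s x)"
    using continuous_on_compose2[OF W[unfolded jcont_def], of "{0..1} \<times> {0..b}" "\<lambda>z. (snd z, fst z)"]
    by (simp add: case_prod_unfold continuous_intros image_subset_iff)
  have c: "continuous_on {0..b} (\<lambda>s. W s x)" if "x \<in> {0..1}" for x by (rule jcont_slice(2)[OF W that])
  show "((\<lambda>t. integral {0..t} (\<lambda>s. W s x)) has_real_derivative W s x) (at s within {0..b})"
    if "s \<in> {0..b}" "x \<in> {0..1}" for s x
    using integral_has_real_derivative[OF c[OF that(2)] that(1)] .
  have "compact ((\<lambda>z. W (fst z) (snd z)) ` ({0..b} \<times> {0..1}))"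
    using W unfolding jcont_def by (intro compact_continuous_image compact_Times) auto
  from compact_imp_bounded[OF this] obtain B where
    BB: "0 < B \<and> (\<forall>y\<in>(\<lambda>z. W (fst z) (snd z)) ` ({0..b} \<times> {0..1}). norm y \<le> B)"
    unfolding bounded_pos ..
  then have B0: "B > 0" by (rule conjunct1)
  have B: "\<bar>W s x\<bar> \<le> B" if "s \<in> {0..b}" "x \<in> {0..1}" for s x
  proof -
    have "W s x \<in> (\<lambda>z. W (fst z) (snd z)) ` ({0..b} \<times> {0..1})"
      by (rule image_eqI[of _ _ "(s, x)"]) (use that in simp_all)
    from bspec[OF conjunct2[OF BB] this] show ?thesis by simp
  qed
  show "jcont 0 b (\<lambda>t x. integral {0..t} (\<lambda>s. W s x))"
  proof (rule jcontI_uniform)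
    fix t assume t: "t \<in> {0..b}"
    have "continuous_on ({0..1} \<times> cbox 0 t) (\<lambda>(x, s). W s x)"
      by (rule continuous_on_subset[OF W']) (use t in auto)
    from integral_continuous_on_param[OF this]
    show "continuous_on {0..1} (\<lambda>x. integral {0..t} (\<lambda>s. W s x))" by simp
    have le: "\<bar>integral {0..v} (\<lambda>s. W s x) - integral {0..u} (\<lambda>s. W s x)\<bar> \<le> B * (v - u)"
      if uv: "0 \<le> u" "u \<le> v" "v \<le> b" and x: "x \<in> {0..1}" for u v x
    proof -
      have i: "(\<lambda>s. W s x) integrable_on {0..v}"
        by (rule integrable_continuous_real, rule continuous_on_subset[OF c[OF x]]) (use uv in auto)
      have "integral {0..v} (\<lambda>s. W s x) - integral {0..u} (\<lambda>s. W s x) = integral {u..v} (\<lambda>s. W s x)"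
        using Henstock_Kurzweil_Integration.integral_combine[OF uv(1,2) i] by linarith
      moreover have "norm (integral {u..v} (\<lambda>s. W s x)) \<le> B * (v - u)"
        by (rule integral_bound[OF uv(2)]) (use B uv x in \<open>auto intro!: continuous_on_subset[OF c[OF x]]\<close>)
      ultimately show ?thesis by simp
    qed
    show "uniform_limit {0..1} (\<lambda>t x. integral {0..t} (\<lambda>s. W s x)) (\<lambda>x. integral {0..t} (\<lambda>s. W s x)) (at t within {0..b})"
    proof (rule uniform_limitI)
      fix e :: real assume "e > 0"
      then have "e / B > 0" using B0 by simp
      then have "\<forall>\<^sub>F s in at t within {0..b}. dist s t < e / B" by (metis eventually_at)
      then show "\<forall>\<^sub>F s in at t within {0..b}. \<forall>x\<in>{0..1}. dist (integral {0..s} (\<lambda>s. W s x)) (integral {0..t} (\<lambda>s. W s x)) < e"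
        using eventually_at_within_interval
      proof eventually_elim
        case (elim s)
        have lt: "B * \<bar>s - t\<bar> < e" using elim(1) B0 by (simp add: dist_real_def field_simps)
        show ?case
        proof
          fix x :: real assume x: "x \<in> {0..1}"
          have "\<bar>integral {0..s} (\<lambda>s. W s x) - integral {0..t} (\<lambda>s. W s x)\<bar> \<le> B * \<bar>s - t\<bar>"
          proof (cases "s \<le> t")
            case True
            then show ?thesis using le[of s t x] elim(2) t x by (simp add: abs_minus_commute)
          next
            case False
            then show ?thesis using le[of t s x] elim(2) t x by simp
          qed
          then show "dist (integral {0..s} (\<lambda>s. W s x)) (integral {0..t} (\<lambda>s. W s x)) < e"
            using lt by (simp add: dist_real_def)
        qed
      qed
    qed
  qed
qed

lemma equal_derivatives_imp_equal:
  assumes "\<And>s. s \<in> {0..1} \<Longrightarrow> (f has_real_derivative d s) (at s within {0..1})"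
    and "\<And>s. s \<in> {0..1} \<Longrightarrow> (g has_real_derivative d s) (at s within {0..1})" "t \<in> {0..1::real}"
  shows "f t - f 0 = g t - g 0"
proof -
  have "((\<lambda>s. f s - g s) has_real_derivative 0) (at s within {0..1})" if "s \<in> {0..1}" for s
    using DERIV_diff[OF assms(1)[OF that] assms(2)[OF that]] by simp
  then obtain k where k: "\<And>s. s \<in> {0..1} \<Longrightarrow> f s - g s = k"
    using has_field_derivative_zero_constant[of "{0..1}" "\<lambda>s. f s - g s"] by (metis convex_real_interval(5))
  show ?thesis using k[OF assms(3)] k[of 0] by simp
qed

section \<open>From the H2 norm to L2 limits of second derivatives\<close>

text \<open>Only the top-order summand of the norm is retained. The lower orders are recovered from
  it by integration, because their values at 0 are fixed along the curves considered.\<close>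

lemma sobolev_norm_bound:
  assumes "h2 f f1 f2" shows "integral {0..1} (\<lambda>x. (f2 x)\<^sup>2) \<le> (sobolev_norm 2 f)\<^sup>2"
proof -
  define S where "S = (\<Sum>k\<le>2. LINT x:{0..1}|lebesgue. ((wderiv ^^ k) f x)\<^sup>2)"
  have nn: "0 \<le> (LINT x:{0..1}|lebesgue. (u x)\<^sup>2)" for u :: "real \<Rightarrow> real"
    unfolding set_lebesgue_integral_def by (intro Bochner_Integration.integral_nonneg) simp
  have a: "ae (\<lambda>x. (wderiv (wderiv f) x)\<^sup>2 = (f2 x)\<^sup>2)" using h2_wderiv[OF assms] by eventually_elim simp
  have "(LINT x:{0..1}|lebesgue. (wderiv (wderiv f) x)\<^sup>2) = integral {0..1} (\<lambda>x. (wderiv (wderiv f) x)\<^sup>2)"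
    by (rule LINT_eq[OF L1_cong_ae[OF L2_square[OF h2D(3)[OF assms]] a]])
  also have "\<dots> = integral {0..1} (\<lambda>x. (f2 x)\<^sup>2)" by (rule integral_cong_ae[OF a]) simp
  finally have 2: "(LINT x:{0..1}|lebesgue. ((wderiv ^^ 2) f x)\<^sup>2) = integral {0..1} (\<lambda>x. (f2 x)\<^sup>2)"
    by (simp add: numeral_2_eq_2)
  have "(LINT x:{0..1}|lebesgue. ((wderiv ^^ 2) f x)\<^sup>2) \<le> S"
    unfolding S_def by (rule member_le_sum) (auto intro: nn)
  moreover have "0 \<le> S" unfolding S_def by (intro sum_nonneg nn)
  ultimately show ?thesis unfolding 2 sobolev_norm_def S_def[symmetric] by simp
qed

lemma L2_second_derivative_limit:
  assumes t: "((\<lambda>s. sobolev_norm 2 (w s)) \<longlongrightarrow> 0) F" and h: "\<forall>\<^sub>F s in F. h2 (w s) (w1 s) (w2 s)"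
  shows "((\<lambda>s. integral {0..1} (\<lambda>x. (w2 s x)\<^sup>2)) \<longlongrightarrow> 0) F"
proof (rule tendsto_sandwich[OF _ _ tendsto_const])
  show "((\<lambda>s. (sobolev_norm 2 (w s))\<^sup>2) \<longlongrightarrow> 0) F" using tendsto_power[OF t, of 2] by simp
  show "\<forall>\<^sub>F s in F. integral {0..1} (\<lambda>x. (w2 s x)\<^sup>2) \<le> (sobolev_norm 2 (w s))\<^sup>2"
    using h by eventually_elim (rule sobolev_norm_bound)
qed (auto intro: always_eventually L2_integral_nonneg)

lemma curve_deriv_imp_L2deriv:
  assumes h: "\<And>s. s \<in> {0..1} \<Longrightarrow> h2 (c s) (p s) (q s)" and v: "h2 v v1 v2" and c: "curve_deriv c t v" and t: "t \<in> {0..1}"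
  shows "L2deriv 0 1 q v2 t"
  unfolding L2deriv_def L2lim_def
proof (intro conjI ballI t)
  show "L2 (q s)" if "s \<in> {0..1}" for s by (rule h2D(3)[OF h[OF that]])
  show "L2 v2" by (rule h2D(3)[OF v])
  have w: "h2 (\<lambda>x. (c s x - c t x) / (s - t) - v x) (\<lambda>x. (p s x - p t x) / (s - t) - v1 x) (\<lambda>x. (q s x - q t x) / (s - t) - v2 x)"
    if "s \<in> {0..1}" for s
    using h2_diff[OF h2_cmult[OF h2_diff[OF h[OF that] h[OF t]], of "inverse (s - t)"] v]
    by (simp add: divide_inverse mult.commute)
  have ev: "\<forall>\<^sub>F s in at t within {0..1}. s \<in> {0..1} \<and> s \<noteq> t" by (rule eventually_at_within_interval)
  have "((\<lambda>s. sobolev_norm 2 (\<lambda>x. (c s x - c t x) / (s - t) - v x)) \<longlongrightarrow> 0) (at t within {0..1})"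
    using c unfolding curve_deriv_def by blast
  then show "((\<lambda>s. integral {0..1} (\<lambda>x. ((q s x - q t x) / (s - t) - v2 x)\<^sup>2)) \<longlongrightarrow> 0) (at t within {0..1})"
    by (rule L2_second_derivative_limit) (use ev in eventually_elim, rule w, blast)
  show "\<forall>\<^sub>F s in at t within {0..1}. L2 (\<lambda>x. (q s x - q t x) / (s - t))"
    using ev
  proof eventually_elim
    case (elim s)
    then have "L2 (\<lambda>x. inverse (s - t) * (q s x - q t x))" by (intro L2_cmult L2_diff h2D(3)[OF h] t) blast
    then show ?case by (simp add: divide_inverse mult.commute)
  qed
qed

lemma curve_continuous_imp_L2lim:
  assumes h: "\<And>s. s \<in> {0..1} \<Longrightarrow> h2 (c s) (p s) (q s)" and c: "curve_continuous c" and t: "t \<in> {0..1}"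
  shows "L2lim q (q t) (at t within {0..1})"
  unfolding L2lim_def
proof (intro conjI)
  show "L2 (q t)" by (rule h2D(3)[OF h[OF t]])
  have ev: "\<forall>\<^sub>F s in at t within {0..1}. s \<in> {0..1} \<and> s \<noteq> t" by (rule eventually_at_within_interval)
  show "\<forall>\<^sub>F s in at t within {0..1}. L2 (q s)" using ev by eventually_elim (rule h2D(3)[OF h], blast)
  have "((\<lambda>s. sobolev_norm 2 (\<lambda>x. c s x - c t x)) \<longlongrightarrow> 0) (at t within {0..1})"
    using c t unfolding curve_continuous_def by blast
  then show "((\<lambda>s. integral {0..1} (\<lambda>x. (q s x - q t x)\<^sup>2)) \<longlongrightarrow> 0) (at t within {0..1})"
  proof (rule L2_second_derivative_limit)
    show "\<forall>\<^sub>F s in at t within {0..1}. h2 (\<lambda>x. c s x - c t x) (\<lambda>x. p s x - p t x) (\<lambda>x. q s x - q t x)"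
      using ev by eventually_elim (rule h2_diff[OF h h[OF t]], blast)
  qed
qed

section \<open>The geodesic in Lagrangian coordinates\<close>

text \<open>Named representatives for the space derivatives of the geodesic, its velocity and its
  acceleration. They are selected for each time separately, so for \<open>q\<close>,
  \<open>V2\<close> and \<open>A2\<close> the dependence on time is recorded in L2.\<close>

locale flow =
  fixes c V A p q V1 V2 A1 A2 :: "real \<Rightarrow> real \<Rightarrow> real"
  assumes diffeo: "t \<in> {0..1} \<Longrightarrow> diffeo (c t) (p t) (q t)"
    and p_0: "t \<in> {0..1} \<Longrightarrow> p t 0 = 1"
    and hV: "t \<in> {0..1} \<Longrightarrow> h2 (V t) (V1 t) (V2 t)"
    and V_0: "t \<in> {0..1} \<Longrightarrow> V t 0 = 0" and V_1: "t \<in> {0..1} \<Longrightarrow> V t 1 = 0"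
    and V1_0: "t \<in> {0..1} \<Longrightarrow> V1 t 0 = 0"
    and hA: "t \<in> {0..1} \<Longrightarrow> h2 (A t) (A1 t) (A2 t)" and A1_0: "t \<in> {0..1} \<Longrightarrow> A1 t 0 = 0"
    and L2deriv_q: "t \<in> {0..1} \<Longrightarrow> L2deriv 0 1 q (V2 t) t"
    and L2deriv_V2: "t \<in> {0..1} \<Longrightarrow> L2deriv 0 1 V2 (A2 t) t"
    and L2lim_A2: "t \<in> {0..1} \<Longrightarrow> L2lim A2 (A2 t) (at t within {0..1})"
    and geodesic: "t \<in> {0..1} \<Longrightarrow> \<exists>C. christoffel (c t) (V t) (V t) C \<and> (\<forall>x\<in>{0..1}. A t x + C x = 0)"
    and initial: "x \<in> {0..1} \<Longrightarrow> c 0 x = x"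
begin

lemma hc: "t \<in> {0..1} \<Longrightarrow> h2 (c t) (p t) (q t)" and p_pos: "t \<in> {0..1} \<Longrightarrow> x \<in> {0..1} \<Longrightarrow> 0 < p t x"
  using diffeoD[OF diffeo] by blast+

text \<open>The value at 0 does not change with time, so the variation of \<open>P\<close> in time
  is controlled, uniformly in x, by the L1 distance of its space derivatives.\<close>

lemma jcont_from_L2lim:
  assumes "\<And>t. t \<in> {0..1} \<Longrightarrow> prim (P t) (f t)" "\<And>t. t \<in> {0..1} \<Longrightarrow> P t 0 = z"
    and "\<And>t. t \<in> {0..1} \<Longrightarrow> L2lim f (f t) (at t within {0..1})"
  shows "jcont 0 1 P"
proof (rule jcontI_uniform)
  fix t :: real assume t: "t \<in> {0..1}"
  show "continuous_on {0..1} (P t)" by (rule prim_cont[OF assms(1)[OF t]])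
  show "uniform_limit {0..1} P (P t) (at t within {0..1})"
  proof (rule prim_uniform_limit[OF L2lim_imp_L1lim[OF assms(3)[OF t]] _ assms(1)[OF t]])
    show "\<forall>\<^sub>F s in at t within {0..1}. prim (P s) (f s) \<and> P s 0 = P t 0"
      using eventually_at_within_interval by eventually_elim (simp add: assms t[simplified])
  qed
qed

text \<open>The difference quotients of the space derivative \<open>f\<close> converge in L2, hence
  those of its primitive \<open>P\<close> converge uniformly, in particular at each x.\<close>

lemma C1t_from_L2deriv:
  assumes P: "\<And>t. t \<in> {0..1} \<Longrightarrow> prim (P t) (f t)" "\<And>t. t \<in> {0..1} \<Longrightarrow> P t 0 = z"
    and P': "\<And>t. t \<in> {0..1} \<Longrightarrow> prim (P' t) (f' t)" "\<And>t. t \<in> {0..1} \<Longrightarrow> P' t 0 = 0" and jP': "jcont 0 1 P'"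
    and d: "\<And>t. t \<in> {0..1} \<Longrightarrow> L2deriv 0 1 f (f' t) t"
  shows "C1t 0 1 P P'"
  unfolding C1t_def
proof (intro conjI ballI jP')
  show "jcont 0 1 P" by (rule jcont_from_L2lim[OF P L2deriv_imp_L2lim[OF d]])
  fix t x :: real assume t: "t \<in> {0..1}" and x: "x \<in> {0..1}"
  have l: "L2lim (\<lambda>s x. (f s x - f t x) / (s - t)) (f' t) (at t within {0..1})"
    using d[OF t] unfolding L2deriv_def by blast
  have "uniform_limit {0..1} (\<lambda>s x. (P s x - P t x) / (s - t)) (P' t) (at t within {0..1})"
  proof (rule prim_uniform_limit[OF L2lim_imp_L1lim[OF l] _ P'(1)[OF t]])
    show "\<forall>\<^sub>F s in at t within {0..1}. prim (\<lambda>x. (P s x - P t x) / (s - t)) (\<lambda>x. (f s x - f t x) / (s - t)) \<and>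
       (P s 0 - P t 0) / (s - t) = P' t 0"
      using eventually_at_within_interval
    proof eventually_elim
      case (elim s)
      then have s: "s \<in> {0..1}" by blast
      have "prim (\<lambda>x. inverse (s - t) * (P s x - P t x)) (\<lambda>x. inverse (s - t) * (f s x - f t x))"
        by (intro prim_cmult prim_diff_fun P s t)
      then show ?case using P(2)[OF s] P(2)[OF t] P'(2)[OF t] by (simp add: divide_inverse mult.commute)
    qed
  qed
  from tendsto_uniform_limitI[OF this x]
  show "((\<lambda>s. P s x) has_real_derivative P' t x) (at t within {0..1})" unfolding has_field_derivative_iff .
qed

text \<open>Joint continuity is obtained in the order \<open>A1\<close>, \<open>V1\<close>,
  \<open>p\<close>: each is the time derivative of the next, and \<open>C1t\<close> demands a
  jointly continuous derivative.\<close>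

lemma jcont_A1: "jcont 0 1 A1"
  by (rule jcont_from_L2lim[OF h2D(2)[OF hA] A1_0 L2lim_A2])

lemma C1t_V1: "C1t 0 1 V1 A1"
  by (rule C1t_from_L2deriv[OF h2D(2)[OF hV] V1_0 h2D(2)[OF hA] A1_0 jcont_A1 L2deriv_V2])

lemma C1t_p: "C1t 0 1 p V1"
  by (rule C1t_from_L2deriv[OF h2D(2)[OF hc] p_0 h2D(2)[OF hV] V1_0 C1tD(1)[OF C1t_V1] L2deriv_q])

lemma jcont_p: "jcont 0 1 p" and jcont_V1: "jcont 0 1 V1"
  using C1tD(1)[OF C1t_p] C1tD(1)[OF C1t_V1] by blast+

lemma jcont_c: "jcont 0 1 c"
proof (rule jcont_from_L2lim[OF h2D(1)[OF hc]])
  show "c t 0 = 0" if "t \<in> {0..1}" for t by (rule diffeoD(2)[OF diffeo[OF that]])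
  show "L2lim p (p t) (at t within {0..1})" if "t \<in> {0..1}" for t
    by (rule ulim_imp_L2lim[OF jcont_ulim[OF jcont_p that]])
qed

text \<open>In terms of \<open>\<lambda> = ln p\<close> one has \<open>m = \<lambda>\<^sub>t\<^sub>x * exp (- \<lambda>)\<close>, and \<open>m'\<close> is its time derivative.\<close>

definition e where "e t x = V2 t x * p t x - V1 t x * q t x"
definition m where "m t x = e t x / p t x ^ 3"
definition m' where "m' t x = (A2 t x * p t x - A1 t x * q t x) / p t x ^ 3 - 3 * e t x * V1 t x / p t x ^ 4"
definition K where "K t x = integral {0..x} (\<lambda>x. (e t x)\<^sup>2 / (2 * p t x ^ 5))"
definition C where "C t = 12 * integral {0..1} (\<lambda>x. (m' t x - K t x) * (p t x * c t x)) - 6 * integral {0..1} (\<lambda>x. (m' t x - K t x) * p t x)"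
definition B where "B t = integral {0..1} (\<lambda>x. (m' t x - K t x) * p t x) - C t / 2"
definition W where "W t x = K t x + C t * c t x + B t"
definition N where "N t x = integral {0..t} (\<lambda>s. W s x)"

lemma m'_eq: "t \<in> {0..1} \<Longrightarrow> ae (\<lambda>x. m' t x = W t x)"
proof -
  assume t: "t \<in> {0..1}"
  obtain C' where C': "christoffel (c t) (V t) (V t) C'" "\<And>x. x \<in> {0..1} \<Longrightarrow> A t x + C' x = 0"
    using geodesic[OF t] by blast
  show ?thesis
    using momentum_equation[OF diffeo[OF t] hV[OF t] V_0[OF t] V_1[OF t] hA[OF t] C']
    unfolding W_def B_def C_def K_def m'_def e_def by simp
qed

lemma jcont_inverse_p: "jcont 0 1 (\<lambda>t x. inverse (p t x) ^ k)"
proof -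
  have "\<forall>z\<in>{0..1} \<times> {0..1}. p (fst z) (snd z) \<noteq> 0" using p_pos by fastforce
  then show ?thesis
    using jcont_p unfolding jcont_def by (intro continuous_on_power continuous_on_inverse)
qed

context
  fixes t :: real
  assumes t: "t \<in> {0..1}"
begin

lemma ulim_at_t: "jcont 0 1 R \<Longrightarrow> ulim R (R t) (at t within {0..1})"
  by (rule jcont_ulim[OF _ t])

lemma L2lim_e: "L2lim e (e t) (at t within {0..1})"
proof -
  have "L2lim (\<lambda>t x. V2 t x * p t x - q t x * V1 t x) (\<lambda>x. V2 t x * p t x - q t x * V1 t x) (at t within {0..1})"
    by (intro L2lim_diff L2lim_mult_ulim L2deriv_imp_L2lim[OF L2deriv_V2[OF t]] L2deriv_imp_L2lim[OF L2deriv_q[OF t]]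
        ulim_at_t jcont_p jcont_V1)
  then show ?thesis by (rule L2lim_cong) (simp_all add: e_def)
qed

text \<open>Continuity of the acceleration, passed on to \<open>m'\<close>, makes the multipliers
  \<open>C\<close> and \<open>B\<close> continuous in time; this gives \<open>W\<close> the joint
  continuity with which it is integrated in time.\<close>

lemma L2lim_m': "L2lim m' (m' t) (at t within {0..1})"
proof -
  have "L2lim (\<lambda>t x. (A2 t x * p t x - q t x * A1 t x) * inverse (p t x) ^ 3 - 3 * (e t x * (V1 t x * inverse (p t x) ^ 4)))
    (\<lambda>x. (A2 t x * p t x - q t x * A1 t x) * inverse (p t x) ^ 3 - 3 * (e t x * (V1 t x * inverse (p t x) ^ 4))) (at t within {0..1})"
    by (intro L2lim_diff L2lim_cmult L2lim_mult_ulim[OF L2lim_e] L2lim_mult_ulim L2lim_A2 t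
        L2deriv_imp_L2lim[OF L2deriv_q[OF t]] ulim_at_t[where R = "\<lambda>t x. inverse (p t x) ^ 3"]
        ulim_at_t[where R = "\<lambda>t x. V1 t x * inverse (p t x) ^ 4"]
        ulim_at_t[where R = p] ulim_at_t[where R = A1] jcont_mult jcont_p jcont_V1 jcont_A1 jcont_inverse_p)
  then show ?thesis by (rule L2lim_cong) (simp_all only: m'_def divide_inverse power_inverse mult_ac, simp_all)
qed

lemma L1lim_k: "L1lim (\<lambda>t x. (e t x)\<^sup>2 / (2 * p t x ^ 5)) (\<lambda>x. (e t x)\<^sup>2 / (2 * p t x ^ 5)) (at t within {0..1})"
proof -
  have eq: "(e t x)\<^sup>2 / (2 * p t x ^ 5) = e t x * (e t x * (inverse (p t x) ^ 5 * (1/2)))" for t x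
    by (simp only: power2_eq_square divide_inverse inverse_mult_distrib power_inverse mult_1 mult_ac)
  show ?thesis unfolding eq
    by (intro L2lim_mult L2lim_mult_ulim L2lim_e ulim_at_t[where R = "\<lambda>t x. inverse (p t x) ^ 5 * (1/2)"] jcont_mult jcont_inverse_p jcont_const)
qed

lemma prim_K: "prim (K t) (\<lambda>x. (e t x)\<^sup>2 / (2 * p t x ^ 5))"
  using L1lim_k prim_integral[of "\<lambda>x. (e t x)\<^sup>2 / (2 * p t x ^ 5)" 0] unfolding K_def L1lim_def by simp

end

lemma jcont_K: "jcont 0 1 K"
proof (rule jcontI_uniform)
  fix t :: real assume t: "t \<in> {0..1}"
  show "continuous_on {0..1} (K t)" by (rule prim_cont[OF prim_K[OF t]])
  show "uniform_limit {0..1} K (K t) (at t within {0..1})"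
    using L1lim_integral_uniform[OF L1lim_k[OF t]] unfolding K_def .
qed

lemma continuous_integral_m'K:
  assumes R: "jcont 0 1 R" shows "continuous_on {0..1} (\<lambda>t. integral {0..1} (\<lambda>x. (m' t x - K t x) * R t x))"
  unfolding continuous_on_def
proof
  fix t :: real assume t: "t \<in> {0..1}"
  have "L2lim (\<lambda>t x. (m' t x - K t x) * R t x) (\<lambda>x. (m' t x - K t x) * R t x) (at t within {0..1})"
    by (intro L2lim_mult_ulim[OF L2lim_diff[OF L2lim_m'[OF t] ulim_imp_L2lim[OF jcont_ulim[OF jcont_K t]]] jcont_ulim[OF R t]])
  from L1lim_integral[OF L2lim_imp_L1lim[OF this], of 1]
  show "((\<lambda>t. integral {0..1} (\<lambda>x. (m' t x - K t x) * R t x)) \<longlongrightarrow> integral {0..1} (\<lambda>x. (m' t x - K t x) * R t x)) (at t within {0..1})"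
    by simp
qed

lemma continuous_C: "continuous_on {0..1} C" and continuous_B: "continuous_on {0..1} B"
proof -
  show C: "continuous_on {0..1} C" unfolding C_def
    by (intro continuous_intros continuous_integral_m'K jcont_mult jcont_p jcont_c)
  then show "continuous_on {0..1} B" unfolding B_def
    by (intro continuous_intros continuous_integral_m'K jcont_p) auto
qed

lemma jcont_W: "jcont 0 1 W"
  unfolding W_def by (intro jcont_add jcont_mult jcont_K jcont_c jcont_time continuous_C continuous_B)

lemma C1t_N: "C1t 0 1 N W"
  unfolding N_def by (rule jcont_integral_time[OF jcont_W])

text \<open>Expanding \<open>m\<close> as \<open>V2 / p ^ 2 - q * V1 / p ^ 3\<close> makes every
  summand an L2 curve times a coefficient that is continuously differentiable in time.\<close>

lemma L2deriv_m: assumes t: "t \<in> {0..1}" shows "L2deriv 0 1 m (m' t) t"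
proof -
  note r = C1t_inverse_power[OF C1t_p p_pos]
  have "L2deriv 0 1 (\<lambda>t x. V2 t x * inverse (p t x) ^ Suc 1 - q t x * (V1 t x * inverse (p t x) ^ Suc 2))
    (\<lambda>x. (A2 t x * inverse (p t x) ^ Suc 1 + V2 t x * (- real (Suc 1) * V1 t x * inverse (p t x) ^ (1 + 2)))
     - (V2 t x * (V1 t x * inverse (p t x) ^ Suc 2) + q t x *
        (A1 t x * inverse (p t x) ^ Suc 2 + V1 t x * (- real (Suc 2) * V1 t x * inverse (p t x) ^ (2 + 2))))) t"
    by (intro L2deriv_diff L2deriv_mult_C1t[OF L2deriv_V2[OF t] r] L2deriv_mult_C1t[OF L2deriv_q[OF t] C1t_mult[OF C1t_V1 r]])
  then show ?thesis
  proof (rule L2deriv_cong)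
    fix s x :: real assume "s \<in> {0..1}" "x \<in> {0..1}"
    then have "p s x \<noteq> 0" using p_pos by force
    then show "m s x = V2 s x * inverse (p s x) ^ Suc 1 - q s x * (V1 s x * inverse (p s x) ^ Suc 2)"
      unfolding m_def e_def by (simp add: field_simps power2_eq_square power3_eq_cube)
  next
    fix x :: real assume "x \<in> {0..1}"
    define r where "r = inverse (p t x)"
    have pr: "p t x * r = 1" using p_pos[OF t \<open>x \<in> {0..1}\<close>] by (simp add: r_def)
    have dv: "u / p t x ^ k = u * r ^ k" for u and k :: nat
      unfolding r_def divide_inverse power_inverse by (rule refl)
    have r2: "p t x * r ^ 3 = r\<^sup>2" "p t x * r ^ 4 = r ^ 3" using pr by algebra+
    have "m' t x = A2 t x * (p t x * r ^ 3) - A1 t x * q t x * r ^ 3 - 3 * V2 t x * V1 t x * (p t x * r ^ 4) + 3 * (V1 t x)\<^sup>2 * q t x * r ^ 4"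
      unfolding m'_def e_def dv by (simp add: algebra_simps power2_eq_square)
    also have "\<dots> = (A2 t x * r ^ Suc 1 + V2 t x * (- real (Suc 1) * V1 t x * r ^ (1 + 2)))
     - (V2 t x * (V1 t x * r ^ Suc 2) + q t x *
        (A1 t x * r ^ Suc 2 + V1 t x * (- real (Suc 2) * V1 t x * r ^ (2 + 2))))"
      unfolding r2 by (simp add: algebra_simps power2_eq_square power3_eq_cube power4_eq_xxxx)
    finally show "m' t x = (A2 t x * inverse (p t x) ^ Suc 1 + V2 t x * (- real (Suc 1) * V1 t x * inverse (p t x) ^ (1 + 2)))
     - (V2 t x * (V1 t x * inverse (p t x) ^ Suc 2) + q t x *
        (A1 t x * inverse (p t x) ^ Suc 2 + V1 t x * (- real (Suc 2) * V1 t x * inverse (p t x) ^ (2 + 2))))"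
      unfolding r_def .
  qed
qed

lemma L2_m: "t \<in> {0..1} \<Longrightarrow> L2 (m t)"
  using L2deriv_m[of t] unfolding L2deriv_def by blast

lemma N_0: "N 0 x = 0" by (simp add: N_def)

text \<open>The null set in \<open>m'_eq\<close> depends on time, so the equation cannot be
  integrated in time at fixed x. Integrating over \<open>{0..x}\<close> first removes it: the space
  integrals of \<open>m\<close> and \<open>N\<close> have equal time derivatives for every
  x.\<close>

lemma m_eq: assumes t: "t \<in> {0..1}" shows "ae (\<lambda>x. m t x = m 0 x + N t x)"
proof -
  have 0: "(0::real) \<in> {0..1}" by simp
  have N: "L1 (N t)" by (rule L1_cont[OF jcont_slice(1)[OF C1tD(1)[OF C1t_N] t]])
  note M = L2_imp_L1[OF L2_m]
  have "ae (\<lambda>x. m t x - m 0 x - N t x = 0)"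
  proof (rule integral_zero_ae)
    show "L1 (\<lambda>x. m t x - m 0 x - N t x)" by (intro set_integral_diff(1) M N t 0)
    fix x :: real assume x: "x \<in> {0..1}"
    have d: "((\<lambda>s. integral {0..x} (m s)) has_real_derivative integral {0..x} (W s)) (at s within {0..1})" if "s \<in> {0..1}" for s
    proof -
      have "integral {0..x} (m' s) = integral {0..x} (W s)" using x by (intro integral_cong_ae m'_eq that) auto
      then show ?thesis using L2deriv_integral[OF L2deriv_m[OF that] x] by simp
    qed
    have "integral {0..x} (m t) - integral {0..x} (m 0) = integral {0..x} (N t) - integral {0..x} (N 0)"
      by (rule equal_derivatives_imp_equal[OF d L2deriv_integral[OF C1t_imp_L2deriv[OF C1t_N] x] t])
    moreover have "integral {0..x} (N 0) = 0" unfolding N_0[abs_def] by simp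
    ultimately show "integral {0..x} (\<lambda>x. m t x - m 0 x - N t x) = 0"
      using x integral_diff'[OF set_integral_diff(1)[OF M[OF t] M[OF 0]] N, of 0 x] integral_diff'[OF M[OF t] M[OF 0], of 0 x]
      by simp
  qed
  then show ?thesis by eventually_elim simp
qed

definition Pt where "Pt t x = integral {0..t} (\<lambda>s. p s x)"
definition Qt where "Qt t x = integral {0..t} (\<lambda>s. p s x * N s x)"

lemma C1t_Pt: "C1t 0 1 Pt p" unfolding Pt_def by (rule jcont_integral_time[OF jcont_p])

lemma C1t_Qt: "C1t 0 1 Qt (\<lambda>t x. p t x * N t x)"
  unfolding Qt_def by (rule jcont_integral_time[OF jcont_mult[OF jcont_p C1tD(1)[OF C1t_N]]])

text \<open>The left side is the time derivative of \<open>ln (p t x)\<close>. It vanishes at x = 0,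
  and its space derivative is \<open>p * m\<close>.\<close>

lemma V1_over_p:
  assumes t: "t \<in> {0..1}" and x: "x \<in> {0..1}"
  shows "V1 t x / p t x = integral {0..x} (\<lambda>y. m 0 y * p t y + p t y * N t y)"
proof -
  have pr: "prim (\<lambda>x. V1 t x * inverse (p t x)) (\<lambda>x. V2 t x * inverse (p t x) + V1 t x * (- q t x / (p t x)\<^sup>2))"
    by (rule prim_mult[OF h2D(2)[OF hV[OF t]] prim_inverse[OF h2D(2)[OF hc[OF t]] p_pos[OF t]]])
  have "V1 t x / p t x = integral {0..x} (\<lambda>x. V2 t x * inverse (p t x) + V1 t x * (- q t x / (p t x)\<^sup>2))"
    using prim_eq[OF pr x] V1_0[OF t] by (simp add: divide_inverse)
  also have "\<dots> = integral {0..x} (\<lambda>y. m 0 y * p t y + p t y * N t y)"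
  proof (rule integral_cong_ae)
    have "ae (\<lambda>x. m t x = m 0 x + N t x \<and> x \<in> {0..1})" using m_eq[OF t] by (auto intro: aeI eventually_conj)
    then show "ae (\<lambda>y. V2 t y * inverse (p t y) + V1 t y * (- q t y / (p t y)\<^sup>2) = m 0 y * p t y + p t y * N t y)"
    proof eventually_elim
      case (elim y)
      then have p: "p t y \<noteq> 0" using p_pos[OF t, of y] by auto
      have "V2 t y * inverse (p t y) + V1 t y * (- q t y / (p t y)\<^sup>2) = p t y * m t y"
        unfolding m_def e_def using p by (simp add: field_simps power2_eq_square power3_eq_cube)
      also have "\<dots> = m 0 y * p t y + p t y * N t y" using elim by (simp add: algebra_simps)
      finally show ?case .
    qed
  qed (use x in auto)
  finally show ?thesis .
qed

lemma p_initial: "x \<in> {0..1} \<Longrightarrow> p 0 x = 1" and q_initial: "ae (\<lambda>x. q 0 x = 0)"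
  using h2_unique[OF hc[of 0] h2_id initial] by auto

lemma m_initial: "ae (\<lambda>x. m 0 x = V2 0 x)"
proof -
  have "ae (\<lambda>x. q 0 x = 0 \<and> x \<in> {0..1})" using q_initial by (auto intro: aeI eventually_conj)
  then show ?thesis by eventually_elim (simp add: m_def e_def p_initial)
qed

text \<open>Both sides vanish at time 0 and have the time derivative \<open>V1 t x / p t x\<close>.
  Comparing derivatives takes the place of interchanging the time and space integrals.\<close>

lemma ln_p:
  assumes t: "t \<in> {0..1}" and x: "x \<in> {0..1}"
  shows "ln (p t x) = integral {0..x} (\<lambda>y. m 0 y * Pt t y + Qt t y)"
proof -
  have 0: "(0::real) \<in> {0..1}" by simp
  have "ln (p t x) - ln (p 0 x) = integral {0..x} (\<lambda>y. m 0 y * Pt t y + Qt t y) - integral {0..x} (\<lambda>y. m 0 y * Pt 0 y + Qt 0 y)"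
  proof (rule equal_derivatives_imp_equal[OF _ _ t])
    fix s :: real assume s: "s \<in> {0..1}"
    show "((\<lambda>s. ln (p s x)) has_real_derivative V1 s x / p s x) (at s within {0..1})"
      by (rule DERIV_cong[OF DERIV_chain2[OF DERIV_ln[OF p_pos[OF s x]] C1tD(3)[OF C1t_p s x]]]) (simp add: divide_inverse)
    have "L2deriv 0 1 (\<lambda>s y. m 0 y * Pt s y + Qt s y) (\<lambda>y. (0 * Pt s y + m 0 y * p s y) + p s y * N s y) s"
      by (intro L2deriv_add L2deriv_mult_C1t[OF L2deriv_const C1t_Pt] C1t_imp_L2deriv[OF C1t_Qt] s L2_m 0)
    from L2deriv_integral[OF this x]
    show "((\<lambda>s. integral {0..x} (\<lambda>y. m 0 y * Pt s y + Qt s y)) has_real_derivative V1 s x / p s x) (at s within {0..1})"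
      unfolding V1_over_p[OF s x] by simp
  qed
  then show ?thesis by (simp add: p_initial[OF x] Pt_def Qt_def)
qed

lemma final_eq: "ae (\<lambda>x. q 1 x / p 1 x = m 0 x * Pt 1 x + Qt 1 x)"
proof -
  have t: "(1::real) \<in> {0..1}" and 0: "(0::real) \<in> {0..1}" by simp_all
  have L: "L1 (\<lambda>y. m 0 y * Pt 1 y + Qt 1 y)"
    by (intro set_integral_add(1) L1_mult_cont L2_imp_L1[OF L2_m[OF 0]] L1_cont jcont_slice(1)[OF C1tD(1)[OF C1t_Pt] t]
        jcont_slice(1)[OF C1tD(1)[OF C1t_Qt] t])
  have 1: "prim (\<lambda>x. ln (p 1 x)) (\<lambda>x. q 1 x / p 1 x)"
    by (rule prim_ln[OF h2D(2)[OF hc[OF t]] p_pos[OF t]])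
  have 2: "prim (\<lambda>x. 0 + integral {0..x} (\<lambda>y. m 0 y * Pt 1 y + Qt 1 y)) (\<lambda>y. m 0 y * Pt 1 y + Qt 1 y)"
    by (rule prim_integral[OF L])
  show ?thesis by (rule prim_unique[OF 1 2]) (simp add: ln_p[OF t])
qed

text \<open>Rewrites the integrand so that its only rough ingredient is the time-independent
  function \<open>m 0\<close>.\<close>

lemma K_eq:
  assumes t: "t \<in> {0..1}" and x: "x \<in> {0..1}"
  shows "K t x = integral {0..x} (\<lambda>y. p t y * (m 0 y + N t y)\<^sup>2 / 2)"
  unfolding K_def
proof (rule integral_cong_ae)
  have "ae (\<lambda>x. m t x = m 0 x + N t x \<and> x \<in> {0..1})" using m_eq[OF t] by (auto intro: aeI eventually_conj)
  then show "ae (\<lambda>y. (e t y)\<^sup>2 / (2 * p t y ^ 5) = p t y * (m 0 y + N t y)\<^sup>2 / 2)"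
  proof eventually_elim
    case (elim y)
    then have p: "p t y \<noteq> 0" using p_pos[OF t, of y] by auto
    have "e t y = m t y * p t y ^ 3" using p by (simp add: m_def)
    then have "(e t y)\<^sup>2 / (2 * p t y ^ 5) = p t y * (m t y)\<^sup>2 / 2"
      using p by (simp add: field_simps power2_eq_square) (simp add: numeral_eq_Suc)
    then show ?case using elim by simp
  qed
qed (use x in auto)

end

section \<open>Bootstrapping the regularity\<close>

text \<open>\<open>J k\<close> demands \<open>k\<close> classical space derivatives, each jointly
  continuous in time and space, which is what differentiation under a time integral uses. Functions
  of x alone enter as constant curves \<open>\<lambda>_. h\<close>.\<close>

primrec J :: "nat \<Rightarrow> (real \<Rightarrow> real \<Rightarrow> real) \<Rightarrow> bool" where
  "J 0 F \<longleftrightarrow> jcont 0 1 F"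
| "J (Suc k) F \<longleftrightarrow> jcont 0 1 F \<and> (\<exists>F'. J k F' \<and>
     (\<forall>t\<in>{0..1}. \<forall>x\<in>{0..1}. (F t has_real_derivative F' t x) (at x within {0..1})))"

lemma J_jcont: "J k F \<Longrightarrow> jcont 0 1 F"
  by (cases k) simp_all

lemma J_SucI:
  assumes "jcont 0 1 F" "J k F'"
    "\<And>t x. t \<in> {0..1} \<Longrightarrow> x \<in> {0..1} \<Longrightarrow> (F t has_real_derivative F' t x) (at x within {0..1})"
  shows "J (Suc k) F"
  unfolding J.simps using assms by blast

lemma J_SucE:
  assumes "J (Suc k) F"
  obtains F' where "J k F'"
    "\<And>t x. t \<in> {0..1} \<Longrightarrow> x \<in> {0..1} \<Longrightarrow> (F t has_real_derivative F' t x) (at x within {0..1})"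
  using assms unfolding J.simps by blast

lemma J_Suc_imp: "J (Suc k) F \<Longrightarrow> J k F"
proof (induction k arbitrary: F)
  case 0
  from J_jcont[OF this] show ?case by simp
next
  case (Suc k)
  obtain F' where F': "J (Suc k) F'" "\<And>t x. t \<in> {0..1} \<Longrightarrow> x \<in> {0..1} \<Longrightarrow> (F t has_real_derivative F' t x) (at x within {0..1})"
    by (rule J_SucE[OF Suc.prems]) blast
  show ?case by (rule J_SucI[OF J_jcont[OF Suc.prems] Suc.IH[OF F'(1)] F'(2)])
qed

lemma J_mono: "k \<le> l \<Longrightarrow> J l F \<Longrightarrow> J k F"
  by (induction rule: inc_induct) (auto dest: J_Suc_imp simp del: J.simps)

lemma J_time: "continuous_on {0..1} r \<Longrightarrow> J k (\<lambda>t x. r t)"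
proof (induction k arbitrary: r)
  case 0
  then show ?case by (simp add: jcont_time)
next
  case (Suc k)
  show ?case by (rule J_SucI[OF _ Suc.IH[of "\<lambda>_. 0"]]) (simp_all add: jcont_time Suc.prems)
qed

lemma J_add: "J k F \<Longrightarrow> J k H \<Longrightarrow> J k (\<lambda>t x. F t x + H t x)"
proof (induction k arbitrary: F H)
  case 0
  then show ?case by (simp add: jcont_add)
next
  case (Suc k)
  obtain F' where F': "J k F'" "\<And>t x. t \<in> {0..1} \<Longrightarrow> x \<in> {0..1} \<Longrightarrow> (F t has_real_derivative F' t x) (at x within {0..1})"
    by (rule J_SucE[OF Suc.prems(1)]) blast
  obtain H' where H': "J k H'" "\<And>t x. t \<in> {0..1} \<Longrightarrow> x \<in> {0..1} \<Longrightarrow> (H t has_real_derivative H' t x) (at x within {0..1})"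
    by (rule J_SucE[OF Suc.prems(2)]) blast
  show ?case
    by (rule J_SucI[OF jcont_add[OF J_jcont[OF Suc.prems(1)] J_jcont[OF Suc.prems(2)]] Suc.IH[OF F'(1) H'(1)]])
      (rule DERIV_add[OF F'(2) H'(2)])
qed

lemma J_mult: "J k F \<Longrightarrow> J k H \<Longrightarrow> J k (\<lambda>t x. F t x * H t x)"
proof (induction k arbitrary: F H)
  case 0
  then show ?case by (simp add: jcont_mult)
next
  case (Suc k)
  obtain F' where F': "J k F'" "\<And>t x. t \<in> {0..1} \<Longrightarrow> x \<in> {0..1} \<Longrightarrow> (F t has_real_derivative F' t x) (at x within {0..1})"
    by (rule J_SucE[OF Suc.prems(1)]) blast
  obtain H' where H': "J k H'" "\<And>t x. t \<in> {0..1} \<Longrightarrow> x \<in> {0..1} \<Longrightarrow> (H t has_real_derivative H' t x) (at x within {0..1})"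
    by (rule J_SucE[OF Suc.prems(2)]) blast
  have "J k (\<lambda>t x. F' t x * H t x + H' t x * F t x)"
    by (rule J_add[OF Suc.IH[OF F'(1) J_Suc_imp[OF Suc.prems(2)]] Suc.IH[OF H'(1) J_Suc_imp[OF Suc.prems(1)]]])
  then show ?case
    by (rule J_SucI[OF jcont_mult[OF J_jcont[OF Suc.prems(1)] J_jcont[OF Suc.prems(2)]]])
      (rule DERIV_mult[OF F'(2) H'(2)])
qed

lemma J_cmult: "J k F \<Longrightarrow> J k (\<lambda>t x. z * F t x)"
  by (intro J_mult J_time continuous_intros)

lemma J_inverse:
  assumes "J k F" "\<And>t x. t \<in> {0..1} \<Longrightarrow> x \<in> {0..1} \<Longrightarrow> 0 < F t x"
  shows "J k (\<lambda>t x. inverse (F t x))"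
proof -
  have j: "jcont 0 1 (\<lambda>t x. inverse (F t x))" if "J l F" for l
  proof -
    have "\<forall>z\<in>{0..1} \<times> {0..1}. F (fst z) (snd z) \<noteq> 0" using assms(2) by fastforce
    then show ?thesis using J_jcont[OF that] unfolding jcont_def by (intro continuous_on_inverse)
  qed
  show ?thesis using assms(1)
  proof (induction k)
    case 0
    then show ?case using j[of 0] by simp
  next
    case (Suc k)
    obtain F' where F': "J k F'" "\<And>t x. t \<in> {0..1} \<Longrightarrow> x \<in> {0..1} \<Longrightarrow> (F t has_real_derivative F' t x) (at x within {0..1})"
      by (rule J_SucE[OF Suc.prems]) blast
    note I = Suc.IH[OF J_Suc_imp[OF Suc.prems]]
    have "J k (\<lambda>t x. (-1) * (inverse (F t x) * F' t x * inverse (F t x)))"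
      by (intro J_cmult J_mult I F'(1))
    then show ?case
    proof (rule J_SucI[OF j[OF Suc.prems]])
      fix t x :: real assume tx: "t \<in> {0..1}" "x \<in> {0..1}"
      then have "F t x \<noteq> 0" using assms(2) by force
      from DERIV_inverse'[OF F'(2)[OF tx] this]
      show "((\<lambda>x. inverse (F t x)) has_real_derivative (-1) * (inverse (F t x) * F' t x * inverse (F t x))) (at x within {0..1})"
        by simp
    qed
  qed
qed

lemma J_at: "s \<in> {0..1} \<Longrightarrow> J k F \<Longrightarrow> J k (\<lambda>_. F s)"
proof (induction k arbitrary: F)
  have j: "jcont 0 1 (\<lambda>_. F s)" if "s \<in> {0..1}" "jcont 0 1 F" for F
    using C1tD(1)[OF C1t_const[OF jcont_slice(1)[OF that(2,1)]]] .
  {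
    case 0
    then show ?case using j by simp
  next
    case (Suc k)
    obtain F' where F': "J k F'" "\<And>t x. t \<in> {0..1} \<Longrightarrow> x \<in> {0..1} \<Longrightarrow> (F t has_real_derivative F' t x) (at x within {0..1})"
      by (rule J_SucE[OF Suc.prems(2)]) blast
    show ?case
      by (rule J_SucI[OF j[OF Suc.prems(1) J_jcont[OF Suc.prems(2)]] Suc.IH[OF Suc.prems(1) F'(1)] F'(2)[OF Suc.prems(1)]])
  }
qed

lemma derivative_integral_time:
  assumes F: "jcont 0 1 F" and F': "jcont 0 1 F'"
    and d: "\<And>t x. t \<in> {0..1} \<Longrightarrow> x \<in> {0..1} \<Longrightarrow> (F t has_real_derivative F' t x) (at x within {0..1})"
    and t: "t \<in> {0..1}" and x: "x \<in> {0..1}"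
  shows "((\<lambda>x. integral {0..t} (\<lambda>s. F s x)) has_real_derivative integral {0..t} (\<lambda>s. F' s x)) (at x within {0..1})"
proof -
  have "((\<lambda>x. integral (cbox 0 t) ((\<lambda>x s. F s x) x)) has_field_derivative integral (cbox 0 t) ((\<lambda>x s. F' s x) x)) (at x within {0..1})"
  proof (rule leibniz_rule_field_derivative)
    fix y s :: real assume y: "y \<in> {0..1}"
    show "((\<lambda>y. F s y) has_field_derivative F' s y) (at y within {0..1})" if "s \<in> cbox 0 t"
      using that t y by (intro d) auto
    have "continuous_on {0..t} (\<lambda>s. F s y)"
      by (rule continuous_on_subset[OF jcont_slice(2)[OF F y]]) (use t in auto)
    then show "(\<lambda>s. F s y) integrable_on cbox 0 t" by (simp add: integrable_continuous_real)
  next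
    have "continuous_on ({0..1} \<times> cbox 0 t) (\<lambda>z. F' (snd z) (fst z))"
      using continuous_on_compose2[OF F'[unfolded jcont_def], of "{0..1} \<times> cbox 0 t" "\<lambda>z. (snd z, fst z)"] t
      by (simp add: continuous_intros image_subset_iff)
    then show "continuous_on ({0..1} \<times> cbox 0 t) (\<lambda>(x, s). F' s x)" by (simp add: case_prod_unfold)
  qed (use x in auto)
  then show ?thesis by simp
qed

lemma J_integral_time: "J k F \<Longrightarrow> J k (\<lambda>t x. integral {0..t} (\<lambda>s. F s x))"
proof (induction k arbitrary: F)
  case 0
  then show ?case using C1tD(1)[OF jcont_integral_time[of 1 F]] by simp
next
  case (Suc k)
  obtain F' where F': "J k F'" "\<And>t x. t \<in> {0..1} \<Longrightarrow> x \<in> {0..1} \<Longrightarrow> (F t has_real_derivative F' t x) (at x within {0..1})"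
    by (rule J_SucE[OF Suc.prems]) blast
  note j = J_jcont[OF Suc.prems]
  show ?case
    by (rule J_SucI[OF C1tD(1)[OF jcont_integral_time[OF j]] Suc.IH[OF F'(1)]])
      (rule derivative_integral_time[OF j J_jcont[OF F'(1)] F'(2)])
qed

section \<open>Sobolev functions and smooth factors\<close>

lemma weak_deriv_add:
  assumes "weak_deriv f f'" "weak_deriv g g'"
  shows "weak_deriv (\<lambda>x. f x + g x) (\<lambda>x. f' x + g' x)"
proof -
  obtain F where F: "prim F f'" "ae (\<lambda>x. f x = F x)" by (rule weak_deriv_imp_prim[OF assms(1)])
  obtain H where H: "prim H g'" "ae (\<lambda>x. g x = H x)" by (rule weak_deriv_imp_prim[OF assms(2)])
  have "weak_deriv (\<lambda>x. F x + H x) (\<lambda>x. f' x + g' x)"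
    by (intro prim_imp_weak_deriv prim_add F H L2_add weak_derivD(2)[OF assms(1)] weak_derivD(2)[OF assms(2)])
  moreover have "ae (\<lambda>x. f x + g x = F x + H x)" using F(2) H(2) by eventually_elim simp
  ultimately show ?thesis by (rule weak_deriv_cong) simp
qed

lemma weak_deriv_mult_C1:
  assumes f: "weak_deriv f g"
    and h: "\<And>x. x \<in> {0..1} \<Longrightarrow> (h has_real_derivative h' x) (at x within {0..1})" "continuous_on {0..1} h'"
  shows "weak_deriv (\<lambda>x. f x * h x) (\<lambda>x. g x * h x + f x * h' x)"
proof -
  obtain F where F: "prim F g" "ae (\<lambda>x. f x = F x)" by (rule weak_deriv_imp_prim[OF f])
  have ph: "prim h h'" by (rule prim_C1[OF h])
  have "weak_deriv (\<lambda>x. F x * h x) (\<lambda>x. g x * h x + F x * h' x)"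
    by (intro prim_imp_weak_deriv prim_mult F ph L2_add L2_mult_cont weak_derivD(2)[OF f] prim_cont[OF ph] L2_cont prim_cont[OF F(1)] h)
  moreover have "ae (\<lambda>x. f x * h x = F x * h x)" using F(2) by eventually_elim simp
  moreover have "ae (\<lambda>x. g x * h x + f x * h' x = g x * h x + F x * h' x)" using F(2) by eventually_elim simp
  ultimately show ?thesis by (rule weak_deriv_cong)
qed

lemma sobolev_SucE:
  assumes "sobolev (Suc k) f" obtains g where "weak_deriv f g" "sobolev k g"
  using assms by (simp only: sobolev.simps) blast

lemma sobolev_SucI: "weak_deriv f g \<Longrightarrow> sobolev k g \<Longrightarrow> sobolev (Suc k) f"
  by (simp only: sobolev.simps) blast

lemma sobolev_Suc_imp: "sobolev (Suc k) f \<Longrightarrow> sobolev k f"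
proof (induction k arbitrary: f)
  case 0
  then obtain g where "weak_deriv f g" by (rule sobolev_SucE)
  from weak_derivD(1)[OF this] show ?case by simp
next
  case (Suc k)
  obtain g where g: "weak_deriv f g" "sobolev (Suc k) g" by (rule sobolev_SucE[OF Suc.prems])
  show ?case by (rule sobolev_SucI[OF g(1) Suc.IH[OF g(2)]])
qed

lemma sobolev_add: "sobolev k f \<Longrightarrow> sobolev k g \<Longrightarrow> sobolev k (\<lambda>x. f x + g x)"
proof (induction k arbitrary: f g)
  case 0
  then show ?case by (simp add: L2_add)
next
  case (Suc k)
  obtain f' where f': "weak_deriv f f'" "sobolev k f'" by (rule sobolev_SucE[OF Suc.prems(1)])
  obtain g' where g': "weak_deriv g g'" "sobolev k g'" by (rule sobolev_SucE[OF Suc.prems(2)])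
  show ?case by (rule sobolev_SucI[OF weak_deriv_add[OF f'(1) g'(1)] Suc.IH[OF f'(2) g'(2)]])
qed

text \<open>The product rule yields \<open>g * h\<close> and \<open>f * h'\<close>. In each of them
  one factor has lost a derivative and the other is weakened to the same order, so the induction
  hypothesis covers both.\<close>

lemma sobolev_mult_J: "sobolev k f \<Longrightarrow> J k (\<lambda>_. h) \<Longrightarrow> sobolev k (\<lambda>x. f x * h x)"
proof (induction k arbitrary: f h)
  case 0
  have "continuous_on {0..1} h" using jcont_slice(1)[OF J_jcont[OF 0(2)], of 0] by simp
  then show ?case using 0(1) by (simp add: L2_mult_cont)
next
  case (Suc k)
  obtain g where g: "weak_deriv f g" "sobolev k g" by (rule sobolev_SucE[OF Suc.prems(1)])
  obtain H' where H': "J k H'" "\<And>t x. t \<in> {0..1} \<Longrightarrow> x \<in> {0..1} \<Longrightarrow> (h has_real_derivative H' t x) (at x within {0..1})"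
    by (rule J_SucE[OF Suc.prems(2)]) blast
  have h': "J k (\<lambda>_. H' 0)" by (rule J_at[OF _ H'(1)]) simp
  have "weak_deriv (\<lambda>x. f x * h x) (\<lambda>x. g x * h x + f x * H' 0 x)"
    by (rule weak_deriv_mult_C1[OF g(1) H'(2)]) (use jcont_slice(1)[OF J_jcont[OF H'(1)], of 0] in simp_all)
  then show ?case
    by (rule sobolev_SucI) (intro sobolev_add Suc.IH g(2) J_Suc_imp[OF Suc.prems(2)] sobolev_Suc_imp[OF Suc.prems(1)] h')
qed

lemma sobolev_const: "sobolev k (\<lambda>_. z)"
proof (induction k arbitrary: z)
  case (Suc k)
  have "weak_deriv (\<lambda>_. z) (\<lambda>_. 0)"
    by (intro prim_imp_weak_deriv prim_C1 L2_cont) (auto intro!: derivative_eq_intros)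
  then show ?case by (rule sobolev_SucI) (rule Suc.IH)
qed (simp add: L2_cont)

lemma J_imp_sobolev: "J k (\<lambda>_. h) \<Longrightarrow> sobolev k h"
  using sobolev_mult_J[OF sobolev_const[of k 1]] by simp

text \<open>The one-dimensional Sobolev embedding of H^(k+1) into C^k: the primitive of a function
  depends only on its almost-everywhere class, so the continuous representative of the weak
  derivative is a classical derivative.\<close>

lemma sobolev_imp_J:
  assumes "sobolev (Suc k) f" shows "\<exists>F. J k (\<lambda>_. F) \<and> ae (\<lambda>x. f x = F x)"
  using assms
proof (induction k arbitrary: f)
  case 0
  obtain g where g: "weak_deriv f g" by (rule sobolev_SucE[OF 0])
  obtain F where F: "prim F g" "ae (\<lambda>x. f x = F x)" by (rule weak_deriv_imp_prim[OF g])
  have "J 0 (\<lambda>_. F)" using C1tD(1)[OF C1t_const[OF prim_cont[OF F(1)]]] by simp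
  then show ?case using F(2) by blast
next
  case (Suc k)
  obtain g where g: "weak_deriv f g" "sobolev (Suc k) g" by (rule sobolev_SucE[OF Suc.prems])
  obtain F where F: "prim F g" "ae (\<lambda>x. f x = F x)" by (rule weak_deriv_imp_prim[OF g(1)])
  obtain H where H: "J k (\<lambda>_. H)" "ae (\<lambda>x. g x = H x)" using Suc.IH[OF g(2)] by blast
  have cH: "continuous_on {0..1} H" using jcont_slice(1)[OF J_jcont[OF H(1)], of 0] by simp
  have FH: "prim F H" by (rule prim_cong[OF F(1) refl ae_eq_sym[OF H(2)]])
  have "J (Suc k) (\<lambda>_. F)"
    by (rule J_SucI[OF C1tD(1)[OF C1t_const[OF prim_cont[OF F(1)]]] H(1)]) (rule prim_deriv[OF FH cH])
  then show ?case using F(2) by blast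
qed

section \<open>The bootstrap along the geodesic\<close>

context flow
begin

context
  fixes b :: "real \<Rightarrow> real"
  assumes cb: "continuous_on {0..1} b" and mb: "ae (\<lambda>x. m 0 x = b x)"
begin

text \<open>Exponentiating \<open>ln_p\<close> and replacing \<open>m 0\<close> by its continuous
  representative \<open>b\<close> gives a continuous integrand, to which the fundamental theorem
  applies at every point.\<close>

lemma p_derivative:
  assumes t: "t \<in> {0..1}" and x: "x \<in> {0..1}"
  shows "(p t has_real_derivative p t x * (b x * Pt t x + Qt t x)) (at x within {0..1})"
proof -
  define l where "l = (\<lambda>y. b y * Pt t y + Qt t y)"
  have cl: "continuous_on {0..1} l" unfolding l_def
    by (intro continuous_intros cb jcont_slice(1)[OF C1tD(1)[OF C1t_Pt] t] jcont_slice(1)[OF C1tD(1)[OF C1t_Qt] t])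
  have a: "ae (\<lambda>y. m 0 y * Pt t y + Qt t y = l y)" using mb by eventually_elim (simp add: l_def)
  have eq: "exp (integral {0..y} l) = p t y" if y: "y \<in> {0..1}" for y
  proof -
    have "integral {0..y} l = ln (p t y)"
      unfolding ln_p[OF t y] by (rule integral_cong_ae[OF ae_eq_sym[OF a]]) (use y in auto)
    then show ?thesis using p_pos[OF t y] by simp
  qed
  have "((\<lambda>y. exp (integral {0..y} l)) has_real_derivative exp (integral {0..x} l) * l x) (at x within {0..1})"
    by (rule DERIV_chain2[OF DERIV_exp integral_has_real_derivative[OF cl x]])
  then have "((\<lambda>y. exp (integral {0..y} l)) has_real_derivative p t x * l x) (at x within {0..1})"
    unfolding eq[OF x] .
  then have "(p t has_real_derivative p t x * l x) (at x within {0..1})"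
    by (rule has_field_derivative_transform_within[OF _ zero_less_one x]) (rule eq)
  then show ?thesis unfolding l_def .
qed

lemma W_derivative:
  assumes t: "t \<in> {0..1}" and x: "x \<in> {0..1}"
  shows "(W t has_real_derivative p t x * (b x + N t x)\<^sup>2 * (1/2) + C t * p t x) (at x within {0..1})"
proof -
  define l where "l = (\<lambda>y. p t y * (b y + N t y)\<^sup>2 * (1/2))"
  have cl: "continuous_on {0..1} l" unfolding l_def
    by (intro continuous_intros cb jcont_slice(1)[OF C1tD(1)[OF C1t_N] t] jcont_slice(1)[OF jcont_p t])
  have a: "ae (\<lambda>y. p t y * (m 0 y + N t y)\<^sup>2 / 2 = l y)" using mb by eventually_elim (simp add: l_def)
  have eq: "integral {0..y} l = K t y" if y: "y \<in> {0..1}" for y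
    unfolding K_eq[OF t y] by (rule integral_cong_ae[OF ae_eq_sym[OF a]]) (use y in auto)
  have "(K t has_real_derivative l x) (at x within {0..1})"
    by (rule has_field_derivative_transform_within[OF integral_has_real_derivative[OF cl x] zero_less_one x]) (rule eq)
  from DERIV_add[OF DERIV_add[OF this DERIV_cmult[OF h2D(8)[OF hc[OF t] x], of "C t"]] DERIV_const[of "B t"]]
  show ?thesis unfolding W_def[abs_def] l_def by simp
qed

text \<open>The space derivatives of \<open>p\<close> and \<open>W\<close> involve no function
  beyond \<open>b\<close>, \<open>p\<close>, \<open>N\<close>, their time integrals and
  \<open>C\<close>. So \<open>p\<close> and \<open>N\<close> gain one derivative as long as
  \<open>b\<close> keeps up.\<close>

lemma J_step:
  assumes "J k p" "J k N" "J k (\<lambda>_. b)"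
  shows "J (Suc k) p" "J (Suc k) N"
proof -
  have PQ: "J k Pt" "J k Qt"
    using J_integral_time[OF assms(1)] J_integral_time[OF J_mult[OF assms(1,2)]]
    unfolding Pt_def[abs_def] Qt_def[abs_def] .
  have "J k (\<lambda>t x. p t x * (b x * Pt t x + Qt t x))"
    by (intro J_mult J_add PQ assms)
  then show "J (Suc k) p" by (rule J_SucI[OF jcont_p _ p_derivative])
  have W': "J k (\<lambda>t x. p t x * (b x + N t x)\<^sup>2 * (1/2) + C t * p t x)"
    unfolding power2_eq_square by (intro J_mult J_add assms J_time continuous_C continuous_on_const)
  have "J k (\<lambda>t x. integral {0..t} (\<lambda>s. p s x * (b x + N s x)\<^sup>2 * (1/2) + C s * p s x))"
    by (rule J_integral_time[OF W'])
  then show "J (Suc k) N"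
  proof (rule J_SucI[OF C1tD(1)[OF C1t_N]])
    fix t x :: real assume tx: "t \<in> {0..1}" "x \<in> {0..1}"
    show "(N t has_real_derivative integral {0..t} (\<lambda>s. p s x * (b x + N s x)\<^sup>2 * (1/2) + C s * p s x)) (at x within {0..1})"
      using derivative_integral_time[OF jcont_W J_jcont[OF W'] W_derivative tx] unfolding N_def[abs_def] .
  qed
qed

lemma J_bootstrap: "J k (\<lambda>_. b) \<Longrightarrow> J (Suc k) p \<and> J (Suc k) N"
proof (induction k)
  case 0
  have "J 0 p" "J 0 N" using jcont_p C1tD(1)[OF C1t_N] by simp_all
  then show ?case using J_step[OF _ _ 0] by blast
next
  case (Suc k)
  then show ?case using J_step[OF _ _ Suc.prems] J_Suc_imp[OF Suc.prems] by blast
qed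

lemma J_final:
  assumes "J k (\<lambda>_. b)"
  shows "J (Suc k) (\<lambda>_ x. inverse (p 1 x))" "J (Suc k) (\<lambda>_. Qt 1)" "J (Suc k) (\<lambda>_. Pt 1)"
proof -
  have pN: "J (Suc k) p" "J (Suc k) N" using J_bootstrap[OF assms] by blast+
  have one: "(1::real) \<in> {0..1}" by simp
  show "J (Suc k) (\<lambda>_ x. inverse (p 1 x))"
    by (rule J_inverse[OF J_at[OF one pN(1)] p_pos[OF one]])
  show "J (Suc k) (\<lambda>_. Qt 1)" "J (Suc k) (\<lambda>_. Pt 1)"
    using J_at[OF one J_integral_time[OF J_mult[OF pN]]] J_at[OF one J_integral_time[OF pN(1)]]
    unfolding Pt_def[abs_def] Qt_def[abs_def] .
qed

end

lemma Pt_pos: assumes x: "x \<in> {0..1}" shows "0 < Pt 1 x"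
proof -
  have c: "continuous_on {0..1} (\<lambda>s. p s x)" by (rule jcont_slice(2)[OF jcont_p x])
  have pos: "0 < p s x" if "s \<in> {0..1}" for s by (rule p_pos[OF that x])
  have "Pt 1 x \<noteq> 0"
  proof
    assume "Pt 1 x = 0"
    then have "\<forall>s\<in>{0..1}. p s x = 0"
      unfolding Pt_def using integral_eq_0_iff[OF c zero_less_one less_imp_le[OF pos]] by blast
    then show False using pos[of 0] by simp
  qed
  moreover have "0 \<le> Pt 1 x" unfolding Pt_def
    by (intro Henstock_Kurzweil_Integration.integral_nonneg integrable_continuous_real c less_imp_le[OF pos])
  ultimately show ?thesis by simp
qed

text \<open>The argument is a loop: if \<open>b\<close> has class k, then the coefficients
  \<open>inverse (p 1 x)\<close>, \<open>Qt 1\<close> and \<open>Pt 1\<close> have class k + 1, and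
  the formula for \<open>m 0\<close> hands this back to \<open>b\<close>, up to the class
  \<open>j\<close> of \<open>\<psi>\<close>.\<close>

lemma initial_velocity_regular:
  assumes "sobolev (Suc j) (q 1)" shows "sobolev (Suc j) (V2 0)"
proof -
  obtain \<psi> where \<psi>: "J j (\<lambda>_. \<psi>)" "ae (\<lambda>x. q 1 x = \<psi> x)" using sobolev_imp_J[OF assms] by blast
  have one: "(1::real) \<in> {0..1}" by simp
  \<comment> \<open>\<open>final_eq\<close> solved for \<open>m 0\<close>, with \<open>q 1\<close>
    replaced by its representative \<open>\<psi>\<close> so that the result is continuous.\<close>
  define b where "b = (\<lambda>x. (\<psi> x * inverse (p 1 x) + (-1) * Qt 1 x) * inverse (Pt 1 x))"
  have ae: "ae (\<lambda>x. m 0 x = (q 1 x * inverse (p 1 x) + (-1) * Qt 1 x) * inverse (Pt 1 x))"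
  proof -
    have "ae (\<lambda>x. q 1 x / p 1 x = m 0 x * Pt 1 x + Qt 1 x \<and> x \<in> {0..1})"
      using final_eq by (auto intro: aeI eventually_conj)
    then show ?thesis
    proof eventually_elim
      case (elim x)
      then have "Pt 1 x \<noteq> 0" using Pt_pos[of x] by auto
      moreover have "q 1 x * inverse (p 1 x) + (-1) * Qt 1 x = m 0 x * Pt 1 x"
        using elim by (simp add: divide_inverse)
      ultimately show ?case by simp
    qed
  qed
  have mb: "ae (\<lambda>x. m 0 x = b x)" using ae \<psi>(2) by eventually_elim (simp add: b_def)
  have J0: "J 0 (\<lambda>_ x. inverse (p 1 x))" "J 0 (\<lambda>_. Qt 1)" "J 0 (\<lambda>_. Pt 1)"
  proof -
    have "J 0 p" "J 0 Pt" "J 0 Qt" using jcont_p C1tD(1)[OF C1t_Pt] C1tD(1)[OF C1t_Qt] by simp_all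
    note at = this[THEN J_at[OF one]]
    show "J 0 (\<lambda>_. Qt 1)" "J 0 (\<lambda>_. Pt 1)" by (rule at)+
    show "J 0 (\<lambda>_ x. inverse (p 1 x))" by (rule J_inverse[OF at(1) p_pos[OF one]])
  qed
  \<comment> \<open>The bound \<open>k \<le> j\<close> comes from \<open>\<psi>\<close> alone, which
    has only \<open>j\<close> classical derivatives.\<close>
  have b: "J k (\<lambda>_. b)"
    if "J k (\<lambda>_ x. inverse (p 1 x))" "J k (\<lambda>_. Qt 1)" "J k (\<lambda>_. Pt 1)" "k \<le> j" for k
    unfolding b_def by (intro J_mult J_add J_cmult J_inverse[OF that(3) Pt_pos] that J_mono[OF that(4) \<psi>(1)])
  have cb: "continuous_on {0..1} b" using jcont_slice(1)[OF J_jcont[OF b[OF J0 le0]], of 0] by simp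
  have Jb: "k \<le> j \<Longrightarrow> J k (\<lambda>_. b)" for k
  proof (induction k)
    case 0
    then show ?case by (intro b J0)
  next
    case (Suc k)
    then have "J k (\<lambda>_. b)" by simp
    from J_final[OF cb mb this] show ?case using Suc.prems by (rule b)
  qed
  note F = J_final[OF cb mb Jb[OF order_refl]]
  \<comment> \<open>The last derivative is a weak one: \<open>q 1\<close> itself replaces
    \<open>\<psi>\<close>, and the coefficients, now of class \<open>Suc j\<close>, multiply it
    within the Sobolev space.\<close>
  have "sobolev (Suc j) (\<lambda>x. (q 1 x * inverse (p 1 x) + (-1) * Qt 1 x) * inverse (Pt 1 x))"
    by (intro sobolev_mult_J sobolev_add assms F(1) J_imp_sobolev[OF J_cmult[OF F(2)]] J_inverse[OF F(3) Pt_pos])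
  from sobolev_cong_ae[OF this ae] have "sobolev (Suc j) (m 0)" .
  from sobolev_cong_ae[OF this ae_eq_sym[OF m_initial]] show ?thesis .
qed

end

section \<open>Identification of the initial tangent vector\<close>

text \<open>The velocity in \<open>geodesic\<close> is existentially quantified, so the given
  tangent vector \<open>v\<close> has to be identified with it; both second derivatives are L2
  limits of the same difference quotients.\<close>

lemma L2lim_unique:
  assumes "L2lim H h F" "L2lim H k F" "F \<noteq> bot"
  shows "ae (\<lambda>x. h x = k x)"
proof -
  have "((\<lambda>s. integral {0..1} (\<lambda>x. (H s x - H s x - (h x - k x))\<^sup>2)) \<longlongrightarrow> 0) F"
    using L2lim_diff[OF assms(1,2)] unfolding L2lim_def by blast
  then have "((\<lambda>s. integral {0..1} (\<lambda>x. (h x - k x)\<^sup>2)) \<longlongrightarrow> 0) F"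
    by (simp add: power2_commute)
  then have "integral {0..1} (\<lambda>x. (h x - k x)\<^sup>2) = 0" using assms(3) by (simp add: tendsto_const_iff)
  moreover have "L2 (\<lambda>x. h x - k x)" using assms(1,2) unfolding L2lim_def by (blast intro: L2_diff)
  ultimately have "ae (\<lambda>x. h x - k x = 0)" by (intro L2_zero_ae)
  then show ?thesis by eventually_elim simp
qed

lemma curve_derivD: "curve_deriv c t v \<Longrightarrow> v \<in> H2_0"
  unfolding curve_deriv_def by blast

theorem corollary4p14:
  fixes n :: nat and \<phi>\<^sub>0 \<phi>\<^sub>1 :: "real \<Rightarrow> real"
    and c :: "real \<Rightarrow> real \<Rightarrow> real" and v :: "real \<Rightarrow> real"
  assumes "n \<ge> 3"
    and "\<phi>\<^sub>0 = id" and "\<phi>\<^sub>0 \<in> Diff2_0"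
    and "\<phi>\<^sub>1 \<in> Diff2_0" and "sobolev n \<phi>\<^sub>1"
    and "geodesic_joining c \<phi>\<^sub>0 \<phi>\<^sub>1"
    and "curve_deriv c 0 v"
  shows "sobolev n v"
proof -
  \<comment> \<open>Two of the n derivatives of the endpoint are spent in passing to its second
    derivative, which then lies in H^(n-2) = H^(j+1), at least H1.\<close>
  define j where "j = n - 3"
  have n: "n = Suc (Suc (Suc j))" using assms(1) by (simp add: j_def)
  have geo: "geodesic c" and c0: "\<And>x. x \<in> {0..1} \<Longrightarrow> c 0 x = x" and c1: "\<And>x. x \<in> {0..1} \<Longrightarrow> c 1 x = \<phi>\<^sub>1 x"
    using assms(2,6) unfolding geodesic_joining_def by auto
  obtain V A where diff: "\<And>t. t \<in> {0..1} \<Longrightarrow> c t \<in> Diff2_0"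
    and dc: "\<And>t. t \<in> {0..1} \<Longrightarrow> curve_deriv c t (V t)" and dV: "\<And>t. t \<in> {0..1} \<Longrightarrow> curve_deriv V t (A t)"
    and cA: "curve_continuous A"
    and chr: "\<And>t. t \<in> {0..1} \<Longrightarrow> \<exists>C. christoffel (c t) (V t) (V t) C \<and> (\<forall>x\<in>{0..1}. A t x + C x = 0)"
    using geo unfolding geodesic_def by blast
  have "\<forall>t\<in>{0..1}. \<exists>pq. diffeo (c t) (fst pq) (snd pq) \<and> fst pq 0 = 1"
  proof
    fix t :: real assume "t \<in> {0..1}"
    from diff[OF this] obtain p q where "diffeo (c t) p q" "p 0 = 1" by (rule Diff2_0E)
    then show "\<exists>pq. diffeo (c t) (fst pq) (snd pq) \<and> fst pq 0 = 1" by (intro exI[of _ "(p, q)"]) simp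
  qed
  from bchoice[OF this] obtain pq where
    pq: "\<And>t. t \<in> {0..1} \<Longrightarrow> diffeo (c t) (fst (pq t)) (snd (pq t)) \<and> fst (pq t) 0 = 1" by blast
  have rep: "\<exists>f. \<forall>t\<in>{0..1}. h2 (U t) (fst (f t)) (snd (f t)) \<and> U t 0 = 0 \<and> U t 1 = 0 \<and> fst (f t) 0 = 0"
    if U: "\<And>t. t \<in> {0..1} \<Longrightarrow> U t \<in> H2_0" for U :: "real \<Rightarrow> real \<Rightarrow> real"
  proof (rule bchoice, rule ballI)
    fix t :: real assume "t \<in> {0..1}"
    from U[OF this] obtain u1 u2 where "h2 (U t) u1 u2" "U t 0 = 0" "U t 1 = 0" "u1 0 = 0" by (rule H2_0E)
    then show "\<exists>f. h2 (U t) (fst f) (snd f) \<and> U t 0 = 0 \<and> U t 1 = 0 \<and> fst f 0 = 0"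
      by (intro exI[of _ "(u1, u2)"]) simp
  qed
  obtain fV where fV: "\<And>t. t \<in> {0..1} \<Longrightarrow> h2 (V t) (fst (fV t)) (snd (fV t)) \<and> V t 0 = 0 \<and> V t 1 = 0 \<and> fst (fV t) 0 = 0"
    using rep[of V, OF curve_derivD[OF dc]] by blast
  obtain fA where fA: "\<And>t. t \<in> {0..1} \<Longrightarrow> h2 (A t) (fst (fA t)) (snd (fA t)) \<and> A t 0 = 0 \<and> A t 1 = 0 \<and> fst (fA t) 0 = 0"
    using rep[of A, OF curve_derivD[OF dV]] by blast
  have hc: "\<And>t. t \<in> {0..1} \<Longrightarrow> h2 (c t) (fst (pq t)) (snd (pq t))" using diffeoD(1) pq by blast
  have hV: "\<And>t. t \<in> {0..1} \<Longrightarrow> h2 (V t) (fst (fV t)) (snd (fV t))" using fV by blast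
  have hA: "\<And>t. t \<in> {0..1} \<Longrightarrow> h2 (A t) (fst (fA t)) (snd (fA t))" using fA by blast
  interpret flow c V A "\<lambda>t. fst (pq t)" "\<lambda>t. snd (pq t)" "\<lambda>t. fst (fV t)" "\<lambda>t. snd (fV t)" "\<lambda>t. fst (fA t)" "\<lambda>t. snd (fA t)"
  proof
    fix t :: real assume t: "t \<in> {0..1}"
    show "diffeo (c t) (fst (pq t)) (snd (pq t))" "fst (pq t) 0 = 1" using pq[OF t] by blast+
    show "h2 (V t) (fst (fV t)) (snd (fV t))" "V t 0 = 0" "V t 1 = 0" "fst (fV t) 0 = 0" using fV[OF t] by blast+
    show "h2 (A t) (fst (fA t)) (snd (fA t))" "fst (fA t) 0 = 0" using fA[OF t] by blast+
    show "L2deriv 0 1 (\<lambda>t. snd (pq t)) (snd (fV t)) t" by (rule curve_deriv_imp_L2deriv[OF hc hV[OF t] dc[OF t] t])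
    show "L2deriv 0 1 (\<lambda>t. snd (fV t)) (snd (fA t)) t" by (rule curve_deriv_imp_L2deriv[OF hV hA[OF t] dV[OF t] t])
    show "L2lim (\<lambda>t. snd (fA t)) (snd (fA t)) (at t within {0..1})" by (rule curve_continuous_imp_L2lim[OF hA cA t])
    show "\<exists>C. christoffel (c t) (V t) (V t) C \<and> (\<forall>x\<in>{0..1}. A t x + C x = 0)" by (rule chr[OF t])
  qed (rule c0)
  have 0: "(0::real) \<in> {0..1}" and 1: "(1::real) \<in> {0..1}" by simp_all
  \<comment> \<open>The weak derivatives that witness the regularity of the endpoint agree almost
    everywhere with the representatives \<open>fst (pq 1)\<close> and \<open>snd (pq 1)\<close>, so
    the latter inherit it.\<close>
  obtain g1 where g1: "weak_deriv \<phi>\<^sub>1 g1" "sobolev (Suc (Suc j)) g1"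
    by (rule sobolev_SucE[OF assms(5)[unfolded n]])
  obtain g2 where g2: "weak_deriv g1 g2" "sobolev (Suc j) g2" by (rule sobolev_SucE[OF g1(2)])
  have "weak_deriv \<phi>\<^sub>1 (fst (pq 1))"
    by (rule weak_deriv_cong[OF h2D(6)[OF hc[OF 1]] aeI]) (simp_all add: c1)
  from weak_deriv_unique[OF this g1(1)] have p1: "ae (\<lambda>x. fst (pq 1) x = g1 x)" .
  have "weak_deriv (fst (pq 1)) g2" by (rule weak_deriv_cong[OF g2(1) p1]) simp
  from weak_deriv_unique[OF h2D(7)[OF hc[OF 1]] this] have "ae (\<lambda>x. snd (pq 1) x = g2 x)" .
  from sobolev_cong_ae[OF g2(2) this] have "sobolev (Suc j) (snd (pq 1))" .
  then have V20: "sobolev (Suc j) (snd (fV 0))" by (rule initial_velocity_regular)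
  from curve_derivD[OF assms(7)] obtain v1 v2 where v: "h2 v v1 v2" by (rule H2_0E)
  have "ae (\<lambda>x. v2 x = snd (fV 0) x)"
  proof (rule L2lim_unique)
    show "L2lim (\<lambda>s x. (snd (pq s) x - snd (pq 0) x) / (s - 0)) v2 (at 0 within {0..1})"
      using curve_deriv_imp_L2deriv[OF hc v assms(7) 0] unfolding L2deriv_def by blast
    show "L2lim (\<lambda>s x. (snd (pq s) x - snd (pq 0) x) / (s - 0)) (snd (fV 0)) (at 0 within {0..1})"
      using L2deriv_q[OF 0] unfolding L2deriv_def by blast
    show "at (0::real) within {0..1} \<noteq> bot" by (simp add: trivial_limit_within islimpt_Icc)
  qed
  from sobolev_cong_ae[OF V20 this] have "sobolev (Suc j) v2" .
  then show ?thesis unfolding n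
    by (intro sobolev_SucI[OF h2D(6)[OF v]] sobolev_SucI[OF h2D(7)[OF v]])
qed

end
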